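(* Let $\mathbb K$ be $\mathbb R$ or $\mathbb C$. Let $F_i$, $i=0,\dots,n$, be a Zariski equisingular local system of pseudopolynomials at the origin in $\mathbb K^m\times\mathbb K^n$ with parameter $t\in\mathbb K^m$. Then for any $\mathbb K$-analytic function $G$ dividing $F_n$, the multiplicities $$\operatorname{mult}_{(t,0)}G=\operatorname{mult}_0G_t,\qquad G_t(x)=G(t,x),$$ are equal and independent of $t$ (for $t$ close to $0\in\mathbb K^m$).
   Context: $\mathbb K$-analytic means real analytic if $\mathbb K=\mathbb R$ and holomorphic if $\mathbb K=\mathbb C$. $F_{red}$ is the reduced (square-free) form of $F$. $\operatorname{mult}_p$ is the order of vanishing at $p$ (lowest degree of a non-zero term of the Taylor expansion at $p$). Local system of pseudopolynomials in $x=(x_1,\dots,x_n)$ at $(0,0)\in\mathbb K^m\times\mathbb K^n$ with parameter $t\in U\subset\mathbb K^m$: a family of $\mathbb K$-analytic functions $$F_i(t,x_1,\dots,x_i)=x_i^{d_i}+\sum_{j=1}^{d_i}A_{i,j}(t,x_1,\dots,x_{i-1})x_i^{d_i-j},\quad i=0,\dots,n,$$ defined on $U\times U_i$ ($U$, $U_i$ neighborhoods of the origin in $\mathbb K^m$, $\mathbb K^i$), where the coefficients $A_{i,j}$ vanish identically on $U\times\{0\}$ and $F_0$ is an analytic function of $t$ only, such that for each $i=1,\dots,n$ the discriminant of $F_{i,red}$ divides $F_{i-1}$. If $d_i=0$ this means $F_i\equiv1$, and then by convention $F_j\equiv1$ for all $j<i$. The system is Zariski equisingular if $F_0(0)\neq0$.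 *)

theory Defs
  imports "HOL-Analysis.Analysis" "Subresultants.Resultant_Prelim"
begin

section \<open>Analytic functions of finitely many variables\<close>

text \<open>
  The space of points with coordinates indexed by a finite set \<open>I\<close> is represented by the functions
  \<open>'i \<Rightarrow> 'k\<close> of which only the values on \<open>I\<close> matter: neighbourhoods are cylinders over polydiscs in
  the \<open>I\<close>-coordinates. A function with a Taylor expansion in the \<open>I\<close>-coordinates at a point is
  therefore, near that point, independent of the coordinates outside \<open>I\<close>. The dimension is thus an
  ordinary term, and functions of \<open>x\<^sub>1, \<dots>, x\<^sub>i\<close> for varying \<open>i\<close> share one type.

  The definitions are stated for any normed field \<open>'k\<close>; they are used for \<open>real\<close> and \<open>complex\<close>.
\<close>

definition polydisc :: "'i set \<Rightarrow> ('i \<Rightarrow> 'k::real_normed_field) \<Rightarrow> real \<Rightarrow> ('i \<Rightarrow> 'k) set" where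
  "polydisc I p r = {z. \<forall>j\<in>I. norm (z j - p j) < r}"

definition coord_nhds :: "'i set \<Rightarrow> ('i \<Rightarrow> 'k::real_normed_field) \<Rightarrow> ('i \<Rightarrow> 'k) filter" where
  "coord_nhds I p = (INF r\<in>{0<..}. principal (polydisc I p r))"

lemma eventually_coord_nhds:
  "eventually Q (coord_nhds I p) \<longleftrightarrow> (\<exists>r>0. \<forall>z\<in>polydisc I p r. Q z)"
proof -
  have "eventually Q (coord_nhds I p)
    \<longleftrightarrow> (\<exists>r\<in>{0<..}. eventually Q (principal (polydisc I p r)))"
    unfolding coord_nhds_def
  proof (rule eventually_INF_base)
    fix a b :: real
    assume "a \<in> {0<..}" "b \<in> {0<..}"
    then show "\<exists>x\<in>{0<..}. principal (polydisc I p x)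
        \<le> inf (principal (polydisc I p a)) (principal (polydisc I p b))"
      by (intro bexI[of _ "min a b"]) (auto simp: polydisc_def)
  qed auto
  then show ?thesis by (auto simp: eventually_principal)
qed

definition coord_open :: "'i set \<Rightarrow> ('i \<Rightarrow> 'k::real_normed_field) set \<Rightarrow> bool" where
  "coord_open I U \<longleftrightarrow> (\<forall>p\<in>U. \<forall>\<^sub>F z in coord_nhds I p. z \<in> U)"

definition multi_indices :: "'i set \<Rightarrow> ('i \<Rightarrow> nat) set" where
  "multi_indices I = {\<alpha>. \<forall>j. j \<notin> I \<longrightarrow> \<alpha> j = 0}"

definition has_taylor ::
  "'i set \<Rightarrow> (('i \<Rightarrow> 'k::real_normed_field) \<Rightarrow> 'k) \<Rightarrow> ('i \<Rightarrow> 'k) \<Rightarrow> (('i \<Rightarrow> nat) \<Rightarrow> 'k) \<Rightarrow> bool"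
  where
  "has_taylor I f p c \<longleftrightarrow>
     (\<forall>\<^sub>F z in coord_nhds I p.
        ((\<lambda>\<alpha>. c \<alpha> * (\<Prod>j\<in>I. (z j - p j) ^ \<alpha> j)) has_sum f z) (multi_indices I))"

text \<open>For \<open>'k = real\<close> this is real analyticity, for \<open>'k = complex\<close> it is holomorphy (near \<open>p\<close>).\<close>

definition K_analytic_at ::
  "'i set \<Rightarrow> (('i \<Rightarrow> 'k::real_normed_field) \<Rightarrow> 'k) \<Rightarrow> ('i \<Rightarrow> 'k) \<Rightarrow> bool" where
  "K_analytic_at I f p \<longleftrightarrow> (\<exists>c. has_taylor I f p c)"

text \<open>
  The multiplicity at \<open>p\<close>; it is \<open>\<infinity>\<close> for a function vanishing identically near \<open>p\<close>. The Taylor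
  coefficients on \<open>multi_indices I\<close> are uniquely determined, so the quantifier over \<open>c\<close> is harmless.
\<close>

definition vanishing_order ::
  "'i set \<Rightarrow> (('i \<Rightarrow> 'k::real_normed_field) \<Rightarrow> 'k) \<Rightarrow> ('i \<Rightarrow> 'k) \<Rightarrow> enat" where
  "vanishing_order I f p =
     Inf {enat (\<Sum>j\<in>I. \<alpha> j) |\<alpha> c. has_taylor I f p c \<and> \<alpha> \<in> multi_indices I \<and> c \<alpha> \<noteq> 0}"

text \<open>Divisibility of germs at the origin.\<close>

definition germ_dvd ::
  "'i set \<Rightarrow> (('i \<Rightarrow> 'k::real_normed_field) \<Rightarrow> 'k) \<Rightarrow> (('i \<Rightarrow> 'k) \<Rightarrow> 'k) \<Rightarrow> bool" where
  "germ_dvd I f g \<longleftrightarrow>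
     (\<exists>h. K_analytic_at I h (\<lambda>_. 0) \<and> (\<forall>\<^sub>F z in coord_nhds I (\<lambda>_. 0). g z = f z * h z))"

section \<open>Polynomials with analytic coefficients\<close>

text \<open>
  Let \<open>\<O>\<close> be the ring of germs at the origin of analytic functions of the \<open>I\<close>-coordinates.
  An element of \<open>\<O>[X]\<close> is represented by a function sending a point to the polynomial with
  coefficients evaluated at that point; two such functions represent the same element
  iff they agree near the origin.
\<close>

definition poly_germ :: "'i set \<Rightarrow> (('i \<Rightarrow> 'k::real_normed_field) \<Rightarrow> 'k poly) \<Rightarrow> bool" where
  "poly_germ I P \<longleftrightarrow>
     (\<forall>j. K_analytic_at I (\<lambda>z. coeff (P z) j) (\<lambda>_. 0)) \<and>
     (\<exists>N. \<forall>\<^sub>F z in coord_nhds I (\<lambda>_. 0). degree (P z) \<le> N)"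

definition poly_germ_eq ::
  "'i set \<Rightarrow> (('i \<Rightarrow> 'k::real_normed_field) \<Rightarrow> 'k poly) \<Rightarrow> (('i \<Rightarrow> 'k) \<Rightarrow> 'k poly) \<Rightarrow> bool" where
  "poly_germ_eq I P Q \<longleftrightarrow> (\<forall>\<^sub>F z in coord_nhds I (\<lambda>_. 0). P z = Q z)"

definition monic_germ :: "'i set \<Rightarrow> (('i \<Rightarrow> 'k::real_normed_field) \<Rightarrow> 'k poly) \<Rightarrow> bool" where
  "monic_germ I P \<longleftrightarrow> poly_germ I P \<and>
     (\<exists>d. \<forall>\<^sub>F z in coord_nhds I (\<lambda>_. 0). degree (P z) = d \<and> lead_coeff (P z) = 1)"

definition unit_germ :: "'i set \<Rightarrow> (('i \<Rightarrow> 'k::real_normed_field) \<Rightarrow> 'k poly) \<Rightarrow> bool" where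
  "unit_germ I P \<longleftrightarrow> poly_germ I P \<and>
     (\<exists>Q. poly_germ I Q \<and> poly_germ_eq I (\<lambda>z. P z * Q z) (\<lambda>_. 1))"

definition irreducible_germ ::
  "'i set \<Rightarrow> (('i \<Rightarrow> 'k::real_normed_field) \<Rightarrow> 'k poly) \<Rightarrow> bool" where
  "irreducible_germ I P \<longleftrightarrow>
     poly_germ I P \<and> \<not> poly_germ_eq I P (\<lambda>_. 0) \<and> \<not> unit_germ I P \<and>
     (\<forall>Q R. poly_germ I Q \<longrightarrow> poly_germ I R \<longrightarrow> poly_germ_eq I P (\<lambda>z. Q z * R z) \<longrightarrow>
        unit_germ I Q \<or> unit_germ I R)"

text \<open>
  The reduced form of a monic \<open>P = \<Prod>\<^sub>k Q\<^sub>k\<^bsup>e\<^sub>k\<^esup>\<close>, with \<open>Q\<^sub>k\<close> distinct monic irreducible and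
  \<open>e\<^sub>k \<ge> 1\<close>, is \<open>R = \<Prod>\<^sub>k Q\<^sub>k\<close>.
\<close>

definition reduced_form ::
  "'i set \<Rightarrow> (('i \<Rightarrow> 'k::real_normed_field) \<Rightarrow> 'k poly) \<Rightarrow> (('i \<Rightarrow> 'k) \<Rightarrow> 'k poly) \<Rightarrow> bool" where
  "reduced_form I P R \<longleftrightarrow>
     (\<exists>(N::nat) Q (e :: nat \<Rightarrow> nat).
        (\<forall>k<N. monic_germ I (Q k) \<and> irreducible_germ I (Q k) \<and> e k \<ge> 1) \<and>
        (\<forall>k<N. \<forall>l<N. k \<noteq> l \<longrightarrow> \<not> poly_germ_eq I (Q k) (Q l)) \<and>
        poly_germ_eq I P (\<lambda>z. \<Prod>k<N. Q k z ^ e k) \<and>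
        poly_germ_eq I R (\<lambda>z. \<Prod>k<N. Q k z))"

text \<open>Constant polynomials \<open>1\<close> and polynomials of degree 1 have discriminant 1.\<close>

definition discriminant :: "'a::field poly \<Rightarrow> 'a" where
  "discriminant p =
     (-1) ^ (degree p * (degree p - 1) div 2) * resultant p (pderiv p) / lead_coeff p"

section \<open>Local systems of pseudopolynomials\<close>

text \<open>
  A point \<open>(t, x)\<close> is \<open>case_sum t x :: nat + nat \<Rightarrow> 'k\<close>; the coordinates of \<open>t\<close> are
  \<open>t 1, \<dots>, t m\<close> and those of \<open>x\<close> are \<open>x 1, \<dots>, x i\<close>.
\<close>

definition coords :: "nat \<Rightarrow> nat \<Rightarrow> (nat + nat) set" where
  "coords m i = {1..m} <+> {1..i}"

definition monic_poly :: "nat \<Rightarrow> (nat \<Rightarrow> 'k::field) \<Rightarrow> 'k poly" where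
  "monic_poly d a = monom 1 d + (\<Sum>j=1..d. monom (a j) (d - j))"

text \<open>
  Analyticity of \<open>A i j\<close> in \<open>coords m (i - 1)\<close> at all points of \<open>U \<times> V i\<close> says that \<open>A i j\<close> is an
  analytic function on \<open>U\<close> times the projection of \<open>V i\<close> to the first \<open>i - 1\<close> coordinates.
\<close>

definition pseudopoly_system ::
  "nat \<Rightarrow> nat \<Rightarrow> (nat \<Rightarrow> 'k::real_normed_field) set \<Rightarrow> (nat \<Rightarrow> (nat \<Rightarrow> 'k) set) \<Rightarrow> (nat \<Rightarrow> nat) \<Rightarrow>
   (nat \<Rightarrow> nat \<Rightarrow> (nat + nat \<Rightarrow> 'k) \<Rightarrow> 'k) \<Rightarrow> (nat \<Rightarrow> (nat + nat \<Rightarrow> 'k) \<Rightarrow> 'k) \<Rightarrow> bool" where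
  "pseudopoly_system m n U V d A F \<longleftrightarrow>
     coord_open {1..m} U \<and> (\<lambda>_. 0) \<in> U \<and>
     (\<forall>i\<le>n. coord_open {1..i} (V i) \<and> (\<lambda>_. 0) \<in> V i) \<and>
     (\<forall>i\<le>n. \<forall>t\<in>U. \<forall>x\<in>V i. K_analytic_at (coords m i) (F i) (case_sum t x)) \<and>
     (\<forall>i\<in>{1..n}. \<forall>j\<in>{1..d i}.
        (\<forall>t\<in>U. \<forall>x\<in>V i. K_analytic_at (coords m (i - 1)) (A i j) (case_sum t x)) \<and>
        (\<forall>t\<in>U. A i j (case_sum t (\<lambda>_. 0)) = 0)) \<and>
     (\<forall>i\<in>{1..n}. \<forall>t\<in>U. \<forall>x\<in>V i.
        F i (case_sum t x) =
          x i ^ d i + (\<Sum>j=1..d i. A i j (case_sum t x) * x i ^ (d i - j))) \<and>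
     (\<forall>i\<in>{1..n}. \<exists>R.
        reduced_form (coords m (i - 1)) (\<lambda>z. monic_poly (d i) (\<lambda>j. A i j z)) R \<and>
        germ_dvd (coords m (i - 1)) (\<lambda>z. discriminant (R z)) (F (i - 1))) \<and>
     (\<forall>i\<in>{1..n}. d i = 0 \<longrightarrow> (\<forall>j<i. \<forall>t\<in>U. \<forall>x\<in>V j. F j (case_sum t x) = 1))"

definition zariski_equisingular ::
  "nat \<Rightarrow> nat \<Rightarrow> (nat \<Rightarrow> 'k::real_normed_field) set \<Rightarrow> (nat \<Rightarrow> (nat \<Rightarrow> 'k) set) \<Rightarrow> (nat \<Rightarrow> nat) \<Rightarrow>
   (nat \<Rightarrow> nat \<Rightarrow> (nat + nat \<Rightarrow> 'k) \<Rightarrow> 'k) \<Rightarrow> (nat \<Rightarrow> (nat + nat \<Rightarrow> 'k) \<Rightarrow> 'k) \<Rightarrow> bool" where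
  "zariski_equisingular m n U V d A F \<longleftrightarrow>
     pseudopoly_system m n U V d A F \<and> F 0 (\<lambda>_. 0) \<noteq> 0"

end

theory Submission
  imports Defs "HOL-Complex_Analysis.Complex_Analysis"
    "HOL-Computational_Algebra.Fundamental_Theorem_Algebra"
begin

text \<open>
  Restrict all functions to planes \<open>(t, x) = (\<tau> w, s v)\<close> with fixed directions \<open>w\<close>, \<open>v\<close>: germs become
  convergent power series in \<open>\<tau>\<close>, \<open>s\<close>, and one shows by induction on \<open>i\<close> that \<open>F\<^sub>i\<close> restricted to a generic
  plane is a power of \<open>s\<close> times a unit. For the induction step, let \<open>R\<close> be the restriction of the reduced
  form of \<open>F\<^sub>i\<close>. Its discriminant divides a power of \<open>s\<close> times a unit, so the roots of \<open>R(\<tau>, s, X)\<close> are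
  distinct for \<open>s \<noteq> 0\<close>. Lifting along a covering makes them continuous functions of \<open>\<tau>\<close> and \<open>log s\<close>; after
  the substitution \<open>s = u\<^sup>N\<close> they are functions \<open>\<phi>\<^sub>j(\<tau>, u)\<close>, holomorphic in \<open>u\<close>. A difference \<open>\<phi>\<^sub>j - \<phi>\<^sub>k\<close>
  vanishes only at \<open>u = 0\<close>, hence by Rouche's theorem its order in \<open>u\<close> does not depend on \<open>\<tau>\<close>. For a
  primitive \<open>N\<close>-th root of unity \<open>\<zeta>\<close>, the substitution \<open>u \<mapsto> \<zeta>u\<close> permutes the roots, and the terms of
  \<open>\<phi>\<^sub>j\<close> of degree less than \<open>N\<close> survive in \<open>\<phi>\<^sub>j(\<zeta>u) - \<phi>\<^sub>j(u)\<close>; so \<open>min(N, ord \<phi>\<^sub>j)\<close> does not depend on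
  \<open>\<tau>\<close> either. For generic \<open>c\<close> the sum of these numbers is the order in \<open>u\<close> of \<open>R(\<tau>, u\<^sup>N, c u\<^sup>N)\<close>. This
  order being constant, \<open>R(\<tau>, s, c s)\<close> is a power of \<open>s\<close> times a unit, and so is \<open>F\<^sub>i\<close> on the plane.

  A divisor \<open>G\<close> of \<open>F\<^sub>n\<close> has the same property on generic planes, which forces the part of least
  \<open>x\<close>-degree in its Taylor expansion to be nonzero at \<open>t = 0\<close>. Over the reals the roots are taken in
  \<open>\<complex>\<close>, through the embedding \<open>\<iota>\<close>.
\<close>

section \<open>Continuous root functions\<close>

text \<open>In \<open>\<tau>\<close> the roots are only known to be continuous; lifting and Rouche's
  theorem ask for no more. Rouche's theorem needs functions without zeros off \<open>u = 0\<close>.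
  A difference of two distinct roots is such a function, a single root need not be; hence the detour
  of comparing a root with its conjugate under \<open>u \<mapsto> \<zeta> u\<close>. The conjugate
  says nothing about degree \<open>N\<close>, but on a line \<open>X = c u^N\<close> the order of
  \<open>c u^N - \<phi>_j\<close> is at most \<open>N\<close> as soon as \<open>c\<close> differs
  from the coefficient of \<open>u^N\<close> in \<open>\<phi>_j\<close>. The slopes \<open>c\<close>
  to be avoided depend on \<open>\<tau>\<close>, so no line is good for all \<open>\<tau>\<close> at
  the outset. The remedy is that the coefficients of \<open>R(\<tau>, s, c s)\<close> are
  polynomials in \<open>c\<close>: one that vanishes for all but finitely many \<open>c\<close>
  vanishes identically. Being a power of \<open>s\<close> times a unit passes to products and to
  factors. This leads from the reduced form to \<open>F_i\<close>, which has the same irreducible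
  factors, and from \<open>F_n\<close> to \<open>G\<close>. The direction is built one coordinate at
  a time with finitely many values excluded each time; this leaves room to keep a prescribed
  polynomial in the direction nonzero, so that a given part of the Taylor series of \<open>G\<close>
  stays visible on the plane.\<close>

lemma rsquarefree_decompose_monic:
  fixes p :: "complex poly"
  assumes "rsquarefree p" "lead_coeff p = 1"
  shows "p = (\<Prod>x | poly p x = 0. [:-x, 1:])" "card {x. poly p x = 0} = degree p" "finite {x. poly p x = 0}"
proof -
  show p: "p = (\<Prod>x | poly p x = 0. [:-x, 1:])"
    using complex_poly_decompose_rsquarefree[OF assms(1)] assms(2) by simp
  have "p \<noteq> 0" using assms(2) by auto
  then show "finite {x. poly p x = 0}" by (rule poly_roots_finite)
  have "degree (\<Prod>x | poly p x = 0. [:-x, 1:]) = card {x. poly p x = 0}"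
    by (subst degree_prod_eq_sum_degree) auto
  with p show "card {x. poly p x = 0} = degree p" by simp
qed

text \<open>The modulus of a monic polynomial at \<open>x\<close> is the product of the distances
  from \<open>x\<close> to its roots, so a small value forces a nearby root. All continuity of roots
  rests on this.\<close>

lemma root_near:
  fixes p :: "complex poly"
  assumes "rsquarefree p" "lead_coeff p = 1" "0 < \<eta>" "cmod (poly p x) < \<eta> ^ degree p"
  obtains y where "poly p y = 0" "dist x y < \<eta>"
proof -
  have "\<exists>y. poly p y = 0 \<and> dist x y < \<eta>"
  proof (rule ccontr)
    assume "\<not> ?thesis"
    then have far: "\<And>y. poly p y = 0 \<Longrightarrow> \<eta> \<le> cmod (x - y)" by (force simp: dist_norm)
    have "\<eta> ^ degree p = (\<Prod>y | poly p y = 0. \<eta>)"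
      using rsquarefree_decompose_monic(2)[OF assms(1,2)] by simp
    also have "\<dots> \<le> (\<Prod>y | poly p y = 0. cmod (x - y))"
      using far assms(3) by (intro prod_mono) auto
    also have "\<dots> = cmod (poly (\<Prod>y | poly p y = 0. [:-y, 1:]) x)"
      by (simp add: poly_prod prod_norm)
    also have "\<dots> = cmod (poly p x)"
      using rsquarefree_decompose_monic(1)[OF assms(1,2)] by simp
    finally show False using assms(4) by simp
  qed
  then show ?thesis using that by blast
qed

lemma continuous_on_poly_coeff:
  fixes q :: "'b::topological_space \<Rightarrow> 'a::real_normed_field poly"
  assumes "\<And>j. continuous_on B (\<lambda>b. coeff (q b) j)" "\<And>b. b \<in> B \<Longrightarrow> degree (q b) = d"
    "continuous_on B f"
  shows "continuous_on B (\<lambda>b. poly (q b) (f b))"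
proof -
  have "continuous_on B (\<lambda>b. \<Sum>j\<le>d. coeff (q b) j * f b ^ j)"
    by (intro continuous_intros assms)
  then show ?thesis
    by (rule continuous_on_eq) (simp add: poly_altdef assms(2))
qed

lemma finite_separated:
  fixes R :: "'a::metric_space set"
  assumes "finite R"
  obtains \<eta> where "\<eta> > 0" "\<And>x y. x \<in> R \<Longrightarrow> y \<in> R \<Longrightarrow> x \<noteq> y \<Longrightarrow> 2 * \<eta> \<le> dist x y"
proof -
  \<comment> \<open>The extra element 1 keeps the minimum defined when \<open>R\<close> has fewer
    than two points.\<close>
  define D where "D = insert 1 ((\<lambda>(x,y). dist x y) ` {(x,y). x \<in> R \<and> y \<in> R \<and> x \<noteq> y})"
  have "finite ({(x,y). x \<in> R \<and> y \<in> R \<and> x \<noteq> y})"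
    by (rule finite_subset[of _ "R \<times> R"]) (use assms in auto)
  then have fin: "finite D" by (simp add: D_def)
  have pos: "Min D > 0" using fin by (subst Min_gr_iff) (auto simp: D_def)
  show ?thesis
  proof (rule that[of "Min D / 2"])
    show "Min D / 2 > 0" using pos by simp
    show "2 * (Min D / 2) \<le> dist x y" if "x \<in> R" "y \<in> R" "x \<noteq> y" for x y
      using Min_le[OF fin, of "dist x y"] that by (auto simp: D_def)
  qed
qed

locale root_family =
  fixes B :: "'b::real_normed_vector set" and q :: "'b \<Rightarrow> complex poly" and d :: nat
  assumes cont: "\<And>j. continuous_on B (\<lambda>b. coeff (q b) j)"
    and deg: "\<And>b. b \<in> B \<Longrightarrow> degree (q b) = d"
    and monic: "\<And>b. b \<in> B \<Longrightarrow> lead_coeff (q b) = 1"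
    and sqf: "\<And>b. b \<in> B \<Longrightarrow> rsquarefree (q b)"
begin

definition Z where "Z = {(b, x). b \<in> B \<and> poly (q b) x = 0}"

lemma card_roots: "b \<in> B \<Longrightarrow> card {x. poly (q b) x = 0} = d" "b \<in> B \<Longrightarrow> finite {x. poly (q b) x = 0}"
  using rsquarefree_decompose_monic[OF sqf monic] deg by auto

lemma evenly_covered:
  assumes "b0 \<in> B"
  shows "\<exists>T. b0 \<in> T \<and> openin (top_of_set B) T \<and> (\<exists>v. \<Union>v = Z \<inter> fst -` T \<and>
           (\<forall>u \<in> v. openin (top_of_set Z) u) \<and> pairwise disjnt v \<and>
           (\<forall>u \<in> v. \<exists>h. homeomorphism u T fst h))"
proof -
  define R where "R = {x. poly (q b0) x = 0}"
  have R: "finite R" "card R = d" using card_roots[OF assms] by (auto simp: R_def)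
  obtain \<eta> where \<eta>: "\<eta> > 0" "\<And>x y. x \<in> R \<Longrightarrow> y \<in> R \<Longrightarrow> x \<noteq> y \<Longrightarrow> 2 * \<eta> \<le> dist x y"
    using finite_separated[OF R(1)] by blast
  \<comment> \<open>The index 0 keeps the intersection nonempty, and \<open>T\<close> inside
    \<open>B\<close>, when \<open>R\<close> is empty; the implication voids its condition unless 0
    is itself in \<open>R\<close>.\<close>
  define T where "T = (\<Inter>x\<in>insert 0 R. {b\<in>B. x \<in> R \<longrightarrow> cmod (poly (q b) x) < \<eta> ^ d})"
  define sheet where "sheet x = {(b, y). b \<in> T \<and> poly (q b) y = 0 \<and> dist x y < \<eta>}" for x
  have TB: "T \<subseteq> B" by (auto simp: T_def)
  have b0T: "b0 \<in> T" using assms \<eta>(1) by (auto simp: T_def R_def)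
  have opT: "openin (top_of_set B) T"
    unfolding T_def
  proof (intro openin_INT2 ballI)
    fix x
    have "openin (top_of_set B) {b\<in>B. cmod (poly (q b) x) \<in> {..<\<eta> ^ d}}"
      by (intro continuous_openin_preimage_gen[unfolded vimage_def Int_def mem_Collect_eq, of B]
          continuous_on_norm continuous_on_poly_coeff[OF cont deg] continuous_intros) auto
    then show "openin (top_of_set B) {b\<in>B. x \<in> R \<longrightarrow> cmod (poly (q b) x) < \<eta> ^ d}"
      by (cases "x \<in> R") auto
  qed (use R in auto)
  have disj: "x = x'" if "x \<in> R" "x' \<in> R" "dist x y < \<eta>" "dist x' y < \<eta>" for x x' y
    using \<eta>(2)[of x x'] that dist_triangle[of x x' y] by (auto simp: dist_commute)
  have ex: "\<exists>y. poly (q b) y = 0 \<and> dist x y < \<eta>" if "b \<in> T" "x \<in> R" for b x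
  proof -
    have "b \<in> B" "cmod (poly (q b) x) < \<eta> ^ d" using that by (auto simp: T_def)
    then show ?thesis using root_near[of "q b" \<eta> x] sqf monic deg \<eta>(1) by metis
  qed
  \<comment> \<open>Each of the \<open>d\<close> disjoint discs around the points of
    \<open>R\<close> contains a root, and there are only \<open>d\<close> roots: every root lies in
    exactly one disc, and every disc holds exactly one root.\<close>
  have cover: "\<exists>!x. x \<in> R \<and> dist x y < \<eta>" and uni: "\<And>x y'. x \<in> R \<Longrightarrow> poly (q b) y' = 0 \<Longrightarrow> dist x y < \<eta> \<Longrightarrow> dist x y' < \<eta> \<Longrightarrow> y' = y"
    if b: "b \<in> T" and y: "poly (q b) y = 0" for b y
  proof -
    obtain f where f: "\<And>x. x \<in> R \<Longrightarrow> poly (q b) (f x) = 0 \<and> dist x (f x) < \<eta>"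
      using ex[OF b] by metis
    have inj: "inj_on f R" by (rule inj_onI) (metis disj f)
    have bB: "b \<in> B" using b TB by auto
    have "f ` R = {x. poly (q b) x = 0}"
      by (rule card_subset_eq) (use card_roots[OF bB] f R card_image[OF inj] in auto)
    then have im: "\<And>y. poly (q b) y = 0 \<Longrightarrow> \<exists>x\<in>R. y = f x" by blast
    show "\<exists>!x. x \<in> R \<and> dist x y < \<eta>" using im[OF y] f disj by metis
    show "y' = y" if "x \<in> R" "poly (q b) y' = 0" "dist x y < \<eta>" "dist x y' < \<eta>" for x y'
      using im[OF y] im[OF that(2)] f disj that by metis
  qed
  have openZ: "openin (top_of_set Z) (sheet x)" if "x \<in> R" for x
  proof -
    obtain W where W: "open W" "T = B \<inter> W" using opT by (auto simp: openin_open)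
    have "sheet x = Z \<inter> (W \<times> ball x \<eta>)" using W by (auto simp: sheet_def Z_def)
    then show ?thesis using openin_open_Int[OF open_Times[OF W(1) open_ball]] by simp
  qed
  have homeo: "\<exists>h. homeomorphism (sheet x) T fst h" if x: "x \<in> R" for x
  proof -
    obtain h where h: "\<And>b. b \<in> T \<Longrightarrow> poly (q b) (h b) = 0 \<and> dist x (h b) < \<eta>"
      using ex[OF _ x] by metis
    have conth: "continuous_on T h"
      unfolding continuous_on_iff
    proof (intro ballI allI impI)
      fix b1 e assume b1: "b1 \<in> T" and e: "(e::real) > 0"
      \<comment> \<open>Capping the radius at the distance to the rim keeps the root found near
        \<open>h b1\<close> inside the disc around \<open>x\<close>, where \<open>h b\<close> is the
        only root.\<close>
      define e' where "e' = min e (\<eta> - dist x (h b1))"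
      have e': "e' > 0" "e' \<le> e" "e' \<le> \<eta> - dist x (h b1)" using e h[OF b1] by (auto simp: e'_def)
      have "continuous_on T (\<lambda>b. poly (q b) (h b1))"
        using continuous_on_subset[OF continuous_on_poly_coeff[OF cont deg continuous_on_const] TB] by auto
      then obtain \<delta> where \<delta>: "\<delta> > 0" "\<And>b. b \<in> T \<Longrightarrow> dist b b1 < \<delta> \<Longrightarrow> dist (poly (q b) (h b1)) (poly (q b1) (h b1)) < e' ^ d"
        using b1 e'(1) unfolding continuous_on_iff by (metis zero_less_power)
      show "\<exists>\<delta>>0. \<forall>b\<in>T. dist b b1 < \<delta> \<longrightarrow> dist (h b) (h b1) < e"
      proof (intro exI[of _ \<delta>] conjI ballI impI \<delta>(1))
        fix b assume b: "b \<in> T" "dist b b1 < \<delta>"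
        have bB: "b \<in> B" using b TB by auto
        have "cmod (poly (q b) (h b1)) < e' ^ degree (q b)" using \<delta>(2)[OF b] h[OF b1] deg[OF bB] by simp
        then obtain y where y: "poly (q b) y = 0" "dist (h b1) y < e'"
          using root_near sqf[OF bB] monic[OF bB] e'(1) by metis
        then have "dist x y < \<eta>" using dist_triangle[of x y "h b1"] e' by linarith
        then have "y = h b" using uni[OF b(1), of "h b" x y] h[OF b(1)] x y(1) by auto
        then show "dist (h b) (h b1) < e" using y e' by (simp add: dist_commute)
      qed
    qed
    have "homeomorphism (sheet x) T fst (\<lambda>b. (b, h b))"
    proof (rule homeomorphismI)
      show "continuous_on (sheet x) fst" "continuous_on T (\<lambda>b. (b, h b))"
        by (intro continuous_intros conth)+
      show "(fst p, h (fst p)) = p" if "p \<in> sheet x" for p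
        using that uni[of "fst p" "h (fst p)" x "snd p"] h x by (auto simp: sheet_def)
    qed (use h in \<open>auto simp: sheet_def\<close>)
    then show ?thesis by blast
  qed
  show ?thesis
  proof (intro exI[of _ T] conjI b0T opT exI[of _ "sheet ` R"])
    show "\<Union>(sheet ` R) = Z \<inter> fst -` T"
    proof -
      have "\<exists>x\<in>R. dist x y < \<eta>" if "b \<in> T" "poly (q b) y = 0" for b y
        using cover[OF that] by blast
      then show ?thesis using TB by (auto simp: sheet_def Z_def)
    qed
    show "pairwise disjnt (sheet ` R)"
      unfolding pairwise_def disjnt_def using disj by (auto simp: sheet_def)
    show "\<forall>u\<in>sheet ` R. openin (top_of_set Z) u" using openZ by auto
    show "\<forall>u\<in>sheet ` R. \<exists>h. homeomorphism u T fst h" using homeo by auto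
  qed
qed

text \<open>The zero set is a covering of \<open>B\<close>, and over a simply connected base the
  identity lifts through every point of a fibre. Lifts that meet anywhere coincide, so
  \<open>d\<close> lifts that are distinct at one point stay distinct and exhaust the roots.
  Surjectivity of the projection comes from \<open>d > 0\<close>.\<close>

lemma continuous_root_functions:
  assumes "simply_connected B" "locally path_connected B" "B \<noteq> {}" "d > 0"
  obtains g where "\<And>i. i < d \<Longrightarrow> continuous_on B (g i)"
    "\<And>b. b \<in> B \<Longrightarrow> q b = (\<Prod>i<d. [:-g i b, 1:])"
    "\<And>b. b \<in> B \<Longrightarrow> inj_on (\<lambda>i. g i b) {..<d}"
proof -
  have cov: "covering_space Z fst B"
  proof
    show "continuous_on Z fst" by (intro continuous_intros)
    show "fst ` Z = B"
      using card_roots assms(4) by (force simp: Z_def image_iff card_gt_0_iff)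
  qed (use evenly_covered in auto)
  obtain z where z: "z \<in> B" using assms(3) by auto
  obtain e where e: "bij_betw e {..<d} {x. poly (q z) x = 0}"
    using card_roots[OF z] by (metis ex_bij_betw_nat_finite atLeast0LessThan)
  have "\<exists>G. continuous_on B G \<and> G \<in> B \<rightarrow> Z \<and> G z = (z, e i) \<and> (\<forall>y\<in>B. fst (G y) = y)" if "i < d" for i
  proof -
    have "(z, e i) \<in> Z" using e z that by (auto simp: Z_def bij_betw_def)
    then show ?thesis
      by (rule covering_space_lift_strong[OF cov _ z assms(1,2), of _ id]) (auto simp: continuous_on_id)
  qed
  then obtain G where G: "\<And>i. i < d \<Longrightarrow> continuous_on B (G i)" "\<And>i. i < d \<Longrightarrow> G i \<in> B \<rightarrow> Z"
    "\<And>i. i < d \<Longrightarrow> G i z = (z, e i)" "\<And>i y. i < d \<Longrightarrow> y \<in> B \<Longrightarrow> fst (G i y) = y" by metis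
  have conn: "connected B" using assms(1) simply_connected_imp_connected by blast
  define g where "g i b = snd (G i b)" for i b
  have gG: "G i b = (b, g i b)" if "i < d" "b \<in> B" for i b
    using G(4)[OF that] by (auto simp: g_def prod_eq_iff)
  have root: "poly (q b) (g i b) = 0" if "i < d" "b \<in> B" for i b
    using G(2)[OF that(1)] gG[OF that] that by (auto simp: Z_def Pi_def)
  have inj: "inj_on (\<lambda>i. g i b) {..<d}" if b: "b \<in> B" for b
  proof (rule inj_onI)
    fix i j assume ij: "i \<in> {..<d}" "j \<in> {..<d}" "g i b = g j b"
    have "G i z = G j z"
      by (rule covering_space_lift_unique[OF cov, of "G i" b "G j" B id z])
        (use G ij b z gG conn in \<open>auto simp: Pi_def continuous_on_id\<close>)
    then have "e i = e j" using G(3) ij by auto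
    then show "i = j" using e ij by (auto simp: bij_betw_def inj_on_def)
  qed
  show ?thesis
  proof (rule that)
    show "continuous_on B (g i)" if "i < d" for i
      unfolding g_def using G(1)[OF that] by (intro continuous_intros)
    show "inj_on (\<lambda>i. g i b) {..<d}" if "b \<in> B" for b by (rule inj[OF that])
    show "q b = (\<Prod>i<d. [:-g i b, 1:])" if b: "b \<in> B" for b
    proof -
      have "(\<lambda>i. g i b) ` {..<d} = {x. poly (q b) x = 0}"
        by (rule card_subset_eq) (use card_roots[OF b] root[OF _ b] card_image[OF inj[OF b]] in auto)
      then have "q b = (\<Prod>x\<in>(\<lambda>i. g i b) ` {..<d}. [:-x, 1:])"
        using rsquarefree_decompose_monic(1)[OF sqf[OF b] monic[OF b]] by simp
      also have "\<dots> = (\<Prod>i<d. [:-g i b, 1:])"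
        by (subst prod.reindex[OF inj[OF b]]) simp
      finally show ?thesis .
    qed
  qed
qed

end

text \<open>The sets where \<open>f\<close> agrees with \<open>g j\<close> are closed, finite in
  number, disjoint, and cover \<open>B\<close>. Each is therefore open as well, and connectedness
  leaves only one.\<close>

lemma root_function_unique:
  fixes g :: "nat \<Rightarrow> 'b::topological_space \<Rightarrow> complex"
  assumes "connected B" "continuous_on B f" "\<And>i. i < d \<Longrightarrow> continuous_on B (g i)"
    and root: "\<And>b. b \<in> B \<Longrightarrow> (\<Prod>i<d. f b - g i b) = 0"
    and inj: "\<And>b. b \<in> B \<Longrightarrow> inj_on (\<lambda>i. g i b) {..<d}" and "B \<noteq> {}"
  obtains j where "j < d" "\<And>b. b \<in> B \<Longrightarrow> f b = g j b"
proof -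
  define C where "C j = {b\<in>B. f b = g j b}" for j
  have closed: "closedin (top_of_set B) (C j)" if "j < d" for j
  proof -
    have "closedin (top_of_set B) {b\<in>B. f b - g j b = 0}"
      by (intro continuous_closedin_preimage_constant continuous_intros assms that)
    then show ?thesis by (simp add: C_def)
  qed
  obtain b0 where b0: "b0 \<in> B" using assms by auto
  then obtain j where j: "j < d" "f b0 = g j b0" using root[OF b0] by auto
  have "B - C j = (\<Union>i\<in>{..<d} - {j}. C i)"
  proof -
    have "\<exists>i<d. f b = g i b" if "b \<in> B" for b using root[OF that] by auto
    then show ?thesis using inj j by (fastforce simp: C_def inj_on_def)
  qed
  then have "closedin (top_of_set B) (B - C j)" using closed by (auto intro: closedin_Union)
  then have "openin (top_of_set B) (C j)"
    by (auto simp: openin_closedin_eq C_def)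
  then have "C j = B" using closed[OF j(1)] assms(1) b0 j unfolding connected_clopen C_def by blast
  then show ?thesis using that[OF j(1)] by (auto simp: C_def)
qed

lemma root_functions_holomorphic:
  fixes p :: "complex \<Rightarrow> complex poly"
  assumes "open S" and hol: "\<And>j. (\<lambda>w. coeff (p w) j) holomorphic_on S"
    and deg: "\<And>w. w \<in> S \<Longrightarrow> degree (p w) = d"
    and cont: "\<And>i. i < d \<Longrightarrow> continuous_on S (f i)"
    and split: "\<And>w. w \<in> S \<Longrightarrow> p w = (\<Prod>i<d. [:-f i w, 1:])"
    and inj: "\<And>w. w \<in> S \<Longrightarrow> inj_on (\<lambda>i. f i w) {..<d}"
    and i: "i < d"
  shows "f i holomorphic_on S"
  unfolding holomorphic_on_open[OF assms(1)]
proof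
  fix w0 assume w0: "w0 \<in> S"
  txt \<open>
    With the argument frozen at \<open>x0\<close>, the difference \<open>x0 - f i w\<close> is the quotient of a holomorphic
    function \<open>F\<close> vanishing at \<open>w0\<close> and a continuous function \<open>E\<close> that does not vanish there.
  \<close>
  define x0 where "x0 = f i w0"
  define F where "F w = poly (p w) x0" for w
  define E where "E w = (\<Prod>k\<in>{..<d}-{i}. x0 - f k w)" for w
  have "(\<lambda>w. \<Sum>j\<le>d. coeff (p w) j * x0 ^ j) holomorphic_on S"
    by (intro holomorphic_intros hol)
  then have "F holomorphic_on S"
    by (rule holomorphic_transform) (simp add: F_def poly_altdef deg)
  then obtain F' where F': "(F has_field_derivative F') (at w0)"
    using w0 assms(1) holomorphic_on_open by blast
  have FE: "F w = (x0 - f i w) * E w" if "w \<in> S" for w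
    unfolding F_def E_def using i
    by (simp add: split[OF that] poly_prod prod.remove[of "{..<d}" i] left_diff_distrib)
  have F0: "F w0 = 0" using FE[OF w0] by (simp add: x0_def)
  have Econt: "isCont E w0"
  proof -
    have "continuous_on S E" unfolding E_def by (intro continuous_intros cont) auto
    then show ?thesis using w0 assms(1) by (simp add: continuous_on_eq_continuous_at)
  qed
  have E0: "E w0 \<noteq> 0"
    unfolding E_def x0_def using inj[OF w0] i by (auto simp: inj_on_def)
  have "\<forall>\<^sub>F w in at w0. E w \<noteq> 0"
    using Econt E0 by (simp add: isCont_def tendsto_imp_eventually_ne)
  moreover have "\<forall>\<^sub>F w in at w0. w \<in> S" using w0 assms(1) by (simp add: eventually_at_in_open')
  ultimately have ev: "\<forall>\<^sub>F w in at w0. - ((F w - F w0) / (w - w0)) / E w = (f i w - f i w0) / (w - w0)"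
  proof eventually_elim
    case (elim w)
    have "F w - F w0 = (f i w0 - f i w) * E w" using elim FE[of w] F0 by (simp add: x0_def)
    then have "- ((F w - F w0) / (w - w0)) / E w = - ((f i w0 - f i w) / (w - w0))"
      using elim(1) by simp
    then show ?case by (simp add: minus_divide_left)
  qed
  have "((\<lambda>w. - ((F w - F w0) / (w - w0)) / E w) \<longlongrightarrow> - F' / E w0) (at w0)"
    using F' Econt E0 unfolding has_field_derivative_iff isCont_def by (intro tendsto_intros) auto
  then have "((\<lambda>w. (f i w - f i w0) / (w - w0)) \<longlongrightarrow> - F' / E w0) (at w0)"
    by (rule Lim_transform_eventually[OF _ ev])
  then show "\<exists>f'. (f i has_field_derivative f') (at w0)"
    unfolding has_field_derivative_iff by blast
qed

text \<open>A root with \<open>\<epsilon> \<le> |x|\<close> would satisfy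
  \<open>|x|^j \<epsilon>^d \<le> |x|^d\<close> for all \<open>j < d\<close>, where
  \<open>\<epsilon> \<le> 1\<close> is used; then the lower terms are too small to cancel
  \<open>x^d\<close>.\<close>

lemma monic_root_bound:
  fixes p :: "complex poly"
  assumes "lead_coeff p = 1" "0 < \<epsilon>" "\<epsilon> \<le> 1" "(\<Sum>j<degree p. cmod (coeff p j)) < \<epsilon> ^ degree p" "poly p x = 0"
  shows "cmod x < \<epsilon>"
proof (rule ccontr)
  assume "\<not> ?thesis"
  then have x: "\<epsilon> \<le> cmod x" by simp
  have *: "cmod (coeff p j) * cmod x ^ j * \<epsilon> ^ degree p \<le> cmod (coeff p j) * cmod x ^ degree p" if "j < degree p" for j
  proof -
    have "cmod x ^ j * \<epsilon> ^ degree p \<le> cmod x ^ j * \<epsilon> ^ (degree p - j)"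
      using assms that by (intro mult_left_mono power_decreasing) auto
    also have "\<dots> \<le> cmod x ^ j * cmod x ^ (degree p - j)"
      using x assms by (intro mult_left_mono power_mono) auto
    also have "\<dots> = cmod x ^ degree p" using that by (simp flip: power_add)
    finally show ?thesis by (simp add: mult_left_mono mult.assoc)
  qed
  have "poly p x = (\<Sum>j<degree p. coeff p j * x ^ j) + x ^ degree p"
    using assms(1) by (simp add: poly_altdef flip: lessThan_Suc_atMost)
  then have "x ^ degree p = - (\<Sum>j<degree p. coeff p j * x ^ j)"
    using assms(5) by (simp add: eq_neg_iff_add_eq_0 add.commute)
  then have "cmod x ^ degree p = cmod (\<Sum>j<degree p. coeff p j * x ^ j)"
    by (metis norm_minus_cancel norm_power)
  also have "\<dots> \<le> (\<Sum>j<degree p. cmod (coeff p j) * cmod x ^ j)"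
    by (rule order.trans[OF norm_sum]) (simp add: norm_mult norm_power)
  finally have "cmod x ^ degree p * \<epsilon> ^ degree p \<le> (\<Sum>j<degree p. cmod (coeff p j) * cmod x ^ j) * \<epsilon> ^ degree p"
    using assms by (intro mult_right_mono) auto
  also have "\<dots> \<le> (\<Sum>j<degree p. cmod (coeff p j)) * cmod x ^ degree p"
    unfolding sum_distrib_right using * by (intro sum_mono) auto
  also have "\<dots> < \<epsilon> ^ degree p * cmod x ^ degree p"
    using assms x by (intro mult_strict_right_mono zero_less_power) auto
  finally show False by (simp add: mult.commute)
qed

section \<open>Truncated orders of formal power series\<close>

definition trunc_order :: "nat \<Rightarrow> 'a::zero fps \<Rightarrow> nat" where
  "trunc_order N F = (LEAST k. k = N \<or> fps_nth F k \<noteq> 0)"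

lemma trunc_order_cong:
  fixes F G :: "'a::zero fps"
  assumes "\<And>k. k < N \<Longrightarrow> fps_nth F k = 0 \<longleftrightarrow> fps_nth G k = 0"
  shows "trunc_order N F = trunc_order N G"
proof -
  have le: "trunc_order N F \<le> trunc_order N G"
    if "\<And>k. k < N \<Longrightarrow> fps_nth F k = 0 \<longleftrightarrow> fps_nth G k = 0"  for F G :: "'a fps"
  proof -
    have "trunc_order N G = N \<or> fps_nth G (trunc_order N G) \<noteq> 0"
      unfolding trunc_order_def by (rule LeastI[of _ N]) simp
    moreover have "trunc_order N G \<le> N" unfolding trunc_order_def by (rule Least_le) simp
    ultimately have "trunc_order N G = N \<or> fps_nth F (trunc_order N G) \<noteq> 0" using that
      by (metis le_neq_implies_less)
    then show ?thesis unfolding trunc_order_def[of N F] by (intro Least_le) auto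
  qed
  show ?thesis using le[of F G] le[of G F] assms by (simp add: antisym)
qed

text \<open>\<open>subdegree\<close> gives the zero series the value 0, whereas its order should
  count as infinite; the definition by \<open>LEAST\<close> needs no such exception.\<close>

lemma trunc_order_eq_min_subdegree:
  "trunc_order N F = (if F = 0 then N else min N (subdegree F))"
proof (cases "F = 0")
  case True
  then show ?thesis by (auto simp: trunc_order_def intro: Least_equality)
next
  case False
  have "trunc_order N F = min N (subdegree F)"
    unfolding trunc_order_def
  proof (rule Least_equality)
    show "min N (subdegree F) = N \<or> fps_nth F (min N (subdegree F)) \<noteq> 0"
      using False by (auto simp: min_def)
  next
    fix y assume "y = N \<or> fps_nth F y \<noteq> 0"
    then show "min N (subdegree F) \<le> y" by (auto simp: subdegree_leI min.coboundedI2)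
  qed
  then show ?thesis using False by simp
qed

text \<open>Below degree \<open>N\<close> only \<open>F\<close> contributes, and in degree
  \<open>N\<close> the choice of \<open>c\<close> prevents cancellation.\<close>

lemma subdegree_const_mult_X_power_diff:
  fixes F :: "'a::comm_ring_1 fps"
  assumes "fps_nth F N \<noteq> c"
  shows "fps_const c * fps_X ^ N - F \<noteq> 0" "subdegree (fps_const c * fps_X ^ N - F) = trunc_order N F"
proof -
  let ?k = "trunc_order N F"
  have nz: "?k = N \<or> fps_nth F ?k \<noteq> 0"
    unfolding trunc_order_def by (rule LeastI[of _ N]) simp
  have le: "?k \<le> N" unfolding trunc_order_def by (rule Least_le) simp
  have low: "fps_nth F j = 0 \<and> j < N" if "j < ?k" for j
    using not_less_Least[OF that[unfolded trunc_order_def]] that le by auto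
  have k: "fps_nth (fps_const c * fps_X ^ N - F) ?k \<noteq> 0"
    using nz assms le by (cases "?k = N") auto
  then show "fps_const c * fps_X ^ N - F \<noteq> 0" by auto
  show "subdegree (fps_const c * fps_X ^ N - F) = ?k"
    by (rule subdegreeI[OF k]) (use low in auto)
qed

lemma subdegree_compose_X_power:
  fixes F :: "'a::idom fps"
  assumes "F \<noteq> 0" "N > 0"
  shows "subdegree (F oo fps_X ^ N) = N * subdegree F"
proof -
  define E where "E = unit_factor F"
  have F: "F = fps_X ^ subdegree F * E" "fps_nth E 0 \<noteq> 0"
    using assms(1) by (auto simp: E_def fps_unit_factor_def mult.commute subdegree_decompose)
  have X0: "fps_nth (fps_X ^ N :: 'a fps) 0 = 0" using assms(2) by simp
  have "F oo fps_X ^ N = (fps_X ^ N) ^ subdegree F * (E oo fps_X ^ N)"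
    by (subst F(1)) (simp only: fps_compose_mult_distrib[OF X0] fps_X_power_compose[OF X0])
  also have "\<dots> = fps_X ^ (N * subdegree F) * (E oo fps_X ^ N)" by (simp add: power_mult)
  finally have *: "F oo fps_X ^ N = fps_X ^ (N * subdegree F) * (E oo fps_X ^ N)" .
  have E: "fps_nth (E oo fps_X ^ N) 0 \<noteq> 0" using F(2) by simp
  then have "E oo fps_X ^ N \<noteq> 0" by (metis fps_zero_nth)
  moreover have "subdegree (E oo fps_X ^ N) = 0" using E by (simp add: subdegree_eq_0)
  ultimately show ?thesis unfolding * by simp
qed

section \<open>Puiseux expansion of the roots over a parameter\<close>

text \<open>Roots may collide only at \<open>s = 0\<close>, and there \<open>zero\<close> makes all
  of them 0, because the coefficients of a pseudopolynomial vanish on \<open>x = 0\<close>.\<close>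

locale discriminant_family =
  fixes q :: "complex \<Rightarrow> complex \<Rightarrow> complex poly" and d :: nat and r :: real
  assumes r: "r > 0" and d: "d > 0"
    and cont: "\<And>j. continuous_on (ball 0 r \<times> ball 0 r) (\<lambda>(t, s). coeff (q t s) j)"
    and hol: "\<And>j t. cmod t < r \<Longrightarrow> (\<lambda>s. coeff (q t s) j) holomorphic_on ball 0 r"
    and deg: "\<And>t s. cmod t < r \<Longrightarrow> cmod s < r \<Longrightarrow> degree (q t s) = d"
    and monic: "\<And>t s. cmod t < r \<Longrightarrow> cmod s < r \<Longrightarrow> lead_coeff (q t s) = 1"
    and sqf: "\<And>t s. cmod t < r \<Longrightarrow> cmod s < r \<Longrightarrow> s \<noteq> 0 \<Longrightarrow> rsquarefree (q t s)"
    and zero: "\<And>t. cmod t < r \<Longrightarrow> q t 0 = monom 1 d"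
begin

text \<open>The second coordinate is a logarithm of \<open>s\<close>: the half-plane is the
  universal cover of the punctured disc. Being convex, \<open>B\<close> is simply connected.\<close>

definition B :: "(complex \<times> complex) set" where
  "B = ball 0 r \<times> {w. Re w < ln r}"

lemma exp_in_ball: "Re w < ln r \<Longrightarrow> cmod (exp w) < r"
  using r by (metis exp_less_cancel_iff exp_ln norm_exp_eq_Re)

lemma exp_Re_less: "Re w < ln r \<Longrightarrow> exp (Re w) < r"
  using r by (metis exp_less_cancel_iff exp_ln)

lemma B_conv: "convex B" "B \<noteq> {}" "connected B"
proof -
  show c: "convex B" unfolding B_def by (intro convex_Times convex_ball convex_halfspace_Re_lt)
  have "(0, of_real (ln r - 1)) \<in> B" using r by (simp add: B_def)
  then show "B \<noteq> {}" by blast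
  show "connected B" using c by (rule convex_connected)
qed

lemma fam: "root_family B (\<lambda>b. q (fst b) (exp (snd b))) d"
proof
  show "continuous_on B (\<lambda>b. coeff (q (fst b) (exp (snd b))) j)" for j
  proof -
    have "continuous_on B ((\<lambda>(t, s). coeff (q t s) j) \<circ> (\<lambda>b. (fst b, exp (snd b))))"
      by (intro continuous_on_compose continuous_on_subset[OF cont] continuous_intros)
        (auto simp: B_def exp_Re_less)
    then show ?thesis by (simp add: o_def case_prod_unfold)
  qed
qed (use deg monic sqf exp_in_ball in \<open>auto simp: B_def\<close>)

definition g :: "nat \<Rightarrow> complex \<times> complex \<Rightarrow> complex" where
  "g = (SOME g. (\<forall>i<d. continuous_on B (g i)) \<and>
     (\<forall>b\<in>B. q (fst b) (exp (snd b)) = (\<Prod>i<d. [:-g i b, 1:])) \<and>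
     (\<forall>b\<in>B. inj_on (\<lambda>i. g i b) {..<d}))"

lemma g: "\<And>i. i < d \<Longrightarrow> continuous_on B (g i)"
    "\<And>b. b \<in> B \<Longrightarrow> q (fst b) (exp (snd b)) = (\<Prod>i<d. [:-g i b, 1:])"
    "\<And>b. b \<in> B \<Longrightarrow> inj_on (\<lambda>i. g i b) {..<d}"
proof -
  have "\<exists>g. (\<forall>i<d. continuous_on B (g i)) \<and>
     (\<forall>b\<in>B. q (fst b) (exp (snd b)) = (\<Prod>i<d. [:-g i b, 1:])) \<and>
     (\<forall>b\<in>B. inj_on (\<lambda>i. g i b) {..<d})"
    using root_family.continuous_root_functions[OF fam convex_imp_simply_connected[OF B_conv(1)]
        convex_imp_locally_path_connected[OF B_conv(1)] B_conv(2) d] by metis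
  from someI_ex[OF this, folded g_def]
  show "\<And>i. i < d \<Longrightarrow> continuous_on B (g i)"
    "\<And>b. b \<in> B \<Longrightarrow> q (fst b) (exp (snd b)) = (\<Prod>i<d. [:-g i b, 1:])"
    "\<And>b. b \<in> B \<Longrightarrow> inj_on (\<lambda>i. g i b) {..<d}" by auto
qed

lemma exp_shift: "exp (w + of_int k * (2 * of_real pi * \<i>)) = exp w"
proof -
  have "exp (w + of_int k * (2 * of_real pi * \<i>)) = exp w * exp (of_int (2 * k) * of_real pi * \<i>)"
    by (simp add: exp_add mult_ac)
  then show ?thesis using exp_eq by (metis add.left_neutral exp_zero mult.right_neutral of_real_mult of_real_of_int_eq)
qed

lemma in_B_shift: "(t, w + of_int k * (2 * of_real pi * \<i>)) \<in> B \<longleftrightarrow> (t, w) \<in> B"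
  by (simp add: B_def)

text \<open>The shift does not change \<open>exp w\<close>, so the shifted function is again a
  continuous root and must be one of the \<open>g j\<close>, with the same \<open>j\<close> on all
  of \<open>B\<close>. This is the monodromy of the roots.\<close>

lemma shift_root:
  assumes "i < d"
  obtains j where "j < d" "\<And>t w. (t, w) \<in> B \<Longrightarrow> g i (t, w + of_int k * (2 * of_real pi * \<i>)) = g j (t, w)"
proof -
  define f where "f b = g i (fst b, snd b + of_int k * (2 * of_real pi * \<i>))" for b
  have "continuous_on B (g i \<circ> (\<lambda>b. (fst b, snd b + of_int k * (2 * of_real pi * \<i>))))"
    by (intro continuous_on_compose continuous_on_subset[OF g(1)[OF assms]] continuous_intros)
      (use in_B_shift in auto)
  then have cf: "continuous_on B f" by (simp add: f_def o_def)
  have root: "(\<Prod>j<d. f b - g j b) = 0" if "b \<in> B" for b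
  proof -
    have b': "(fst b, snd b + of_int k * (2 * of_real pi * \<i>)) \<in> B" using that in_B_shift by (cases b) auto
    have "(\<Prod>j<d. f b - g j b) = poly (q (fst b) (exp (snd b))) (f b)"
      unfolding g(2)[OF that] by (simp add: poly_prod)
    also have "\<dots> = (\<Prod>j<d. f b - g j (fst b, snd b + of_int k * (2 * of_real pi * \<i>)))"
      using g(2)[OF b'] by (simp add: exp_shift poly_prod)
    also have "\<dots> = 0" using assms by (auto simp: f_def)
    finally show ?thesis .
  qed
  obtain j where "j < d" "\<And>b. b \<in> B \<Longrightarrow> f b = g j b"
    by (rule root_function_unique[of B f d g]) (use B_conv cf g root in auto)
  then show ?thesis by (intro that[of j]) (auto simp: f_def)
qed

text \<open>The period of a root function under \<open>w \<mapsto> w + 2\<pi>\<i>\<close> is at most \<open>d\<close>, hence divides \<open>d!\<close>.\<close>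

abbreviation N :: nat where "N \<equiv> fact d"

lemma periodic:
  assumes "i < d" "(t, w) \<in> B"
  shows "g i (t, w + of_int (int N * k) * (2 * of_real pi * \<i>)) = g i (t, w)"
proof -
  have "\<exists>\<pi>. \<forall>k::int. \<pi> k < d \<and> (\<forall>t w. (t, w) \<in> B \<longrightarrow> g i (t, w + of_int k * (2 * of_real pi * \<i>)) = g (\<pi> k) (t, w))"
  proof (rule choice, rule allI)
    fix k :: int
    show "\<exists>j. j < d \<and> (\<forall>t w. (t, w) \<in> B \<longrightarrow> g i (t, w + of_int k * (2 * of_real pi * \<i>)) = g j (t, w))"
      by (rule shift_root[OF assms(1), of k]) blast
  qed
  then obtain \<pi> where \<pi>: "\<And>k::int. \<pi> k < d"
    "\<And>(k::int) t w. (t, w) \<in> B \<Longrightarrow> g i (t, w + of_int k * (2 * of_real pi * \<i>)) = g (\<pi> k) (t, w)" by blast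
  \<comment> \<open>The shifts by 0, ..., \<open>d\<close> turns lead to only \<open>d\<close> root
    functions, so two of them agree, and their difference is a period.\<close>
  have "\<not> inj_on (\<lambda>k. \<pi> (int k)) {..d}"
  proof
    assume "inj_on (\<lambda>k. \<pi> (int k)) {..d}"
    then have "card {..d} \<le> card {..<d}" by (rule card_inj_on_le) (use \<pi> in auto)
    then show False by simp
  qed
  then obtain a' b' where "a' \<noteq> b'" "a' \<le> d" "b' \<le> d" "\<pi> (int a') = \<pi> (int b')"
    by (auto simp: inj_on_def)
  then obtain a b where ab: "a < b" "b \<le> d" "\<pi> (int a) = \<pi> (int b)"
    by (metis linorder_neqE_nat)
  define p where "p = int b - int a"
  have step: "g i (t, w + of_int p * (2 * of_real pi * \<i>)) = g i (t, w)" if "(t, w) \<in> B" for t w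
  proof -
    let ?w = "w + of_int (- int a) * (2 * of_real pi * \<i>)"
    have B': "(t, ?w) \<in> B" using that by (simp only: in_B_shift)
    have "g i (t, ?w + of_int (int b) * (2 * of_real pi * \<i>)) = g i (t, ?w + of_int (int a) * (2 * of_real pi * \<i>))"
      using \<pi>(2)[OF B', of "int a"] \<pi>(2)[OF B', of "int b"] ab(3) by simp
    then show ?thesis by (simp add: p_def algebra_simps)
  qed
  have stepn: "g i (t, w + of_int (p * int n) * (2 * of_real pi * \<i>)) = g i (t, w)" if "(t, w) \<in> B" for n t w
  proof (induction n)
    case (Suc n)
    have "(t, w + of_int (p * int n) * (2 * of_real pi * \<i>)) \<in> B" using that by (simp only: in_B_shift)
    from step[OF this] Suc show ?case by (simp add: algebra_simps)
  qed simp
  have "nat p dvd N" using ab by (intro dvd_fact) (auto simp: p_def)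
  then have "p dvd int N * \<bar>k\<bar>" using ab by (auto simp: p_def nat_dvd_iff)
  then obtain e where e: "int N * \<bar>k\<bar> = p * e" by (auto simp: dvd_def)
  have "p > 0" using ab by (simp add: p_def)
  moreover have "p * e \<ge> 0" by (simp flip: e)
  ultimately have "e \<ge> 0" by (simp add: zero_le_mult_iff)
  then have pos: "g i (t, w + of_int (int N * \<bar>k\<bar>) * (2 * of_real pi * \<i>)) = g i (t, w)" if "(t, w) \<in> B" for t w
    using stepn[OF that, of "nat e"] e by simp
  show ?thesis
  proof (cases "k \<ge> 0")
    case True
    then show ?thesis using pos[OF assms(2)] by simp
  next
    case False
    have B': "(t, w + of_int (int N * k) * (2 * of_real pi * \<i>)) \<in> B" using assms(2) by (simp only: in_B_shift)
    show ?thesis using pos[OF B'] False by (simp add: algebra_simps)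
  qed
qed

definition \<rho> :: real where "\<rho> = root N r"

lemma \<rho>: "\<rho> > 0" "\<And>u. cmod u < \<rho> \<longleftrightarrow> cmod u ^ N < r" "N > 0"
proof -
  show N: "N > 0" by simp
  show "\<rho> > 0" using r N by (simp add: \<rho>_def)
  show "cmod u < \<rho> \<longleftrightarrow> cmod u ^ N < r" for u
    using r N by (metis \<rho>_def norm_ge_zero real_root_less_iff real_root_power_cancel)
qed

text \<open>The branch cut of \<open>Ln\<close> does no harm: changing the logarithm of
  \<open>u\<close> by a multiple of \<open>2 \<pi> \<i>\<close> changes \<open>N Ln u\<close> by a
  period of \<open>g i\<close>. The value at 0 will turn out to be the limit.\<close>

definition \<phi> :: "nat \<Rightarrow> complex \<Rightarrow> complex \<Rightarrow> complex" where
  "\<phi> i t u = (if u = 0 then 0 else g i (t, of_nat N * Ln u))"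

lemma \<phi>_0 [simp]: "\<phi> i t 0 = 0" by (simp add: \<phi>_def)

lemma \<phi>_exp:
  assumes "i < d" "(t, w) \<in> B"
  shows "\<phi> i t (exp (w / of_nat N)) = g i (t, w)"
proof -
  have "exp (Ln (exp (w / of_nat N))) = exp (w / of_nat N)" by simp
  then obtain k :: int where k: "Ln (exp (w / of_nat N)) = w / of_nat N + of_int (2 * k) * pi * \<i>"
    unfolding exp_eq by auto
  have "of_nat N * Ln (exp (w / of_nat N)) = w + of_int (int N * k) * (2 * of_real pi * \<i>)"
    unfolding k by (simp add: field_simps)
  then show ?thesis using periodic[OF assms, of k] by (simp add: \<phi>_def)
qed

lemma obtain_log:
  assumes "cmod u < \<rho>" "u \<noteq> 0" "cmod t < r"
  obtains w where "(t, w) \<in> B" "u = exp (w / of_nat N)" "u ^ N = exp w"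
proof (rule that[of "of_nat N * Ln u"])
  show u: "u = exp (of_nat N * Ln u / of_nat N)" using assms by simp
  show uN: "u ^ N = exp (of_nat N * Ln u)" using assms by (metis exp_Ln exp_of_nat_mult)
  have "exp (Re (of_nat N * Ln u)) = cmod (u ^ N)" unfolding uN by simp
  also have "\<dots> < exp (ln r)" using assms(1) r \<rho>(2) by (simp add: norm_power)
  finally have "exp (Re (of_nat N * Ln u)) < exp (ln r)" .
  then have "Re (of_nat N * Ln u) < ln r" by (simp only: exp_less_cancel_iff)
  then show "(t, of_nat N * Ln u) \<in> B" using assms by (simp add: B_def)
qed

lemma split:
  assumes "cmod t < r" "cmod u < \<rho>"
  shows "q t (u ^ N) = (\<Prod>i<d. [:-\<phi> i t u, 1:])"
proof (cases "u = 0")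
  case True
  have "u ^ N = 0" using True by simp
  then show ?thesis using zero[OF assms(1)] True by (simp only:) (simp add: monom_altdef)
next
  case False
  then obtain w where w: "(t, w) \<in> B" "u = exp (w / of_nat N)" "u ^ N = exp w"
    using obtain_log assms by metis
  have "q t (u ^ N) = (\<Prod>i<d. [:-g i (t, w), 1:])" using g(2)[OF w(1)] w(3) by simp
  also have "\<dots> = (\<Prod>i<d. [:-\<phi> i t u, 1:])" using \<phi>_exp w by (intro prod.cong) auto
  finally show ?thesis .
qed

lemma \<phi>_inj:
  assumes "cmod t < r" "cmod u < \<rho>" "u \<noteq> 0" "i < d" "j < d" "\<phi> i t u = \<phi> j t u"
  shows "i = j"
proof -
  obtain w where w: "(t, w) \<in> B" "u = exp (w / of_nat N)"
    using obtain_log assms by metis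
  then show ?thesis using \<phi>_exp w g(3)[OF w(1)] assms by (auto simp: inj_on_def)
qed

definition \<zeta> :: complex where "\<zeta> = exp (2 * of_real pi * \<i> / of_nat N)"

lemma \<zeta>_power: "\<zeta> ^ k = 1 \<longleftrightarrow> N dvd k"
proof -
  have "\<zeta> ^ k = exp (2 * of_real pi * \<i> * of_nat k / of_nat N)"
    by (simp add: \<zeta>_def mult_ac flip: exp_of_nat_mult)
  then show ?thesis using complex_root_unity_eq_1[of N k] by simp
qed

text \<open>Multiplying \<open>u\<close> by \<open>\<zeta>\<close> adds \<open>2 \<pi> \<i>\<close>
  to \<open>w = N log u\<close>. It is one turn around \<open>s = 0\<close> and acts on the roots by
  monodromy.\<close>

lemma conj_root:
  assumes "i < d"
  obtains j where "j < d" "\<And>t u. cmod t < r \<Longrightarrow> cmod u < \<rho> \<Longrightarrow> \<phi> i t (\<zeta> * u) = \<phi> j t u"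
proof -
  obtain j where j: "j < d" "\<And>t w. (t, w) \<in> B \<Longrightarrow> g i (t, w + of_int 1 * (2 * of_real pi * \<i>)) = g j (t, w)"
    using shift_root[OF assms] by metis
  have "\<phi> i t (\<zeta> * u) = \<phi> j t u" if tu: "cmod t < r" "cmod u < \<rho>" for t u
  proof (cases "u = 0")
    case False
    then obtain w where w: "(t, w) \<in> B" "u = exp (w / of_nat N)"
      using obtain_log[OF tu(2) _ tu(1)] by blast
    have "\<zeta> * u = exp ((w + of_int 1 * (2 * of_real pi * \<i>)) / of_nat N)"
      by (simp add: w \<zeta>_def add_divide_distrib exp_add)
    then have "\<phi> i t (\<zeta> * u) = g i (t, w + of_int 1 * (2 * of_real pi * \<i>))"
      using \<phi>_exp[OF assms] w(1) in_B_shift by metis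
    then show ?thesis using j(2)[OF w(1)] \<phi>_exp[OF j(1) w(1)] w(2) by simp
  qed simp
  then show ?thesis using that j(1) by blast
qed

lemma g_holomorphic:
  assumes "i < d" "cmod t < r"
  shows "(\<lambda>w. g i (t, w)) holomorphic_on {w. Re w < ln r}"
proof (rule root_functions_holomorphic[where p = "\<lambda>w. q t (exp w)" and d = d])
  show "(\<lambda>w. coeff (q t (exp w)) j) holomorphic_on {w. Re w < ln r}" for j
  proof -
    have "((\<lambda>s. coeff (q t s) j) \<circ> exp) holomorphic_on {w. Re w < ln r}"
      by (rule holomorphic_on_compose_gen[OF _ hol[OF assms(2)]])
        (auto intro: holomorphic_intros simp: exp_Re_less)
    then show ?thesis by (simp add: o_def)
  qed
  have B: "(t, w) \<in> B" if "w \<in> {w. Re w < ln r}" for w using that assms by (simp add: B_def)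
  show "continuous_on {w. Re w < ln r} (\<lambda>w. g k (t, w))" if "k < d" for k
    by (rule continuous_on_compose2[OF g(1)[OF that]]) (use B in \<open>auto intro!: continuous_intros\<close>)
  show "q t (exp w) = (\<Prod>i<d. [:- g i (t, w), 1:])" if "w \<in> {w. Re w < ln r}" for w
    using g(2)[OF B[OF that]] by simp
  show "inj_on (\<lambda>i. g i (t, w)) {..<d}" if "w \<in> {w. Re w < ln r}" for w
    using g(3)[OF B[OF that]] .
qed (use assms deg exp_in_ball in \<open>auto intro: open_halfspace_Re_lt\<close>)

text \<open>As \<open>s\<close> tends to 0 the coefficients below the leading one tend to those of
  \<open>X^d\<close>, which are 0, so \<open>monic_root_bound\<close> forces the roots to 0. This
  makes the singularity at \<open>u = 0\<close> removable.\<close>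

lemma \<phi>_tendsto_0:
  assumes "i < d" "cmod t < r"
  shows "(\<phi> i t \<longlongrightarrow> 0) (at 0)"
proof (rule tendstoI)
  fix e :: real assume e: "e > 0"
  define \<epsilon> where "\<epsilon> = min e 1"
  have \<epsilon>: "0 < \<epsilon>" "\<epsilon> \<le> 1" "\<epsilon> \<le> e" using e by (auto simp: \<epsilon>_def)
  have "continuous_on (ball 0 r) (\<lambda>s. \<Sum>j<d. cmod (coeff (q t s) j))"
    by (intro continuous_intros holomorphic_on_imp_continuous_on hol assms)
  then have "isCont (\<lambda>s. \<Sum>j<d. cmod (coeff (q t s) j)) 0"
    using r by (simp add: continuous_on_eq_continuous_at)
  moreover have "(\<Sum>j<d. cmod (coeff (q t 0) j)) = 0" by (simp add: zero[OF assms(2)])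
  ultimately have "((\<lambda>s. \<Sum>j<d. cmod (coeff (q t s) j)) \<longlongrightarrow> 0) (nhds 0)"
    using tendsto_at_iff_tendsto_nhds[of "\<lambda>s. \<Sum>j<d. cmod (coeff (q t s) j)" 0]
    by (simp only: isCont_def)
  moreover have "filterlim (\<lambda>u. u ^ N) (nhds 0) (at (0::complex))"
  proof -
    have "((\<lambda>u. u ^ N) \<longlongrightarrow> 0 ^ N) (at (0::complex))" by (intro tendsto_intros)
    moreover have "(0::complex) ^ N = 0" by simp
    ultimately show ?thesis by (simp only:)
  qed
  ultimately have "((\<lambda>u. \<Sum>j<d. cmod (coeff (q t (u ^ N)) j)) \<longlongrightarrow> 0) (at 0)"
    by (rule filterlim_compose)
  then have "\<forall>\<^sub>F u in at 0. (\<Sum>j<d. cmod (coeff (q t (u ^ N)) j)) < \<epsilon> ^ d"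
    by (rule order_tendstoD) (use \<epsilon> in simp)
  moreover have "\<forall>\<^sub>F u in at 0. u \<in> ball 0 \<rho>" using \<rho>(1) by (intro eventually_at_in_open') auto
  ultimately show "\<forall>\<^sub>F u in at 0. dist (\<phi> i t u) 0 < e"
  proof eventually_elim
    case (elim u)
    have u: "cmod (u ^ N) < r" "cmod u < \<rho>" using elim \<rho>(2) by (auto simp: norm_power)
    have "poly (q t (u ^ N)) (\<phi> i t u) = 0"
      unfolding split[OF assms(2) u(2)] using assms(1) by (auto simp: poly_prod)
    then have "cmod (\<phi> i t u) < \<epsilon>"
      using monic_root_bound[of "q t (u ^ N)" \<epsilon> "\<phi> i t u"] monic[OF assms(2) u(1)] deg[OF assms(2) u(1)] \<epsilon> elim
      by simp
    then show ?case using \<epsilon> by simp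
  qed
qed

lemma \<phi>_holomorphic:
  assumes "i < d" "cmod t < r"
  shows "\<phi> i t holomorphic_on ball 0 \<rho>"
proof (rule no_isolated_singularity'[where K = "{0}"])
  show "(\<phi> i t \<longlongrightarrow> \<phi> i t z) (at z within ball 0 \<rho>)" if "z \<in> {0}" for z
    using tendsto_within_subset[OF \<phi>_tendsto_0[OF assms]] that by auto
  have op: "open (ball 0 \<rho> - {0 :: complex})" by auto
  show "\<phi> i t holomorphic_on ball 0 \<rho> - {0}"
    unfolding holomorphic_on_open[OF op]
  proof
    fix u0 :: complex assume u0: "u0 \<in> ball 0 \<rho> - {0}"
    \<comment> \<open>A branch of \<open>N log u\<close> that is holomorphic near \<open>u0\<close>;
      \<open>of_nat N * Ln u\<close> itself fails on the cut.\<close>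
    define l where "l u = of_nat N * (Ln (u / u0) + Ln u0)" for u
    have lexp: "exp (l u / of_nat N) = u" if "u \<noteq> 0" for u
      using that u0 by (simp add: l_def exp_add)
    have lB: "(t, l u) \<in> B" if "u \<in> ball 0 \<rho> - {0}" for u
    proof -
      have "cmod (exp (l u / of_nat N)) ^ N = cmod (exp (of_nat N * (l u / of_nat N)))"
        by (simp only: norm_power exp_of_nat_mult)
      then have "exp (Re (l u)) = cmod (exp (l u / of_nat N)) ^ N" by simp
      also have "\<dots> < exp (ln r)" using lexp that r \<rho>(2)[of u] by simp
      finally have "Re (l u) < ln r" by (simp only: exp_less_cancel_iff)
      then show ?thesis using assms by (simp add: B_def)
    qed
    define S where "S = (ball 0 \<rho> - {0}) \<inter> (\<lambda>u. u / u0) -` (- \<real>\<^sub>\<le>\<^sub>0)"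
    have S: "open S" unfolding S_def
      using u0 by (intro open_Int op open_vimage open_Compl closed_nonpos_Reals_complex continuous_intros) auto
    have "l holomorphic_on S" unfolding l_def S_def
      using u0 by (intro holomorphic_intros) auto
    then have "((\<lambda>w. g i (t, w)) \<circ> l) holomorphic_on S"
      by (rule holomorphic_on_compose_gen[OF _ g_holomorphic[OF assms]])
        (use lB in \<open>auto simp: S_def B_def\<close>)
    then have "\<phi> i t holomorphic_on S"
      by (rule holomorphic_transform) (use \<phi>_exp[OF assms(1) lB] lexp in \<open>auto simp: S_def\<close>)
    moreover have "u0 \<in> S" using u0 by (simp add: S_def)
    ultimately show "\<exists>f'. (\<phi> i t has_field_derivative f') (at u0)"
      using S by (auto simp: holomorphic_on_open)
  qed
qed auto

definition \<Phi> :: "nat \<Rightarrow> complex \<Rightarrow> complex fps" where "\<Phi> i t = fps_expansion (\<phi> i t) 0"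

lemma \<Phi>:
  assumes "i < d" "cmod t < r"
  shows "\<phi> i t has_fps_expansion \<Phi> i t"
proof -
  have "\<phi> i t analytic_on {0}"
    using \<phi>_holomorphic[OF assms] \<rho>(1) by (auto simp: analytic_at intro!: exI[of _ "ball 0 \<rho>"])
  from analytic_at_imp_has_fps_expansion_0[OF this] show ?thesis by (simp add: \<Phi>_def)
qed

end

section \<open>Orders in u that do not depend on the parameter\<close>

context discriminant_family begin

text \<open>Distinct roots meet only at \<open>u = 0\<close>, so the order of the difference there
  equals the number of all its zeros inside a circle. The comparison of \<open>t\<close> with 0 that
  Rouche's theorem needs on the circle comes from compactness.\<close>

lemma difference_order_constant:
  assumes ij: "i < d" "j < d" "i \<noteq> j"
  obtains k \<epsilon> where "\<epsilon> > 0" "\<epsilon> \<le> r"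
    "\<And>t. cmod t < \<epsilon> \<Longrightarrow> \<Phi> i t - \<Phi> j t \<noteq> 0 \<and> subdegree (\<Phi> i t - \<Phi> j t) = k"
proof -
  define R where "R = \<rho> / 2"
  have R: "R > 0" "R < \<rho>" using \<rho>(1) by (auto simp: R_def)
  \<comment> \<open>Joint continuity is known for \<open>g\<close> as a function of \<open>t\<close>
    and \<open>w\<close>, not for \<open>\<phi>\<close>. The circle of radius \<open>R\<close> is
    therefore replaced by a compact segment of logarithms \<open>w\<close> that maps onto it; its
    height \<open>2 \<pi> N\<close> is one turn of \<open>u\<close> and \<open>N\<close> turns of
    \<open>s\<close>.\<close>
  define K where "K = Complex (of_nat N * ln R) ` {- (pi * N)..pi * N}"
  have K: "compact K"
  proof -
    have "K = (\<lambda>y. of_real (of_nat N * ln R) + \<i> * of_real y) ` {- (pi * N)..pi * N}"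
      unfolding K_def by (intro image_cong refl) (simp add: complex_eq_iff)
    then show ?thesis
      by (simp only:) (intro compact_continuous_image continuous_intros compact_Icc)
  qed
  have K_exp: "\<exists>w\<in>K. u = exp (w / of_nat N)" if "cmod u = R" for u
  proof
    have "u \<noteq> 0" using that R by auto
    then show "u = exp (of_nat N * Ln u / of_nat N)" by simp
    have "Im (of_nat N * Ln u) \<in> {- (pi * N)..pi * N}"
    proof -
      have "\<bar>Im (Ln u)\<bar> \<le> pi"
        using Im_Ln_le_pi[OF \<open>u \<noteq> 0\<close>] mpi_less_Im_Ln[OF \<open>u \<noteq> 0\<close>] by linarith
      then have "\<bar>real N * Im (Ln u)\<bar> \<le> pi * real N"
        by (simp add: abs_mult mult.commute[of pi] mult_left_mono)
      moreover have "Im (of_nat N * Ln u) = real N * Im (Ln u)" by simp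
      ultimately show ?thesis
        by (intro iffD2[OF atLeastAtMost_iff] conjI) linarith+
    qed
    moreover have "of_nat N * Ln u = Complex (of_nat N * ln R) (Im (of_nat N * Ln u))"
      using that \<open>u \<noteq> 0\<close> by (simp add: complex_eq_iff)
    ultimately show "of_nat N * Ln u \<in> K" unfolding K_def by blast
  qed
  have "of_nat N * ln R < ln r"
  proof -
    have "R ^ N < r" using \<rho>(2)[of "of_real R"] R by simp
    then have "ln (R ^ N) < ln r" using R r by (subst ln_less_cancel_iff) auto
    then show ?thesis using R by (simp add: ln_realpow)
  qed
  then have KB: "cball 0 (r / 2) \<times> K \<subseteq> B" using r by (auto simp: B_def K_def)
  define D where "D = (\<lambda>p. g i p - g j p)"
  have Dcont: "continuous_on (cball 0 (r / 2) \<times> K) D" unfolding D_def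
    by (intro continuous_intros continuous_on_subset[OF g(1) KB] ij)
  have D0: "D p \<noteq> 0" if "p \<in> B" for p
    using g(3)[OF that] ij by (auto simp: D_def inj_on_def)
  have z0: "0 \<in> cball 0 (r / 2)" using r by simp
  obtain m where m: "m > 0" "\<And>w. w \<in> K \<Longrightarrow> m \<le> cmod (D (0, w))"
  proof -
    have "continuous_on K (\<lambda>w. cmod (D (0, w)))"
      using z0 by (intro continuous_on_norm continuous_on_compose2[OF Dcont] continuous_intros) auto
    moreover have "K \<noteq> {}" by (auto simp: K_def)
    ultimately obtain w where w: "w \<in> K" "\<And>v. v \<in> K \<Longrightarrow> cmod (D (0, w)) \<le> cmod (D (0, v))"
      using continuous_attains_inf[OF K] by blast
    show ?thesis
    proof (rule that[of "cmod (D (0, w))"])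
      have "(0, w) \<in> B" using w z0 KB by blast
      then show "cmod (D (0, w)) > 0" using D0 by simp
    qed (use w in auto)
  qed
  have "uniformly_continuous_on (cball 0 (r / 2) \<times> K) D"
    by (intro compact_uniformly_continuous Dcont compact_Times compact_cball K)
  then obtain \<eta> where \<eta>: "\<eta> > 0" "\<And>p p'. p \<in> cball 0 (r / 2) \<times> K \<Longrightarrow> p' \<in> cball 0 (r / 2) \<times> K \<Longrightarrow>
      dist p' p < \<eta> \<Longrightarrow> dist (D p') (D p) < m"
    using m(1) unfolding uniformly_continuous_on_def by metis
  define \<epsilon> where "\<epsilon> = min \<eta> (r / 2)"
  have \<epsilon>: "\<epsilon> > 0" "\<epsilon> \<le> r" using \<eta> r by (auto simp: \<epsilon>_def)
  define \<delta> where "\<delta> t u = \<phi> i t u - \<phi> j t u" for t u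
  have \<delta>hol: "\<delta> t holomorphic_on ball 0 \<rho>" if "cmod t < r" for t
    unfolding \<delta>_def by (intro holomorphic_intros \<phi>_holomorphic ij that)
  have \<delta>zero: "{u \<in> ball 0 \<rho>. \<delta> t u = 0} = {0}" if "cmod t < r" for t
    using \<phi>_inj[OF that] ij \<rho>(1) by (auto simp: \<delta>_def)
  have exps: "\<delta> t has_fps_expansion \<Phi> i t - \<Phi> j t" if "cmod t < r" for t
    unfolding \<delta>_def using \<Phi> ij that by (intro fps_expansion_intros)
  have nz: "\<Phi> i t - \<Phi> j t \<noteq> 0" if "cmod t < r" for t
  proof
    assume "\<Phi> i t - \<Phi> j t = 0"
    then have "\<delta> t has_fps_expansion 0" using exps[OF that] by simp
    then have "\<forall>\<^sub>F u in nhds 0. \<delta> t u = 0" by (auto simp: has_fps_expansion_def)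
    then obtain e where e: "e > 0" "\<And>u. dist u 0 < e \<Longrightarrow> \<delta> t u = 0"
      unfolding eventually_nhds_metric by blast
    define u where "u = complex_of_real (min e \<rho> / 2)"
    have "\<delta> t u = 0" by (rule e(2)) (use e \<rho>(1) in \<open>auto simp: u_def norm_divide\<close>)
    moreover have "u \<in> ball 0 \<rho>" "u \<noteq> 0" using e \<rho>(1) by (auto simp: u_def norm_divide)
    ultimately show False using \<delta>zero[OF that] by blast
  qed
  have zord: "zorder (\<delta> t) 0 = int (subdegree (\<Phi> i t - \<Phi> j t))" if "cmod t < r" for t
    by (rule has_fps_expansion_zorder_0[OF exps[OF that] nz[OF that]])
  have eq: "zorder (\<delta> t) 0 = zorder (\<delta> 0) 0" if t: "cmod t < \<epsilon>" for t
  proof -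
    have tr: "cmod t < r" "cmod 0 < r" "t \<in> cball 0 (r / 2)" using t r by (auto simp: \<epsilon>_def)
    have fg: "(\<lambda>p. \<delta> 0 p + (\<delta> t p - \<delta> 0 p)) = \<delta> t" by auto
    let ?\<gamma> = "circlepath 0 R"
    have w1: "winding_number ?\<gamma> 0 = 1" using R by (simp add: winding_number_circlepath_centre)
    have "(\<Sum>p\<in>{p \<in> ball 0 \<rho>. \<delta> 0 p + (\<delta> t p - \<delta> 0 p) = 0}. winding_number ?\<gamma> p * zorder (\<lambda>p. \<delta> 0 p + (\<delta> t p - \<delta> 0 p)) p)
      = (\<Sum>p\<in>{p \<in> ball 0 \<rho>. \<delta> 0 p = 0}. winding_number ?\<gamma> p * zorder (\<delta> 0) p)"
    proof (rule Rouche_theorem)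
      show "\<forall>z\<in>path_image ?\<gamma>. cmod (\<delta> t z - \<delta> 0 z) < cmod (\<delta> 0 z)"
      proof
        fix z assume "z \<in> path_image ?\<gamma>"
        then have "cmod z = R" using R by simp
        then obtain w where w: "w \<in> K" "z = exp (w / of_nat N)" using K_exp by blast
        have B: "(t, w) \<in> B" "(0, w) \<in> B" using KB w tr z0 by auto
        have \<delta>D: "\<delta> t z = D (t, w)" "\<delta> 0 z = D (0, w)"
          using \<phi>_exp[OF ij(1)] \<phi>_exp[OF ij(2)] B w(2) by (auto simp: \<delta>_def D_def)
        have "dist (D (t, w)) (D (0, w)) < m"
          by (rule \<eta>(2)) (use tr z0 w t in \<open>auto simp: \<epsilon>_def dist_Pair_Pair\<close>)
        then show "cmod (\<delta> t z - \<delta> 0 z) < cmod (\<delta> 0 z)"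
          using m(2)[OF w(1)] \<delta>D by (simp add: dist_norm)
      qed
      show "\<forall>z. z \<notin> ball 0 \<rho> \<longrightarrow> winding_number ?\<gamma> z = 0"
        using R by (auto intro!: winding_number_zero_outside[of _ "ball 0 \<rho>"])
      show "finite {p \<in> ball 0 \<rho>. \<delta> 0 p = 0}" unfolding \<delta>zero[OF tr(2)] by simp
      show "finite {p \<in> ball 0 \<rho>. \<delta> 0 p + (\<delta> t p - \<delta> 0 p) = 0}" using \<delta>zero[OF tr(1)] by simp
      show "(\<lambda>p. \<delta> t p - \<delta> 0 p) holomorphic_on ball 0 \<rho>"
        by (intro holomorphic_intros \<delta>hol tr)
    qed (use R \<delta>hol[OF tr(2)] in auto)
    then show ?thesis unfolding fg using \<delta>zero[OF tr(1)] \<delta>zero[OF tr(2)] w1 by simp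
  qed
  show ?thesis
  proof (rule that[OF \<epsilon>])
    fix t assume t: "cmod t < \<epsilon>"
    then have "cmod t < r" "cmod 0 < r" using \<epsilon> r by auto
    then show "\<Phi> i t - \<Phi> j t \<noteq> 0 \<and> subdegree (\<Phi> i t - \<Phi> j t) = subdegree (\<Phi> i 0 - \<Phi> j 0)"
      using nz eq[OF t] zord by auto
  qed
qed

text \<open>With \<open>j\<close> the conjugate of \<open>i\<close>, the coefficient of degree
  \<open>k\<close> in the difference is \<open>(1 - \<zeta>^k)\<close> times that of
  \<open>\<Phi> i t\<close>, and the factor is nonzero for \<open>0 < k < N\<close>. In degree 0
  both sides vanish. Thus the order of a single root, cut off at \<open>N\<close>, is read off from
  a difference of roots.\<close>

lemma trunc_order_constant:
  assumes i: "i < d"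
  obtains M \<epsilon> where "\<epsilon> > 0" "\<epsilon> \<le> r" "\<And>t. cmod t < \<epsilon> \<Longrightarrow> trunc_order N (\<Phi> i t) = M"
proof -
  obtain j where j: "j < d" "\<And>t u. cmod t < r \<Longrightarrow> cmod u < \<rho> \<Longrightarrow> \<phi> i t (\<zeta> * u) = \<phi> j t u"
    using conj_root[OF i] by blast
  have nth: "fps_nth (\<Phi> j t) k = \<zeta> ^ k * fps_nth (\<Phi> i t) k" if t: "cmod t < r" for t k
  proof -
    have lin: "(\<lambda>u. \<zeta> * u) has_fps_expansion fps_const \<zeta> * fps_X"
      by (intro fps_expansion_intros)
    have "(\<phi> i t \<circ> (\<lambda>u. \<zeta> * u)) has_fps_expansion (\<Phi> i t oo (fps_const \<zeta> * fps_X))"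
      by (rule has_fps_expansion_compose[OF \<Phi>[OF i t] lin]) simp
    moreover have "\<forall>\<^sub>F u in nhds 0. u \<in> ball (0::complex) \<rho>"
      using \<rho>(1) by (intro eventually_nhds_in_open) auto
    then have "\<forall>\<^sub>F u in nhds 0. (\<phi> i t \<circ> (\<lambda>u. \<zeta> * u)) u = \<phi> j t u"
      by eventually_elim (use j(2)[OF t] in auto)
    ultimately have "\<phi> j t has_fps_expansion (\<Phi> i t oo (fps_const \<zeta> * fps_X))"
      using has_fps_expansion_cong by blast
    then have "\<Phi> j t = \<Phi> i t oo (fps_const \<zeta> * fps_X)"
      using \<Phi>[OF j(1) t] fps_expansion_unique_complex by blast
    then show ?thesis by simp
  qed
  have tr: "trunc_order N (\<Phi> i t) = trunc_order N (\<Phi> i t - \<Phi> j t)" if t: "cmod t < r" for t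
  proof (rule trunc_order_cong)
    fix k assume k: "k < N"
    show "fps_nth (\<Phi> i t) k = 0 \<longleftrightarrow> fps_nth (\<Phi> i t - \<Phi> j t) k = 0"
    proof (cases "k = 0")
      case True
      have "fps_nth (\<Phi> l t) 0 = 0" if "l < d" for l
        using has_fps_expansion_imp_0_eq_fps_nth_0[OF \<Phi>[OF that t]] by simp
      then show ?thesis using True i j by simp
    next
      case False
      then have "\<not> N dvd k" using k by (auto dest: dvd_imp_le)
      then have "\<zeta> ^ k \<noteq> 1" using \<zeta>_power by blast
      then show ?thesis using nth[OF t, of k] by auto
    qed
  qed
  show ?thesis
  proof (cases "i = j")
    \<comment> \<open>A root function that is its own conjugate has no terms of degree less than
      \<open>N\<close>.\<close>
    case True
    show ?thesis
      by (rule that[of r N]) (use r tr True in \<open>auto simp: trunc_order_eq_min_subdegree\<close>)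
  next
    case False
    obtain k \<epsilon> where k: "\<epsilon> > 0" "\<epsilon> \<le> r"
      "\<And>t. cmod t < \<epsilon> \<Longrightarrow> \<Phi> i t - \<Phi> j t \<noteq> 0 \<and> subdegree (\<Phi> i t - \<Phi> j t) = k"
      by (rule difference_order_constant[OF i j(1) False], rule that)
    show ?thesis
      by (rule that[of \<epsilon> "min N k"]) (use k tr in \<open>auto simp: trunc_order_eq_min_subdegree\<close>)
  qed
qed

text \<open>After \<open>s = u^N\<close> the polynomial on the line becomes the product of the
  factors \<open>c u^N - \<phi> i t u\<close>, whose orders are the truncated orders of the roots.
  The order \<open>L\<close> is common to all small \<open>t\<close>, whereas the exceptional set
  \<open>E\<close> may vary with \<open>t\<close>.\<close>

lemma line_order_constant:
  obtains L \<epsilon> where "\<epsilon> > 0" "\<epsilon> \<le> r"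
    "\<And>t. cmod t < \<epsilon> \<Longrightarrow> \<exists>E. finite E \<and> (\<forall>c H. c \<notin> E \<longrightarrow>
       (\<lambda>s. poly (q t s) (c * s)) has_fps_expansion H \<longrightarrow> H \<noteq> 0 \<and> subdegree H = L)"
proof -
  have "\<exists>M \<epsilon>. \<epsilon> > 0 \<and> \<epsilon> \<le> r \<and> (\<forall>t. cmod t < \<epsilon> \<longrightarrow> trunc_order N (\<Phi> i t) = M)" if "i < d" for i
    using trunc_order_constant[OF that] by metis
  then obtain M e where Me: "\<And>i. i < d \<Longrightarrow> e i > 0" "\<And>i. i < d \<Longrightarrow> e i \<le> r"
    "\<And>i t. i < d \<Longrightarrow> cmod t < e i \<Longrightarrow> trunc_order N (\<Phi> i t) = M i" by metis
  define \<epsilon> where "\<epsilon> = Min (e ` {..<d})"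
  have "e ` {..<d} \<noteq> {}" using d by auto
  then have \<epsilon>: "\<epsilon> > 0" "\<And>i. i < d \<Longrightarrow> \<epsilon> \<le> e i"
    using Me(1) by (auto simp: \<epsilon>_def Min_gr_iff)
  have \<epsilon>r: "\<epsilon> \<le> r" using \<epsilon>(2)[OF d] Me(2)[OF d] by simp
  show ?thesis
  proof (rule that[OF \<epsilon>(1) \<epsilon>r])
    fix t assume t: "cmod t < \<epsilon>"
    then have tr: "cmod t < r" using \<epsilon>r by simp
    \<comment> \<open>The slopes at which some factor loses its term of degree
      \<open>N\<close>.\<close>
    define E where "E = (\<lambda>i. fps_nth (\<Phi> i t) N) ` {..<d}"
    \<comment> \<open>The sum of the \<open>M i\<close> is the order in \<open>u\<close>, hence
      \<open>N\<close> times the order in \<open>s\<close>, and the division is exact.\<close>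
    have "H \<noteq> 0 \<and> subdegree H = (\<Sum>i<d. M i) div N"
      if c: "c \<notin> E" and H: "(\<lambda>s. poly (q t s) (c * s)) has_fps_expansion H" for c H
    proof -
      define P where "P = (\<Prod>i<d. fps_const c * fps_X ^ N - \<Phi> i t)"
      have ci: "fps_nth (\<Phi> i t) N \<noteq> c" if "i < d" for i using c that by (auto simp: E_def)
      have X: "(\<lambda>u. u ^ N) has_fps_expansion (fps_X ^ N :: complex fps)"
        by (intro fps_expansion_intros)
      have exp1: "((\<lambda>s. poly (q t s) (c * s)) \<circ> (\<lambda>u. u ^ N)) has_fps_expansion (H oo fps_X ^ N)"
        by (rule has_fps_expansion_compose[OF H X]) simp
      have exp2: "(\<lambda>u. \<Prod>i<d. c * u ^ N - \<phi> i t u) has_fps_expansion P"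
        unfolding P_def by (intro fps_expansion_intros \<Phi>[OF _ tr] X) auto
      have "\<forall>\<^sub>F u in nhds 0. u \<in> ball (0::complex) \<rho>"
        using \<rho>(1) by (intro eventually_nhds_in_open) auto
      then have ev: "\<forall>\<^sub>F u in nhds 0. ((\<lambda>s. poly (q t s) (c * s)) \<circ> (\<lambda>u. u ^ N)) u = (\<Prod>i<d. c * u ^ N - \<phi> i t u)"
      proof eventually_elim
        case (elim u)
        then have "q t (u ^ N) = (\<Prod>i<d. [:-\<phi> i t u, 1:])" by (intro split[OF tr]) simp
        then show ?case by (simp only: o_def) (simp add: poly_prod)
      qed
      have HP: "H oo fps_X ^ N = P"
        using iffD1[OF has_fps_expansion_cong[OF ev refl] exp1] exp2 by (rule fps_expansion_unique_complex)
      have nzi: "fps_const c * fps_X ^ N - \<Phi> i t \<noteq> 0" if "i < d" for i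
        by (rule subdegree_const_mult_X_power_diff(1)[OF ci[OF that]])
      have sdi: "subdegree (fps_const c * fps_X ^ N - \<Phi> i t) = M i" if i: "i < d" for i
        using subdegree_const_mult_X_power_diff(2)[OF ci[OF i]] Me(3)[OF i] \<epsilon>(2)[OF i] t by simp
      have "P \<noteq> 0" unfolding P_def using nzi by auto
      then have "H \<noteq> 0" using HP by auto
      have "subdegree P = (\<Sum>i<d. M i)"
        unfolding P_def using nzi sdi by (subst subdegree_prod) auto
      moreover have "subdegree P = N * subdegree H"
        unfolding HP[symmetric] by (rule subdegree_compose_X_power[OF \<open>H \<noteq> 0\<close>]) simp
      ultimately have "(\<Sum>i<d. M i) = N * subdegree H" by simp
      then have "(\<Sum>i<d. M i) div N = subdegree H" using \<rho>(3) by (simp only: nonzero_mult_div_cancel_left)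
      then show ?thesis using \<open>H \<noteq> 0\<close> by simp
    qed
    moreover have "finite E" by (simp add: E_def)
    ultimately show "\<exists>E. finite E \<and> (\<forall>c H. c \<notin> E \<longrightarrow>
       (\<lambda>s. poly (q t s) (c * s)) has_fps_expansion H \<longrightarrow> H \<noteq> 0 \<and> subdegree H = (\<Sum>i<d. M i) div N)"
      by blast
  qed
qed

end

section \<open>Convergent power series in two variables\<close>

text \<open>Unordered sums may be regrouped along the fibres of any map. This serves to collect
  products of series by bidegree, and Taylor series by their degrees in two groups of
  variables.\<close>

lemma has_sum_group:
  fixes f :: "'a \<Rightarrow> 'c::real_normed_vector"
  assumes "(f has_sum z) S" "g ` S \<subseteq> T" "\<And>y. y \<in> T \<Longrightarrow> finite {x\<in>S. g x = y}"
  shows "((\<lambda>y. \<Sum>x | x \<in> S \<and> g x = y. f x) has_sum z) T"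
proof -
  have bij: "bij_betw snd (Sigma T (\<lambda>y. {x\<in>S. g x = y})) S"
    unfolding bij_betw_def using assms(2) by (auto simp: inj_on_def image_iff)
  have "((\<lambda>p. f (snd p)) has_sum z) (Sigma T (\<lambda>y. {x\<in>S. g x = y}))"
    using has_sum_reindex_bij_betw[OF bij, of f] assms(1) by simp
  then show ?thesis
    by (rule has_sum_SigmaD) (use assms(3) in \<open>simp add: has_sum_finite\<close>)
qed

lemma abs_summable_group:
  fixes f :: "'a \<Rightarrow> 'c::banach"
  assumes "(\<lambda>x. norm (f x)) summable_on S" "g ` S \<subseteq> T" "\<And>y. y \<in> T \<Longrightarrow> finite {x\<in>S. g x = y}"
  shows "((\<lambda>y. \<Sum>x | x \<in> S \<and> g x = y. f x) has_sum infsum f S) T"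
    "(\<lambda>y. norm (\<Sum>x | x \<in> S \<and> g x = y. f x)) summable_on T"
proof -
  show "((\<lambda>y. \<Sum>x | x \<in> S \<and> g x = y. f x) has_sum infsum f S) T"
    using has_sum_group[OF has_sum_infsum[OF abs_summable_summable] assms(2,3)] assms(1) by blast
  have "(\<lambda>y. \<Sum>x | x \<in> S \<and> g x = y. norm (f x)) summable_on T"
    using has_sum_group[OF has_sum_infsum[OF assms(1)] assms(2,3)] summable_on_def by blast
  then show "(\<lambda>y. norm (\<Sum>x | x \<in> S \<and> g x = y. f x)) summable_on T"
    by (rule summable_on_comparison_test) (auto intro: norm_sum)
qed

lemma has_sum_times:
  fixes f :: "'a \<Rightarrow> 'c::{banach,real_normed_div_algebra}"
  assumes f: "(\<lambda>x. norm (f x)) summable_on S" and g: "(\<lambda>x. norm (g x)) summable_on T"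
  shows "(\<lambda>p. norm (f (fst p) * g (snd p))) summable_on (S \<times> T)"
    "infsum (\<lambda>p. f (fst p) * g (snd p)) (S \<times> T) = infsum f S * infsum g T"
proof -
  show *: "(\<lambda>p. norm (f (fst p) * g (snd p))) summable_on (S \<times> T)"
  proof (rule summable_on_SigmaI)
    fix x assume "x \<in> S"
    show "((\<lambda>y. norm (f (fst (x, y)) * g (snd (x, y)))) has_sum norm (f x) * infsum (\<lambda>y. norm (g y)) T) T"
      by (simp add: norm_mult) (rule has_sum_cmult_right[OF has_sum_infsum[OF g]])
  qed (auto intro: summable_on_cmult_left f)
  have "((\<lambda>x. f x * infsum g T) has_sum infsum (\<lambda>p. f (fst p) * g (snd p)) (S \<times> T)) S"
    by (rule has_sum_SigmaD[OF has_sum_infsum[OF abs_summable_summable[OF *]]])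
      (simp, rule has_sum_cmult_right[OF has_sum_infsum[OF abs_summable_summable[OF g]]])
  moreover have "((\<lambda>x. f x * infsum g T) has_sum infsum f S * infsum g T) S"
    by (rule has_sum_cmult_left[OF has_sum_infsum[OF abs_summable_summable[OF f]]])
  ultimately show "infsum (\<lambda>p. f (fst p) * g (snd p)) (S \<times> T) = infsum f S * infsum g T"
    using has_sum_unique by blast
qed

text \<open>
  An element \<open>A\<close> of \<open>\<complex>[[t]][[s]]\<close> is a \<open>complex fps fps\<close>; \<open>A $ l $ k\<close> is the coefficient of \<open>t\<^sup>k s\<^sup>l\<close>.
\<close>

definition term2 :: "complex \<Rightarrow> complex \<Rightarrow> complex fps fps \<Rightarrow> nat \<times> nat \<Rightarrow> complex" where
  "term2 t s A = (\<lambda>(l, k). fps_nth (fps_nth A l) k * t ^ k * s ^ l)"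

text \<open>Absolute summability at the corner \<open>(r, r)\<close> dominates the series on the
  whole closed bidisc, so one number records a domain of convergence.\<close>

definition conv2 :: "real \<Rightarrow> complex fps fps \<Rightarrow> bool" where
  "conv2 r A \<longleftrightarrow> (\<lambda>p. norm (term2 r r A p)) summable_on UNIV"

definition ev2 :: "complex \<Rightarrow> complex \<Rightarrow> complex fps fps \<Rightarrow> complex" where
  "ev2 t s A = infsum (term2 t s A) UNIV"

lemma norm_term2_le:
  assumes "cmod t \<le> r" "cmod s \<le> r"
  shows "norm (term2 t s A p) \<le> norm (term2 (of_real r) (of_real r) A p)"
proof -
  have "r \<ge> 0" using assms(1) norm_ge_zero order.trans by blast
  then show ?thesis using assms
    by (auto simp: term2_def norm_mult norm_power split: prod.splits intro!: mult_mono power_mono)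
qed

lemma conv2_norm_summable:
  assumes "conv2 r A" "cmod t \<le> r" "cmod s \<le> r"
  shows "(\<lambda>p. norm (term2 t s A p)) summable_on UNIV"
  by (rule summable_on_comparison_test[OF assms(1)[unfolded conv2_def]])
    (use norm_term2_le[OF assms(2,3)] in auto)

lemma conv2_mono: "conv2 r A \<Longrightarrow> 0 \<le> r' \<Longrightarrow> r' \<le> r \<Longrightarrow> conv2 r' A"
  unfolding conv2_def[of r'] by (rule conv2_norm_summable) auto

lemma has_sum_ev2:
  assumes "conv2 r A" "cmod t \<le> r" "cmod s \<le> r"
  shows "(term2 t s A has_sum ev2 t s A) UNIV"
  unfolding ev2_def by (rule has_sum_infsum[OF abs_summable_summable[OF conv2_norm_summable[OF assms]]])

lemma term2_add: "term2 t s (A + B) p = term2 t s A p + term2 t s B p"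
  by (cases p) (simp add: term2_def algebra_simps)

lemma term2_uminus: "term2 t s (- A) p = - term2 t s A p"
  by (cases p) (simp add: term2_def)

lemma finite_add_fibre: "finite {x. case x of ((l, k), (l', k')) \<Rightarrow> (l + l', k + k') = (y :: nat \<times> nat)}"
proof (rule finite_subset)
  show "{x. case x of ((l, k), (l', k')) \<Rightarrow> (l + l', k + k') = y}
    \<subseteq> ({..fst y} \<times> {..snd y}) \<times> ({..fst y} \<times> {..snd y})" by auto
qed auto

text \<open>The double convolution appears as a sum over the fibres of the addition of index pairs,
  the shape in which a product of two absolutely convergent families can be regrouped.\<close>

lemma term2_mult:
  "term2 t s (A * B) y =
    (\<Sum>x | x \<in> UNIV \<times> UNIV \<and> (\<lambda>((l, k), (l', k')). (l + l', k + k')) x = y. term2 t s A (fst x) * term2 t s B (snd x))"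
proof (cases y)
  case (Pair L K)
  have "term2 t s (A * B) y =
    (\<Sum>i=0..L. \<Sum>j=0..K. fps_nth (fps_nth A i) j * fps_nth (fps_nth B (L - i)) (K - j)) * t ^ K * s ^ L"
    by (simp add: Pair term2_def fps_mult_nth fps_sum_nth)
  also have "\<dots> = (\<Sum>p\<in>{0..L} \<times> {0..K}. fps_nth (fps_nth A (fst p)) (snd p) * fps_nth (fps_nth B (L - fst p)) (K - snd p) * t ^ K * s ^ L)"
    by (simp add: sum.cartesian_product sum_distrib_right case_prod_unfold)
  also have "\<dots> = (\<Sum>x | x \<in> UNIV \<times> UNIV \<and> (\<lambda>((l, k), (l', k')). (l + l', k + k')) x = y. term2 t s A (fst x) * term2 t s B (snd x))"
  proof (rule sum.reindex_bij_witness[of _ fst "\<lambda>(i, j). ((i, j), (L - i, K - j))"])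
    fix p assume "p \<in> {0..L} \<times> {0..K}"
    then obtain i j where p: "p = (i, j)" "i \<le> L" "j \<le> K" by auto
    have "t ^ K = t ^ j * t ^ (K - j)" "s ^ L = s ^ i * s ^ (L - i)"
      using p by (simp_all flip: power_add)
    then show "term2 t s A (fst (case p of (i, j) \<Rightarrow> ((i, j), L - i, K - j))) * term2 t s B (snd (case p of (i, j) \<Rightarrow> ((i, j), L - i, K - j))) =
      fps_nth (fps_nth A (fst p)) (snd p) * fps_nth (fps_nth B (L - fst p)) (K - snd p) * t ^ K * s ^ L"
      unfolding p(1) term2_def by (simp only: prod.case fst_conv snd_conv mult_ac)
  qed (auto simp: Pair)
  finally show ?thesis .
qed

lemma conv2_mult_aux:
  assumes "conv2 r A" "conv2 r B" "cmod t \<le> r" "cmod s \<le> r"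
  shows "(\<lambda>p. norm (term2 t s (A * B) p)) summable_on UNIV" "ev2 t s (A * B) = ev2 t s A * ev2 t s B"
proof -
  note AB = has_sum_times[OF conv2_norm_summable[OF assms(1,3,4)] conv2_norm_summable[OF assms(2,3,4)]]
  have fin: "finite {x \<in> UNIV \<times> UNIV. (\<lambda>((l, k), (l', k')). (l + l', k + k')) x = y}" for y :: "nat \<times> nat"
    by (rule finite_subset[OF _ finite_add_fibre[of y]]) auto
  note G = abs_summable_group[OF AB(1), where T = UNIV, OF _ fin]
  show "(\<lambda>p. norm (term2 t s (A * B) p)) summable_on UNIV" using G(2) by (simp add: term2_mult)
  have "(term2 t s (A * B) has_sum ev2 t s A * ev2 t s B) UNIV"
    using G(1) AB(2) by (simp add: term2_mult[abs_def] ev2_def)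
  then show "ev2 t s (A * B) = ev2 t s A * ev2 t s B" by (simp add: ev2_def infsumI)
qed

text \<open>
  Evaluation is a ring homomorphism on the convergent series only, and these do not form a type.
\<close>

locale partial_hom =
  fixes C :: "'a::idom set" and h :: "'a \<Rightarrow> 'b::idom"
  assumes C_0: "0 \<in> C" and C_1: "1 \<in> C"
    and C_add: "\<And>x y. x \<in> C \<Longrightarrow> y \<in> C \<Longrightarrow> x + y \<in> C"
    and C_uminus: "\<And>x. x \<in> C \<Longrightarrow> - x \<in> C"
    and C_mult: "\<And>x y. x \<in> C \<Longrightarrow> y \<in> C \<Longrightarrow> x * y \<in> C"
    and h_0: "h 0 = 0" and h_1: "h 1 = 1"
    and h_add: "\<And>x y. x \<in> C \<Longrightarrow> y \<in> C \<Longrightarrow> h (x + y) = h x + h y"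
    and h_uminus: "\<And>x. x \<in> C \<Longrightarrow> h (- x) = - h x"
    and h_mult: "\<And>x y. x \<in> C \<Longrightarrow> y \<in> C \<Longrightarrow> h (x * y) = h x * h y"
begin

lemma hom_sum: "(\<And>i. i \<in> I \<Longrightarrow> f i \<in> C) \<Longrightarrow> sum f I \<in> C \<and> h (sum f I) = (\<Sum>i\<in>I. h (f i))"
  by (induction I rule: infinite_finite_induct) (auto simp: C_0 h_0 C_add h_add)

lemma hom_prod: "(\<And>i. i \<in> I \<Longrightarrow> f i \<in> C) \<Longrightarrow> prod f I \<in> C \<and> h (prod f I) = (\<Prod>i\<in>I. h (f i))"
  by (induction I rule: infinite_finite_induct) (auto simp: C_1 h_1 C_mult h_mult)

lemma hom_power: "x \<in> C \<Longrightarrow> x ^ n \<in> C \<and> h (x ^ n) = h x ^ n"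
  by (induction n) (auto simp: C_1 h_1 C_mult h_mult)

lemma hom_of_nat: "of_nat n \<in> C \<and> h (of_nat n) = of_nat n"
  by (induction n) (auto simp: C_0 C_1 h_0 h_1 C_add h_add)

lemma hom_of_int: "of_int n \<in> C \<and> h (of_int n) = of_int n"
  by (cases n) (use hom_of_nat in \<open>auto simp: C_uminus h_uminus simp del: of_nat_Suc\<close>)

text \<open>The Leibniz formula uses ring operations only, and under these \<open>C\<close> is
  closed.\<close>

lemma hom_det:
  assumes M: "M \<in> carrier_mat n n" and C: "\<And>i j. i < n \<Longrightarrow> j < n \<Longrightarrow> M $$ (i, j) \<in> C"
  shows "det M \<in> C \<and> h (det M) = det (map_mat h M)"
proof -
  let ?f = "\<lambda>p. signof p * (\<Prod>i=0..<n. M $$ (i, p i))"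
  have p: "?f p \<in> C \<and> h (?f p) = signof p * (\<Prod>i=0..<n. map_mat h M $$ (i, p i))" if "p permutes {0..<n}" for p
  proof -
    have lt: "p i < n" if "i < n" for i using permutes_in_image[OF \<open>p permutes _\<close>, of i] that by auto
    have 1: "(\<Prod>i=0..<n. M $$ (i, p i)) \<in> C \<and> h (\<Prod>i=0..<n. M $$ (i, p i)) = (\<Prod>i=0..<n. h (M $$ (i, p i)))"
      by (rule hom_prod) (use C lt in auto)
    have 2: "(\<Prod>i=0..<n. h (M $$ (i, p i))) = (\<Prod>i=0..<n. map_mat h M $$ (i, p i))"
      by (rule prod.cong) (use M lt in auto)
    show ?thesis using 1 2 hom_of_int[of "sign p"] by (simp add: C_mult h_mult)
  qed
  have "det M = (\<Sum>p\<in>{p. p permutes {0..<n}}. ?f p)" using M by (simp add: det_def)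
  moreover have "det (map_mat h M) = (\<Sum>p\<in>{p. p permutes {0..<n}}. signof p * (\<Prod>i=0..<n. map_mat h M $$ (i, p i)))"
    using M by (simp add: det_def)
  moreover have "(\<Sum>p\<in>{p. p permutes {0..<n}}. ?f p) \<in> C \<and> h (\<Sum>p\<in>{p. p permutes {0..<n}}. ?f p) =
     (\<Sum>p\<in>{p. p permutes {0..<n}}. h (?f p))"
    by (rule hom_sum) (use p in blast)
  ultimately show ?thesis using p by simp
qed

definition Cpoly :: "'a poly set" where "Cpoly = {P. \<forall>j. coeff P j \<in> C}"

lemma coeff_map [simp]: "coeff (map_poly h P) j = h (coeff P j)"
  by (simp add: coeff_map_poly h_0)

lemma map_poly_1: "map_poly h 1 = 1"
  by (simp add: poly_eq_iff h_0 h_1 coeff_1)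

lemma Cpoly_1: "1 \<in> Cpoly"
  by (simp add: Cpoly_def coeff_1 C_0 C_1)

lemma Cpoly_mult:
  assumes "P \<in> Cpoly" "Q \<in> Cpoly"
  shows "P * Q \<in> Cpoly" "map_poly h (P * Q) = map_poly h P * map_poly h Q"
proof -
  have *: "coeff (P * Q) j \<in> C \<and> h (coeff (P * Q) j) = (\<Sum>i\<le>j. h (coeff P i * coeff Q (j - i)))" for j
    unfolding coeff_mult by (rule hom_sum) (use assms in \<open>auto simp: Cpoly_def C_mult\<close>)
  then show "P * Q \<in> Cpoly" by (simp add: Cpoly_def)
  show "map_poly h (P * Q) = map_poly h P * map_poly h Q"
    using * assms by (intro poly_eqI) (simp add: coeff_mult Cpoly_def h_mult)
qed

lemma Cpoly_power:
  assumes "P \<in> Cpoly"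
  shows "P ^ n \<in> Cpoly \<and> map_poly h (P ^ n) = map_poly h P ^ n"
  by (induction n) (use assms Cpoly_mult in \<open>auto simp: Cpoly_1 map_poly_1\<close>)

lemma Cpoly_prod:
  assumes "\<And>i. i \<in> I \<Longrightarrow> f i \<in> Cpoly"
  shows "prod f I \<in> Cpoly \<and> map_poly h (prod f I) = (\<Prod>i\<in>I. map_poly h (f i))"
  using assms
  by (induction I rule: infinite_finite_induct) (auto simp: Cpoly_1 map_poly_1 Cpoly_mult)

lemma Cpoly_pderiv:
  assumes "P \<in> Cpoly"
  shows "pderiv P \<in> Cpoly" "map_poly h (pderiv P) = pderiv (map_poly h P)"
proof -
  have *: "of_nat n * coeff P j \<in> C \<and> h (of_nat n * coeff P j) = of_nat n * h (coeff P j)" for n j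
    using assms hom_of_nat[of n] by (simp add: Cpoly_def C_mult h_mult)
  show "pderiv P \<in> Cpoly" using *[of "Suc _"] by (simp add: Cpoly_def coeff_pderiv del: of_nat_Suc)
  show "map_poly h (pderiv P) = pderiv (map_poly h P)"
    using *[of "Suc _"] by (intro poly_eqI) (simp add: coeff_pderiv del: of_nat_Suc)
qed

lemma hom_poly:
  assumes "P \<in> Cpoly" "x \<in> C"
  shows "poly P x \<in> C \<and> h (poly P x) = poly (map_poly h P) (h x)"
proof -
  have le: "degree (map_poly h P) \<le> degree P" by (rule degree_map_poly_le)
  have "poly P x \<in> C \<and> h (poly P x) = (\<Sum>j\<le>degree P. h (coeff P j * x ^ j))"
    unfolding poly_altdef by (rule hom_sum) (use assms hom_power in \<open>auto simp: Cpoly_def C_mult\<close>)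
  moreover have "(\<Sum>j\<le>degree P. h (coeff P j * x ^ j)) = (\<Sum>j\<le>degree P. coeff (map_poly h P) j * h x ^ j)"
    using assms hom_power[OF assms(2)] by (auto simp: Cpoly_def h_mult intro!: sum.cong)
  moreover have "\<dots> = poly (map_poly h P) (h x)"
    unfolding poly_altdef by (rule sum.mono_neutral_right) (use le in \<open>auto simp: coeff_eq_0 simp del: coeff_map\<close>)
  ultimately show ?thesis by simp
qed

text \<open>The size of the Sylvester matrix depends on the degrees; once these are preserved,
  \<open>h\<close> acts on it entry by entry.\<close>

lemma hom_resultant:
  assumes PQ: "P \<in> Cpoly" "Q \<in> Cpoly"
    and deg: "degree (map_poly h P) = degree P" "degree (map_poly h Q) = degree Q"
  shows "resultant P Q \<in> C \<and> h (resultant P Q) = resultant (map_poly h P) (map_poly h Q)"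
proof -
  let ?n = "degree P + degree Q"
  have M: "sylvester_mat P Q \<in> carrier_mat ?n ?n" by (rule sylvester_carrier_mat)
  have "det (sylvester_mat P Q) \<in> C \<and> h (det (sylvester_mat P Q)) = det (map_mat h (sylvester_mat P Q))"
    by (rule hom_det[OF M]) (use PQ C_0 in \<open>auto simp: sylvester_index_mat Cpoly_def\<close>)
  moreover have "map_mat h (sylvester_mat P Q) = sylvester_mat (map_poly h P) (map_poly h Q)"
    by (rule eq_matI) (use deg h_0 in \<open>auto simp: sylvester_index_mat\<close>)
  ultimately show ?thesis by (simp add: resultant_def)
qed

end

section \<open>Evaluation of convergent series as a homomorphism\<close>

lemma conv2_const: "conv2 r (fps_const (fps_const c))" "ev2 t s (fps_const (fps_const c)) = c"
proof -
  have z: "term2 t s (fps_const (fps_const c)) p = 0" if "p \<in> UNIV - {(0, 0)}" for t s p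
    using that by (cases p) (auto simp: term2_def)
  have "((\<lambda>p. norm (term2 r r (fps_const (fps_const c)) p)) has_sum norm c) UNIV \<longleftrightarrow>
     ((\<lambda>p. norm (term2 r r (fps_const (fps_const c)) p)) has_sum norm c) {(0, 0)}"
    by (rule has_sum_cong_neutral) (use z in auto)
  then show "conv2 r (fps_const (fps_const c))"
    unfolding conv2_def summable_on_def by (auto simp: term2_def intro!: has_sum_finiteI)
  have "(term2 t s (fps_const (fps_const c)) has_sum c) UNIV \<longleftrightarrow>
     (term2 t s (fps_const (fps_const c)) has_sum c) {(0, 0)}"
    by (rule has_sum_cong_neutral) (use z in auto)
  then have "(term2 t s (fps_const (fps_const c)) has_sum c) UNIV"
    by (auto simp: term2_def intro!: has_sum_finiteI)
  then show "ev2 t s (fps_const (fps_const c)) = c" by (simp add: ev2_def infsumI)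
qed

lemma conv2_X: "conv2 r fps_X"  "ev2 t s fps_X = s"
proof -
  have z: "term2 t s fps_X p = 0" if "p \<in> UNIV - {(1, 0)}" for t s p
    using that by (cases p) (auto simp: term2_def fps_X_nth)
  have "((\<lambda>p. norm (term2 r r fps_X p)) has_sum \<bar>r\<bar>) UNIV \<longleftrightarrow>
     ((\<lambda>p. norm (term2 r r fps_X p)) has_sum \<bar>r\<bar>) {(1, 0)}"
    by (rule has_sum_cong_neutral) (use z in auto)
  then show "conv2 r fps_X"
    unfolding conv2_def summable_on_def by (auto simp: term2_def intro!: has_sum_finiteI)
  have "(term2 t s fps_X has_sum s) UNIV \<longleftrightarrow> (term2 t s fps_X has_sum s) {(1, 0)}"
    by (rule has_sum_cong_neutral) (use z in auto)
  then have "(term2 t s fps_X has_sum s) UNIV"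
    by (auto simp: term2_def intro!: has_sum_finiteI)
  then show "ev2 t s fps_X = s" by (simp add: ev2_def infsumI)
qed

lemma partial_hom_ev2:
  assumes "cmod t \<le> r" "cmod s \<le> r"
  shows "partial_hom {A. conv2 r A} (ev2 t s)"
proof -
  have r: "r \<ge> 0" using assms(1) norm_ge_zero order.trans by blast
  have r2: "cmod r \<le> r" using r by simp
  have const: "conv2 r 0" "conv2 r 1" "ev2 t s 0 = 0" "ev2 t s 1 = 1"
    using conv2_const(1)[of r 0] conv2_const(1)[of r 1] conv2_const(2)[of t s 0] conv2_const(2)[of t s 1] by simp_all
  show ?thesis
  proof
    fix A B assume "A \<in> {A. conv2 r A}" "B \<in> {A. conv2 r A}"
    then have A: "conv2 r A" and B: "conv2 r B" by auto
    show "A * B \<in> {A. conv2 r A}"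
      using conv2_mult_aux(1)[OF A B r2 r2] by (simp add: conv2_def)
    show "ev2 t s (A * B) = ev2 t s A * ev2 t s B"
      by (rule conv2_mult_aux(2)[OF A B assms])
    have "(\<lambda>p. norm (term2 r r A p) + norm (term2 r r B p)) summable_on UNIV"
      by (intro summable_on_add A[unfolded conv2_def] B[unfolded conv2_def])
    then have "(\<lambda>p. norm (term2 r r (A + B) p)) summable_on UNIV"
      by (rule summable_on_comparison_test) (auto simp: term2_add norm_triangle_ineq)
    then show "A + B \<in> {A. conv2 r A}" by (simp add: conv2_def)
    have "(term2 t s (A + B) has_sum ev2 t s A + ev2 t s B) UNIV"
      unfolding term2_add[abs_def] by (intro has_sum_add has_sum_ev2[OF _ assms] A B)
    then show "ev2 t s (A + B) = ev2 t s A + ev2 t s B" by (simp add: ev2_def infsumI)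
    show "- A \<in> {A. conv2 r A}" using A by (simp add: conv2_def term2_uminus)
    show "ev2 t s (- A) = - ev2 t s A"
      by (simp add: ev2_def term2_uminus[abs_def] infsum_uminus)
  qed (use const in auto)
qed

text \<open>The vector of descending powers of \<open>a\<close> lies in the kernel of the Sylvester
  matrix: each row yields a power of \<open>a\<close> times \<open>poly p a\<close> or
  \<open>poly q a\<close>. Its last entry is \<open>a^0 = 1\<close>, so it is nonzero even for
  \<open>a = 0\<close>.\<close>

lemma resultant_eq_0_if_common_root:
  fixes p q :: "'a::field poly"
  assumes "poly p a = 0" "poly q a = 0" "degree p + degree q > 0"
  shows "resultant p q = 0"
proof -
  define m n where "m = degree p" and "n = degree q"
  define N where "N = m + n"
  let ?v = "vec N (\<lambda>j. a ^ (N - 1 - j))"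
  have M: "sylvester_mat p q \<in> carrier_mat N N"
    using sylvester_carrier_mat[of p q] by (simp add: N_def m_def n_def)
  have "sylvester_mat p q *\<^sub>v ?v = 0\<^sub>v N"
  proof (rule eq_vecI)
    fix i assume "i < dim_vec (0\<^sub>v N)"
    then have i: "i < N" by simp
    have entry: "sylvester_mat p q $$ (i, j) = (if i < n then if i \<le> j \<and> j - i \<le> m then coeff p (m + i - j) else 0
        else if i - n \<le> j \<and> j \<le> i then coeff q (i - j) else 0)" if "j < N" for j
      using sylvester_index_mat[of i p q j] i that by (simp add: N_def m_def n_def)
    have dim: "dim_row (sylvester_mat p q) = N" "dim_col (sylvester_mat p q) = N" using M by auto
    have "(sylvester_mat p q *\<^sub>v ?v) $ i = (\<Sum>j=0..<N. sylvester_mat p q $$ (i, j) * a ^ (N - 1 - j))"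
      using dim i by (simp add: scalar_prod_def del: sylvester_mat_dim)
    also have "\<dots> = 0"
    proof (cases "i < n")
      case True
      have bound: "i + m < N" using True by (simp add: N_def)
      have "(\<Sum>j=0..<N. sylvester_mat p q $$ (i, j) * a ^ (N - 1 - j)) =
        (\<Sum>j=i..i+m. coeff p (m + i - j) * a ^ (N - 1 - j))"
        by (rule sum.mono_neutral_cong_right)
          (use True bound in \<open>auto simp: entry\<close>)
      also have "\<dots> = (\<Sum>k\<le>m. coeff p k * a ^ (n - 1 - i + k))"
        by (rule sum.reindex_bij_witness[of _ "\<lambda>k. m + i - k" "\<lambda>j. m + i - j"]) (use True in \<open>auto simp: N_def add.commute[of n m]\<close>)
      also have "\<dots> = a ^ (n - 1 - i) * poly p a"
        by (simp add: poly_altdef m_def sum_distrib_left power_add mult_ac)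
      finally show ?thesis using assms by simp
    next
      case False
      have "(\<Sum>j=0..<N. sylvester_mat p q $$ (i, j) * a ^ (N - 1 - j)) =
        (\<Sum>j=i-n..i. coeff q (i - j) * a ^ (N - 1 - j))"
        by (rule sum.mono_neutral_cong_right)
          (use False i in \<open>auto simp: entry\<close>)
      also have "\<dots> = (\<Sum>k\<le>n. coeff q k * a ^ (N - 1 - i + k))"
        by (rule sum.reindex_bij_witness[of _ "\<lambda>k. i - k" "\<lambda>j. i - j"]) (use False i in \<open>auto simp: N_def add.commute[of n m]\<close>)
      also have "\<dots> = a ^ (N - 1 - i) * poly q a"
        by (simp add: poly_altdef n_def sum_distrib_left power_add mult_ac)
      finally show ?thesis using assms by simp
    qed
    finally show "(sylvester_mat p q *\<^sub>v ?v) $ i = 0\<^sub>v N $ i" using i by simp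
  qed (use M in auto)
  moreover have "?v \<noteq> 0\<^sub>v N"
  proof
    assume "?v = 0\<^sub>v N"
    then have "?v $ (N - 1) = 0\<^sub>v N $ (N - 1)" by simp
    then show False using assms(3) by (simp add: N_def m_def n_def)
  qed
  ultimately have "det (sylvester_mat p q) = 0"
    using det_0_iff_vec_prod_zero_field[OF M] by (metis vec_carrier)
  then show ?thesis by (simp add: resultant_def)
qed

section \<open>Expansion of evaluated series and identity principles\<close>

definition conv1 :: "real \<Rightarrow> complex fps \<Rightarrow> bool" where
  "conv1 r a \<longleftrightarrow> (\<lambda>k. norm (fps_nth a k * of_real r ^ k)) summable_on UNIV"

definition ev1 :: "complex \<Rightarrow> complex fps \<Rightarrow> complex" where
  "ev1 t a = (\<Sum>\<^sub>\<infinity>k. fps_nth a k * t ^ k)"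

lemma has_sum_ev1:
  assumes "conv1 r a" "cmod t \<le> r"
  shows "((\<lambda>k. fps_nth a k * t ^ k) has_sum ev1 t a) UNIV"
proof -
  have "r \<ge> 0" using assms(2) norm_ge_zero order.trans by blast
  have "(\<lambda>k. norm (fps_nth a k * t ^ k)) summable_on UNIV"
    by (rule summable_on_comparison_test[OF assms(1)[unfolded conv1_def]])
      (use assms(2) \<open>r \<ge> 0\<close> in \<open>auto simp: norm_mult norm_power intro!: mult_left_mono power_mono\<close>)
  from has_sum_infsum[OF abs_summable_summable[OF this]] show ?thesis by (simp add: ev1_def)
qed

lemma ev1_has_fps_expansion:
  assumes "conv1 r a" "r > 0"
  shows "(\<lambda>t. ev1 t a) has_fps_expansion a"
proof (rule has_fps_expansionI)
  have "\<forall>\<^sub>F t in nhds 0. t \<in> ball (0::complex) r" using assms(2) by (intro eventually_nhds_in_open) auto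
  then show "\<forall>\<^sub>F u in nhds 0. (\<lambda>n. fps_nth a n * u ^ n) sums ev1 u a"
    by eventually_elim (use has_sum_ev1[OF assms(1)] in \<open>auto intro: has_sum_imp_sums\<close>)
qed

lemma conv2_imp_conv1:
  assumes "conv2 r A" "r > 0"
  shows "conv1 r (fps_nth A l)"
proof -
  have "(\<lambda>p. norm (term2 r r A p)) summable_on ({l} \<times> UNIV)"
    using assms(1)[unfolded conv2_def] by (rule summable_on_subset_banach) auto
  moreover have "bij_betw (\<lambda>k. (l, k)) UNIV ({l} \<times> (UNIV :: nat set))" by (auto simp: bij_betw_def inj_on_def)
  ultimately have "(\<lambda>k. norm (term2 r r A (l, k))) summable_on UNIV"
    using summable_on_reindex_bij_betw[of "\<lambda>k. (l, k)" UNIV "{l} \<times> UNIV" "\<lambda>p. norm (term2 r r A p)"] by simp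
  then have "(\<lambda>k. norm (term2 r r A (l, k)) * (1 / r ^ l)) summable_on UNIV"
    by (rule summable_on_cmult_left)
  then show ?thesis using assms(2) by (simp add: conv1_def term2_def norm_mult norm_power)
qed

lemma ev2_expand:
  assumes "conv2 r A" "r > 0" "cmod t \<le> r" "cmod s \<le> r"
  shows "((\<lambda>l. ev1 t (fps_nth A l) * s ^ l) has_sum ev2 t s A) UNIV"
proof (rule has_sum_SigmaD)
  show "(term2 t s A has_sum ev2 t s A) (Sigma UNIV (\<lambda>_. UNIV))"
    using has_sum_ev2[OF assms(1,3,4)] by simp
  show "((\<lambda>k. term2 t s A (l, k)) has_sum ev1 t (fps_nth A l) * s ^ l) UNIV" for l
    using has_sum_cmult_left[OF has_sum_ev1[OF conv2_imp_conv1[OF assms(1,2)] assms(3)]]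
    by (simp add: term2_def)
qed

lemma ev2_has_fps_expansion:
  assumes "conv2 r A" "r > 0" "cmod t \<le> r"
  shows "(\<lambda>s. ev2 t s A) has_fps_expansion Abs_fps (\<lambda>l. ev1 t (fps_nth A l))"
proof (rule has_fps_expansionI)
  have "\<forall>\<^sub>F s in nhds 0. s \<in> ball (0::complex) r" using assms(2) by (intro eventually_nhds_in_open) auto
  then show "\<forall>\<^sub>F u in nhds 0. (\<lambda>n. fps_nth (Abs_fps (\<lambda>l. ev1 t (fps_nth A l))) n * u ^ n) sums ev2 t u A"
    by eventually_elim (use ev2_expand[OF assms] in \<open>auto intro: has_sum_imp_sums\<close>)
qed

lemma ev1_0: "conv1 r a \<Longrightarrow> r > 0 \<Longrightarrow> ev1 0 a = fps_nth a 0"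
  using has_fps_expansion_imp_0_eq_fps_nth_0[OF ev1_has_fps_expansion] by simp

lemma ev2_0: "conv2 r A \<Longrightarrow> r > 0 \<Longrightarrow> cmod t \<le> r \<Longrightarrow> ev2 t 0 A = ev1 t (fps_nth A 0)"
  using has_fps_expansion_imp_0_eq_fps_nth_0[OF ev2_has_fps_expansion] by simp

lemma ev2_holomorphic:
  assumes "conv2 r A" "r > 0" "cmod t \<le> r"
  shows "(\<lambda>s. ev2 t s A) holomorphic_on ball 0 r"
  by (rule power_series_holomorphic[where a = "\<lambda>l. ev1 t (fps_nth A l)"])
    (use ev2_expand[OF assms] in \<open>auto intro: has_sum_imp_sums\<close>)

text \<open>The Weierstrass test concerns sequences, so index pairs are enumerated by
  \<open>prod_decode\<close>; the terms at the corner \<open>(r, r)\<close> are the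
  majorants.\<close>

lemma ev2_continuous:
  assumes "conv2 r A" "r > 0"
  shows "continuous_on (cball 0 r \<times> cball 0 r) (\<lambda>(t, s). ev2 t s A)"
proof -
  define f where "f n = (\<lambda>p. term2 (fst p) (snd p) A (prod_decode n))" for n
  have lim: "uniform_limit (cball 0 r \<times> cball 0 r) (\<lambda>n p. \<Sum>i<n. f i p) (\<lambda>p. \<Sum>i. f i p) sequentially"
  proof (rule Weierstrass_m_test)
    show "norm (f n p) \<le> norm (term2 r r A (prod_decode n))" if "p \<in> cball 0 r \<times> cball 0 r" for n p
      unfolding f_def by (rule norm_term2_le) (use that in auto)
    show "summable (\<lambda>n. norm (term2 r r A (prod_decode n)))"
      using assms(1) summable_on_reindex_bij_betw[OF bij_prod_decode, of "\<lambda>p. norm (term2 r r A p)"]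
      unfolding conv2_def by (intro summable_on_imp_summable) simp
  qed
  have ev: "(\<Sum>i. f i p) = ev2 (fst p) (snd p) A" if "p \<in> cball 0 r \<times> cball 0 r" for p
  proof -
    have "(term2 (fst p) (snd p) A has_sum ev2 (fst p) (snd p) A) UNIV"
      by (rule has_sum_ev2[OF assms(1)]) (use that in auto)
    then have "((\<lambda>n. f n p) has_sum ev2 (fst p) (snd p) A) UNIV"
      unfolding f_def using has_sum_reindex_bij_betw[OF bij_prod_decode, of "term2 (fst p) (snd p) A"] by simp
    then show ?thesis by (metis has_sum_imp_sums sums_unique)
  qed
  have cont: "continuous_on (cball 0 r \<times> cball 0 r) (\<lambda>p. \<Sum>i<n. f i p)" for n
    unfolding f_def term2_def case_prod_unfold by (intro continuous_intros)
  have "continuous_on (cball 0 r \<times> cball 0 r) (\<lambda>p. \<Sum>i. f i p)"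
    by (rule uniform_limit_theorem[OF _ lim]) (use cont in auto)
  then have "continuous_on (cball 0 r \<times> cball 0 r) (\<lambda>p. ev2 (fst p) (snd p) A)"
    by (rule continuous_on_eq) (use ev in auto)
  then show ?thesis by (simp add: case_prod_unfold)
qed

text \<open>A nonzero expansion has no zeros in a punctured neighbourhood of 0, where the positive
  reals accumulate. Real test points are all that a plane with real parameters offers.\<close>

lemma fps_expansion_eq_0:
  assumes "f has_fps_expansion F" "e > 0" "\<And>x. 0 < x \<Longrightarrow> x < e \<Longrightarrow> f (complex_of_real x) = 0"
  shows "F = 0"
proof (rule ccontr)
  assume "F \<noteq> 0"
  then have "fps_to_fls F \<noteq> 0" by simp
  moreover have "f has_laurent_expansion fps_to_fls F" using assms(1) has_fps_expansion_to_laurent by blast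
  ultimately have "\<forall>\<^sub>F x in at 0. f x \<noteq> 0" using has_laurent_expansion_eventually_nonzero_iff' by blast
  then obtain \<delta> where \<delta>: "\<delta> > 0" "\<And>x. x \<noteq> 0 \<Longrightarrow> dist x 0 < \<delta> \<Longrightarrow> f x \<noteq> 0"
    unfolding eventually_at by blast
  define x where "x = min e \<delta> / 2"
  have x: "0 < x" "x < e" "x < \<delta>" using assms(2) \<delta>(1) by (auto simp: x_def)
  have "f (complex_of_real x) \<noteq> 0" by (rule \<delta>(2)) (use x in auto)
  then show False using assms(3)[OF x(1,2)] by simp
qed

lemma ev1_eq_0:
  assumes "conv1 r a" "r > 0" "e > 0" "\<And>x. 0 < x \<Longrightarrow> x < e \<Longrightarrow> ev1 (complex_of_real x) a = 0"
  shows "a = 0"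
  using fps_expansion_eq_0[OF ev1_has_fps_expansion[OF assms(1,2)] assms(3,4)] by blast

lemma ev2_eq_0:
  assumes "conv2 r A" "r > 0" "e > 0"
    "\<And>x y. 0 < x \<Longrightarrow> x < e \<Longrightarrow> 0 < y \<Longrightarrow> y < e \<Longrightarrow> ev2 (complex_of_real x) (complex_of_real y) A = 0"
  shows "A = 0"
proof (rule fps_ext)
  fix l
  have e: "min e r > 0" using assms by simp
  have "ev1 (complex_of_real x) (fps_nth A l) = 0" if x: "0 < x" "x < min e r" for x
  proof -
    have "Abs_fps (\<lambda>l. ev1 x (fps_nth A l)) = 0"
      by (rule fps_expansion_eq_0[OF ev2_has_fps_expansion[OF assms(1,2)] assms(3)])
        (use x assms(4) in auto)
    then show ?thesis by (metis fps_nth_Abs_fps fps_zero_nth)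
  qed
  then show "fps_nth A l = fps_nth 0 l"
    using ev1_eq_0[OF conv2_imp_conv1[OF assms(1,2)] assms(2) e] by simp
qed

text \<open>\<open>A\<close> is a power of \<open>s\<close> times a unit of \<open>\<complex>[[t]][[s]]\<close>.\<close>

definition monomial_unit :: "complex fps fps \<Rightarrow> bool" where
  "monomial_unit A \<longleftrightarrow> A \<noteq> 0 \<and> fps_nth (fps_nth A (subdegree A)) 0 \<noteq> 0"

text \<open>Leading coefficients multiply, and so do their constant terms. The direction from the
  product to the factors is what passes the property on to divisors.\<close>

lemma monomial_unit_mult: "monomial_unit (A * B) \<longleftrightarrow> monomial_unit A \<and> monomial_unit B"
proof (cases "A = 0 \<or> B = 0")
  case False
  then show ?thesis by (simp add: monomial_unit_def)
qed (auto simp: monomial_unit_def)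

lemma monomial_unit_1 [simp]: "monomial_unit 1"
  by (simp add: monomial_unit_def)

lemma monomial_unit_prod: "finite I \<Longrightarrow> monomial_unit (prod f I) \<longleftrightarrow> (\<forall>i\<in>I. monomial_unit (f i))"
  by (induction I rule: finite_induct) (auto simp: monomial_unit_mult)

lemma monomial_unit_power: "monomial_unit A \<Longrightarrow> monomial_unit (A ^ n)"
  by (induction n) (auto simp: monomial_unit_mult)

lemma monomial_unitI:
  assumes "fps_nth (fps_nth A l) 0 \<noteq> 0" "\<And>l'. l' < l \<Longrightarrow> fps_nth A l' = 0"
  shows "monomial_unit A"
proof -
  have "fps_nth A l \<noteq> 0" using assms(1) by auto
  then have "subdegree A = l" using assms(2) by (intro subdegreeI)
  then show ?thesis using assms(1) \<open>fps_nth A l \<noteq> 0\<close> by (auto simp: monomial_unit_def)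
qed

lemma conv2_fps_shift:
  assumes "conv2 r A" "r > 0"
  shows "conv2 r (fps_shift n A)"
proof -
  have inj: "inj_on (\<lambda>(l, k). (l + n, k)) (UNIV :: (nat \<times> nat) set)" by (auto simp: inj_on_def)
  have "(\<lambda>p. norm (term2 r r A p)) summable_on (\<lambda>(l, k). (l + n, k)) ` UNIV"
    using assms(1)[unfolded conv2_def] by (rule summable_on_subset_banach) auto
  then have "(\<lambda>p. norm (term2 r r A ((\<lambda>(l, k). (l + n, k)) p))) summable_on UNIV"
    unfolding summable_on_reindex[OF inj] by (simp add: o_def)
  then have "(\<lambda>p. norm (term2 r r A ((\<lambda>(l, k). (l + n, k)) p)) * (1 / r ^ n)) summable_on UNIV"
    by (rule summable_on_cmult_left)
  moreover have "norm (term2 r r A ((\<lambda>(l, k). (l + n, k)) p)) * (1 / r ^ n) = norm (term2 r r (fps_shift n A) p)" for p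
    using assms(2) by (cases p) (simp add: term2_def norm_mult norm_power power_add)
  ultimately show ?thesis by (simp add: conv2_def)
qed

text \<open>After division by the power of \<open>s\<close>, the remaining series is continuous and
  nonzero at the origin, hence nonzero nearby.\<close>

lemma monomial_unit_ev2_nonzero:
  assumes A: "conv2 r A" "r > 0" and U: "monomial_unit A"
  obtains r' where "0 < r'" "r' \<le> r"
    "\<And>t s. cmod t < r' \<Longrightarrow> cmod s < r' \<Longrightarrow> s \<noteq> 0 \<Longrightarrow> ev2 t s A \<noteq> 0"
proof -
  define n where "n = subdegree A"
  define E where "E = fps_shift n A"
  have E: "conv2 r E" unfolding E_def by (rule conv2_fps_shift[OF A])
  have AE: "A = fps_X ^ n * E"
    by (simp add: E_def n_def subdegree_decompose mult.commute[of "fps_X ^ _"])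
  have z: "cmod 0 \<le> r" using A by simp
  have "ev2 0 0 E = fps_nth (fps_nth E 0) 0"
    by (simp add: ev2_0[OF E A(2) z] ev1_0[OF conv2_imp_conv1[OF E A(2)] A(2)])
  also have "\<dots> \<noteq> 0" using U by (simp add: E_def n_def monomial_unit_def)
  finally have E0: "ev2 0 0 E \<noteq> 0" .
  have op: "open (ball 0 r \<times> ball (0::complex) r)" by (intro open_Times open_ball)
  have co: "continuous_on (ball 0 r \<times> ball 0 r) (\<lambda>(t, s). ev2 t s E)"
    by (rule continuous_on_subset[OF ev2_continuous[OF E A(2)]]) auto
  have "(0, 0) \<in> ball 0 r \<times> ball (0::complex) r" using A(2) by simp
  from iffD1[OF continuous_on_eq_continuous_at[OF op] co, rule_format, OF this]
  have "isCont (\<lambda>(t, s). ev2 t s E) (0, 0)" .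
  then have "\<exists>\<delta>>0. \<forall>p. dist (0, 0) p < \<delta> \<longrightarrow> (\<lambda>(t, s). ev2 t s E) p \<noteq> 0"
    by (rule continuous_at_avoid) (use E0 in auto)
  then obtain \<delta> where \<delta>: "\<delta> > 0" "\<And>t s. dist (0, 0) (t, s) < \<delta> \<Longrightarrow> ev2 t s E \<noteq> 0" by auto
  show ?thesis
  proof (rule that[of "min (\<delta> / 2) r"])
    fix t s :: complex assume ts: "cmod t < min (\<delta> / 2) r" "cmod s < min (\<delta> / 2) r" "s \<noteq> 0"
    interpret partial_hom "{A. conv2 r A}" "ev2 t s"
      by (rule partial_hom_ev2) (use ts in auto)
    have "dist (0, 0) (t, s) \<le> cmod t + cmod s"
      using sqrt_sum_squares_le_sum[of "cmod t" "cmod s"] by (simp add: dist_Pair_Pair)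
    then have "ev2 t s E \<noteq> 0" using ts by (intro \<delta>(2)) auto
    moreover have "ev2 t s A = s ^ n * ev2 t s E"
      unfolding AE using h_mult[of "fps_X ^ n" E] hom_power[of fps_X n] E conv2_X by simp
    ultimately show "ev2 t s A \<noteq> 0" using ts by simp
  qed (use \<delta> A in auto)
qed

section \<open>Restriction of a monic polynomial to generic lines\<close>

lemma has_sum_finite_Sum:
  fixes f :: "'a \<Rightarrow> 'b \<Rightarrow> 'c::topological_comm_monoid_add"
  assumes "finite J" "\<And>j. j \<in> J \<Longrightarrow> (f j has_sum g j) A"
  shows "((\<lambda>x. \<Sum>j\<in>J. f j x) has_sum (\<Sum>j\<in>J. g j)) A"
  using assms by (induction J rule: finite_induct) (auto intro: has_sum_add)

text \<open>The form of the sum shows that each coefficient on the line is a polynomial in the slope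
  \<open>c\<close>.\<close>

lemma fps_nth_poly_linear:
  fixes R :: "'a::comm_ring_1 fps poly"
  shows "fps_nth (poly R (fps_const c * fps_X)) l =
    (\<Sum>j\<le>degree R. if j \<le> l then c ^ j * fps_nth (coeff R j) (l - j) else 0)"
proof -
  have "fps_nth (coeff R j * (fps_const c * fps_X) ^ j) l = (if j \<le> l then c ^ j * fps_nth (coeff R j) (l - j) else 0)" for j
  proof -
    have "coeff R j * (fps_const c * fps_X) ^ j = fps_const (c ^ j) * (fps_X ^ j * coeff R j)"
      by (simp add: power_mult_distrib fps_const_power mult_ac)
    then show ?thesis by (simp add: fps_X_power_mult_nth)
  qed
  then show ?thesis by (simp add: poly_altdef fps_sum_nth)
qed

text \<open>\<open>line_order_constant\<close> supplies an order \<open>L\<close> valid for all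
  small \<open>t\<close>. The coefficients below \<open>L\<close> vanish for every slope and every
  \<open>t\<close>; the coefficient of index \<open>L\<close>, taken at \<open>t = 0\<close>,
  provides the unit.\<close>

lemma generic_line_monomial_unit:
  fixes R :: "complex fps fps poly"
  assumes r0: "r > 0" and conv: "\<And>j. conv2 r (coeff R j)"
    and monic: "lead_coeff R = 1"
    and vanish: "\<And>j. j < degree R \<Longrightarrow> fps_nth (coeff R j) 0 = 0"
    and disc: "monomial_unit (resultant R (pderiv R))"
  shows "finite {c. \<not> monomial_unit (poly R (fps_const (fps_const c) * fps_X))}"
proof (cases "degree R = 0")
  case True
  then have "R = 1" using monic by (metis degree_0_id one_pCons)
  then show ?thesis by simp
next
  case False
  define d where "d = degree R"
  have d: "d > 0" using False by (simp add: d_def)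
  define q where "q t s = map_poly (ev2 t s) R" for t s
  have ev0: "ev2 t s 0 = 0" for t s
    by (simp add: ev2_def term2_def case_prod_unfold)
  have coeff_q: "coeff (q t s) j = ev2 t s (coeff R j)" for t s j
    by (simp add: q_def coeff_map_poly ev0)
  have hom: "partial_hom {A. conv2 r A} (ev2 t s)" if "cmod t \<le> r" "cmod s \<le> r" for t s
    by (rule partial_hom_ev2[OF that])
  have RC: "R \<in> partial_hom.Cpoly {A. conv2 r A}" if "cmod t \<le> r" "cmod s \<le> r" for t s
    using conv by (simp add: partial_hom.Cpoly_def[OF hom[OF that]])
  have coeff_d: "coeff (q t s) d = 1" if "cmod t \<le> r" "cmod s \<le> r" for t s
    using monic partial_hom.h_1[OF hom[OF that]] by (simp add: coeff_q d_def)
  have deg_q: "degree (q t s) = d" if "cmod t \<le> r" "cmod s \<le> r" for t s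
  proof (rule antisym)
    show "degree (q t s) \<le> d" unfolding q_def d_def by (rule degree_map_poly_le)
    show "d \<le> degree (q t s)" by (rule le_degree) (use coeff_d[OF that] in simp)
  qed
  define D where "D = resultant R (pderiv R)"
  have D: "conv2 r D \<and> ev2 t s D = resultant (q t s) (pderiv (q t s))" if "cmod t \<le> r" "cmod s \<le> r" for t s
  proof -
    interpret partial_hom "{A. conv2 r A}" "ev2 t s" by (rule hom[OF that])
    note RC' = RC[OF that]
    have "degree (map_poly (ev2 t s) R) = degree R" using deg_q[OF that] by (simp add: q_def d_def)
    moreover from this have "degree (map_poly (ev2 t s) (pderiv R)) = degree (pderiv R)"
      by (simp add: Cpoly_pderiv(2)[OF RC'] degree_pderiv)
    ultimately show ?thesis
      using hom_resultant[OF RC' Cpoly_pderiv(1)[OF RC']] Cpoly_pderiv(2)[OF RC'] by (simp add: D_def q_def)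
  qed
  have D_conv: "conv2 r D" using D[of 0 0] r0 by simp
  obtain r' where r': "0 < r'" "r' \<le> r"
    "\<And>t s. cmod t < r' \<Longrightarrow> cmod s < r' \<Longrightarrow> s \<noteq> 0 \<Longrightarrow> ev2 t s D \<noteq> 0"
    using monomial_unit_ev2_nonzero[OF D_conv r0] disc D_def by metis
  interpret discriminant_family q d r'
  proof
    show "0 < r'" "0 < d" by (fact r'(1) d)+
    show "continuous_on (ball 0 r' \<times> ball 0 r') (\<lambda>(t, s). coeff (q t s) j)" for j
      unfolding coeff_q by (rule continuous_on_subset[OF ev2_continuous[OF conv r0]]) (use r' in auto)
    fix t assume t: "cmod t < r'"
    then have tr: "cmod t \<le> r" using r' by simp
    show "(\<lambda>s. coeff (q t s) j) holomorphic_on ball 0 r'" for j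
      unfolding coeff_q by (rule holomorphic_on_subset[OF ev2_holomorphic[OF conv r0 tr]]) (use r' in auto)
    show "q t 0 = monom 1 d"
    proof (rule poly_eqI)
      fix j
      have z: "cmod 0 \<le> r" using r0 by simp
      consider "j < d" | "j = d" | "j > d" by linarith
      then show "coeff (q t 0) j = coeff (monom 1 d) j"
      proof cases
        case 1
        have "ev2 t 0 (coeff R j) = ev1 t 0"
          using ev2_0[OF conv r0 tr] vanish[of j] 1 by (simp add: d_def)
        then show ?thesis using 1 by (simp add: coeff_q ev1_def)
      next
        case 2
        then show ?thesis using coeff_d[OF tr z] by simp
      next
        case 3
        then show ?thesis using deg_q[OF tr z] by (simp add: coeff_eq_0)
      qed
    qed
    fix s assume s: "cmod s < r'"
    then have sr: "cmod s \<le> r" using r' by simp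
    show "degree (q t s) = d" by (rule deg_q[OF tr sr])
    show "lead_coeff (q t s) = 1" using coeff_d[OF tr sr] deg_q[OF tr sr] by simp
    assume "s \<noteq> 0"
    \<comment> \<open>A nonzero resultant excludes common roots of the polynomial and its
      derivative, that is, multiple roots.\<close>
    then have "resultant (q t s) (pderiv (q t s)) \<noteq> 0" using r'(3)[OF t s] D[OF tr sr] by simp
    then have "\<not> (poly (q t s) a = 0 \<and> poly (pderiv (q t s)) a = 0)" for a
      using resultant_eq_0_if_common_root[of "q t s" a "pderiv (q t s)"] deg_q[OF tr sr] d by auto
    then show "rsquarefree (q t s)" by (simp add: rsquarefree_roots)
  qed
  obtain L \<epsilon> where L: "\<epsilon> > 0" "\<epsilon> \<le> r'"
    "\<And>t. cmod t < \<epsilon> \<Longrightarrow> \<exists>E. finite E \<and> (\<forall>c H. c \<notin> E \<longrightarrow>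
       (\<lambda>s. poly (q t s) (c * s)) has_fps_expansion H \<longrightarrow> H \<noteq> 0 \<and> subdegree H = L)"
    by (rule line_order_constant, rule that)
  define \<Psi> where "\<Psi> c = poly R (fps_const (fps_const c) * fps_X)" for c
  have \<Psi>: "conv2 r (\<Psi> c) \<and> ev2 t s (\<Psi> c) = poly (q t s) (c * s)" if "cmod t \<le> r" "cmod s \<le> r" for t s c
  proof -
    interpret partial_hom "{A. conv2 r A}" "ev2 t s" by (rule hom[OF that])
    have "fps_const (fps_const c) * fps_X \<in> {A. conv2 r A}" "ev2 t s (fps_const (fps_const c) * fps_X) = c * s"
      using C_mult[of "fps_const (fps_const c)" fps_X] h_mult[of "fps_const (fps_const c)" fps_X]
        conv2_const conv2_X r0 by simp_all
    then show ?thesis unfolding \<Psi>_def q_def using hom_poly[OF RC[OF that]] by simp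
  qed
  have \<Psi>_conv: "conv2 r (\<Psi> c)" for c using \<Psi>[of 0 0] r0 by simp
  have expansion: "(\<lambda>s. poly (q t s) (c * s)) has_fps_expansion Abs_fps (\<lambda>l. ev1 t (fps_nth (\<Psi> c) l))"
    if t: "cmod t < \<epsilon>" for t c
  proof -
    have tr: "cmod t \<le> r" using t L r' by simp
    have "\<forall>\<^sub>F s in nhds 0. s \<in> ball (0::complex) r" using r0 by (intro eventually_nhds_in_open) auto
    then have "\<forall>\<^sub>F s in nhds 0. ev2 t s (\<Psi> c) = poly (q t s) (c * s)"
      by eventually_elim (use \<Psi>[OF tr] in auto)
    from iffD1[OF has_fps_expansion_cong[OF this refl] ev2_has_fps_expansion[OF \<Psi>_conv r0 tr]]
    show ?thesis .
  qed
  have generic: "\<exists>E. finite E \<and> (\<forall>c. c \<notin> E \<longrightarrow> ev1 t (fps_nth (\<Psi> c) L) \<noteq> 0 \<and> (\<forall>l<L. ev1 t (fps_nth (\<Psi> c) l) = 0))"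
    if t: "cmod t < \<epsilon>" for t
  proof -
    obtain E where E: "finite E" "\<And>c H. c \<notin> E \<Longrightarrow>
       (\<lambda>s. poly (q t s) (c * s)) has_fps_expansion H \<Longrightarrow> H \<noteq> 0 \<and> subdegree H = L"
      using L(3)[OF t] by blast
    have "ev1 t (fps_nth (\<Psi> c) L) \<noteq> 0 \<and> (\<forall>l<L. ev1 t (fps_nth (\<Psi> c) l) = 0)" if "c \<notin> E" for c
    proof -
      define H where "H = Abs_fps (\<lambda>l. ev1 t (fps_nth (\<Psi> c) l))"
      have H: "H \<noteq> 0" "subdegree H = L" using E(2)[OF that expansion[OF t]] by (auto simp: H_def)
      have "fps_nth H L \<noteq> 0" using H nth_subdegree_nonzero[OF H(1)] by simp
      moreover have "\<forall>l<L. fps_nth H l = 0" using H(2) nth_less_subdegree_zero by blast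
      ultimately show ?thesis by (simp add: H_def)
    qed
    then show ?thesis using E(1) by blast
  qed
  have low: "fps_nth (\<Psi> c) l = 0" if l: "l < L" for c l
  proof (rule ev1_eq_0[OF conv2_imp_conv1[OF \<Psi>_conv r0] r0 L(1)])
    fix x :: real assume x: "0 < x" "x < \<epsilon>"
    then have t: "cmod (complex_of_real x) < \<epsilon>" by simp
    then have tr: "cmod (complex_of_real x) \<le> r" using L r' by simp
    \<comment> \<open>For frozen \<open>t = x\<close>, the coefficient of \<open>s^l\<close> on the
      line as a polynomial in the slope. It vanishes outside a finite set of slopes, hence
      identically.\<close>
    define p where "p = (\<Sum>j\<le>degree R. if j \<le> l then monom (ev1 x (fps_nth (coeff R j) (l - j))) j else 0)"
    have p: "poly p c = ev1 x (fps_nth (\<Psi> c) l)" for c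
    proof -
      have nth: "fps_nth (fps_nth (\<Psi> c) l) k * complex_of_real x ^ k =
        (\<Sum>j\<le>degree R. if j \<le> l then c ^ j * (fps_nth (fps_nth (coeff R j) (l - j)) k * complex_of_real x ^ k) else 0)" for k
      proof -
        have "fps_nth (fps_nth (\<Psi> c) l) k = (\<Sum>j\<le>degree R. if j \<le> l then c ^ j * fps_nth (fps_nth (coeff R j) (l - j)) k else 0)"
          unfolding \<Psi>_def fps_nth_poly_linear
          by (simp add: fps_sum_nth if_distrib[of "\<lambda>f. fps_nth f k"] fps_const_power cong: if_cong)
        then show ?thesis by (simp only: sum_distrib_right) (rule sum.cong, auto)
      qed
      have hs: "((\<lambda>k. if j \<le> l then c ^ j * (fps_nth (fps_nth (coeff R j) (l - j)) k * complex_of_real x ^ k) else 0)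
          has_sum (if j \<le> l then c ^ j * ev1 x (fps_nth (coeff R j) (l - j)) else 0)) UNIV" for j
        using has_sum_cmult_right[OF has_sum_ev1[OF conv2_imp_conv1[OF conv r0] tr]] by simp
      have "((\<lambda>k. \<Sum>j\<le>degree R. if j \<le> l then c ^ j * (fps_nth (fps_nth (coeff R j) (l - j)) k * complex_of_real x ^ k) else 0)
        has_sum (\<Sum>j\<le>degree R. if j \<le> l then c ^ j * ev1 x (fps_nth (coeff R j) (l - j)) else 0)) UNIV"
        by (intro has_sum_finite_Sum hs) auto
      then have "ev1 x (fps_nth (\<Psi> c) l) = (\<Sum>j\<le>degree R. if j \<le> l then c ^ j * ev1 x (fps_nth (coeff R j) (l - j)) else 0)"
        unfolding ev1_def[of _ "fps_nth (\<Psi> c) l"] nth by (rule infsumI)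
      then show ?thesis unfolding p_def
        by (simp add: poly_sum if_distrib[of "\<lambda>p. poly p c"] poly_monom mult_ac cong: if_cong)
    qed
    obtain E where E: "finite E" "\<And>c. c \<notin> E \<Longrightarrow> poly p c = 0"
      using generic[OF t] l p by auto
    have "p = 0"
    proof (rule ccontr)
      assume "p \<noteq> 0"
      then have "finite {c. poly p c = 0}" by (rule poly_roots_finite)
      then have "finite (E \<union> {c. poly p c = 0})" using E by simp
      moreover have "E \<union> {c. poly p c = 0} = UNIV" using E by auto
      ultimately show False using infinite_UNIV_char_0[where ?'a = complex] by simp
    qed
    then show "ev1 x (fps_nth (\<Psi> c) l) = 0" using p[of c] by simp
  qed
  \<comment> \<open>Only the value at \<open>t = 0\<close> matters now: the constant term in
    \<open>t\<close> of the leading coefficient has to be nonzero, and this excludes a single finite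
    set of slopes.\<close>
  have t0: "cmod 0 < \<epsilon>" using L by simp
  obtain E where E: "finite E" "\<And>c. c \<notin> E \<Longrightarrow> ev1 0 (fps_nth (\<Psi> c) L) \<noteq> 0"
    using generic[OF t0] by blast
  have "monomial_unit (\<Psi> c)" if "c \<notin> E" for c
  proof (rule monomial_unitI[OF _ low])
    show "fps_nth (fps_nth (\<Psi> c) L) 0 \<noteq> 0"
      using E(2)[OF that] by (simp add: ev1_0[OF conv2_imp_conv1[OF \<Psi>_conv r0] r0])
  qed
  then have "{c. \<not> monomial_unit (\<Psi> c)} \<subseteq> E" by blast
  then show ?thesis using E(1) unfolding \<Psi>_def by (rule finite_subset)
qed

section \<open>Taylor expansions in several variables\<close>

definition monomial :: "'i set \<Rightarrow> ('i \<Rightarrow> nat) \<Rightarrow> ('i \<Rightarrow> 'a::comm_monoid_mult) \<Rightarrow> 'a" where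
  "monomial I \<alpha> z = (\<Prod>j\<in>I. z j ^ \<alpha> j)"

lemma finite_multi_indices_le: "finite I \<Longrightarrow> finite {\<beta> \<in> multi_indices I. \<forall>j\<in>I. \<beta> j \<le> \<alpha> j}"
proof -
  assume "finite I"
  then have "finite (PiE I (\<lambda>j. {..\<alpha> j}))" by (intro finite_PiE) auto
  then have "finite ((\<lambda>\<beta> j. if j \<in> I then \<beta> j else 0) ` PiE I (\<lambda>j. {..\<alpha> j}))" by simp
  then show ?thesis
  proof (rule rev_finite_subset, intro subsetI)
    fix \<beta> assume "\<beta> \<in> {\<beta> \<in> multi_indices I. \<forall>j\<in>I. \<beta> j \<le> \<alpha> j}"
    then show "\<beta> \<in> (\<lambda>\<beta> j. if j \<in> I then \<beta> j else 0) ` PiE I (\<lambda>j. {..\<alpha> j})"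
      by (intro image_eqI[of _ _ "restrict \<beta> I"]) (auto simp: multi_indices_def restrict_def)
  qed
qed

lemma finite_multi_indices_sum:
  assumes "finite I"
  shows "finite {\<alpha> \<in> multi_indices I. (\<Sum>j\<in>I. \<alpha> j) \<le> n}"
proof (rule finite_subset[OF _ finite_multi_indices_le[OF assms, of "\<lambda>_. n"]])
  show "{\<alpha> \<in> multi_indices I. (\<Sum>j\<in>I. \<alpha> j) \<le> n} \<subseteq> {\<beta> \<in> multi_indices I. \<forall>j\<in>I. \<beta> j \<le> n}"
    using assms by (auto intro: order.trans[OF member_le_sum])
qed

lemma multi_binomial:
  fixes x y :: "'i \<Rightarrow> 'a::comm_semiring_1"
  assumes "finite I"
  shows "(\<Sum>\<beta> | \<beta> \<in> multi_indices I \<and> (\<forall>j\<in>I. \<beta> j \<le> \<alpha> j).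
      \<Prod>j\<in>I. of_nat (\<alpha> j choose \<beta> j) * x j ^ \<beta> j * y j ^ (\<alpha> j - \<beta> j)) = (\<Prod>j\<in>I. (x j + y j) ^ \<alpha> j)"
proof -
  have "(\<Prod>j\<in>I. (x j + y j) ^ \<alpha> j) = (\<Prod>j\<in>I. \<Sum>b\<le>\<alpha> j. of_nat (\<alpha> j choose b) * x j ^ b * y j ^ (\<alpha> j - b))"
    by (simp add: binomial_ring)
  also have "\<dots> = (\<Sum>\<beta>\<in>PiE I (\<lambda>j. {..\<alpha> j}). \<Prod>j\<in>I. of_nat (\<alpha> j choose \<beta> j) * x j ^ \<beta> j * y j ^ (\<alpha> j - \<beta> j))"
    by (rule prod_sum_PiE) (use assms in auto)
  also have "\<dots> = (\<Sum>\<beta> | \<beta> \<in> multi_indices I \<and> (\<forall>j\<in>I. \<beta> j \<le> \<alpha> j).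
      \<Prod>j\<in>I. of_nat (\<alpha> j choose \<beta> j) * x j ^ \<beta> j * y j ^ (\<alpha> j - \<beta> j))"
    by (rule sum.reindex_bij_witness[of _ "\<lambda>\<beta>. restrict \<beta> I" "\<lambda>\<beta> j. if j \<in> I then \<beta> j else 0"])
      (auto simp: multi_indices_def restrict_def PiE_def extensional_def fun_eq_iff Pi_def split: if_splits intro!: prod.cong)
  finally show ?thesis by simp
qed

text \<open>Induction on the variables: the exponents that agree with \<open>\<alpha>\<close> at
  \<open>i\<close> form the coefficient of one power of the new variable. The induction hypothesis
  makes it nonzero at some \<open>v\<close>, and a value off the roots of the resulting polynomial
  completes \<open>v\<close>.\<close>

lemma multi_polynomial_nonzero:
  fixes b :: "('i \<Rightarrow> nat) \<Rightarrow> 'a::{idom,ring_char_0}"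
  assumes "finite I" "finite S" "S \<subseteq> multi_indices I" "\<alpha> \<in> S" "b \<alpha> \<noteq> 0"
  shows "\<exists>v. (\<Sum>\<alpha>\<in>S. b \<alpha> * monomial I \<alpha> v) \<noteq> 0"
  using assms
proof (induction I arbitrary: S \<alpha> b rule: finite_induct)
  case empty
  have "multi_indices ({} :: 'i set) = {\<lambda>_. 0}" by (auto simp: multi_indices_def)
  then have "S = {\<alpha>}" using empty by auto
  then show ?case using empty by (simp add: monomial_def)
next
  case (insert i I)
  define S' where "S' = (\<lambda>\<beta>. \<beta>(i := 0)) ` {\<beta>\<in>S. \<beta> i = \<alpha> i}"
  define b' where "b' \<beta> = b (\<beta>(i := \<alpha> i))" for \<beta>
  have "\<exists>v. (\<Sum>\<beta>\<in>S'. b' \<beta> * monomial I \<beta> v) \<noteq> 0"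
  proof (rule insert.IH)
    show "finite S'" using insert.prems by (simp add: S'_def)
    show "S' \<subseteq> multi_indices I" using insert.prems by (auto simp: S'_def multi_indices_def)
    show "\<alpha>(i := 0) \<in> S'" using insert.prems by (auto simp: S'_def)
    show "b' (\<alpha>(i := 0)) \<noteq> 0" using insert.prems by (simp add: b'_def)
  qed
  then obtain v where v: "(\<Sum>\<beta>\<in>S'. b' \<beta> * monomial I \<beta> v) \<noteq> 0" by blast
  have v': "(\<Sum>\<beta> | \<beta> \<in> S \<and> \<beta> i = \<alpha> i. b \<beta> * monomial I \<beta> v) \<noteq> 0"
  proof -
    have inj: "inj_on (\<lambda>\<beta>. \<beta>(i := 0)) {\<beta>\<in>S. \<beta> i = \<alpha> i}"
      by (rule inj_onI) (metis (mono_tags, lifting) fun_upd_triv fun_upd_upd mem_Collect_eq)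
    have "(\<Sum>\<beta>\<in>S'. b' \<beta> * monomial I \<beta> v) = (\<Sum>\<beta> | \<beta> \<in> S \<and> \<beta> i = \<alpha> i. b' (\<beta>(i := 0)) * monomial I (\<beta>(i := 0)) v)"
      unfolding S'_def by (simp add: sum.reindex[OF inj] o_def)
    also have "\<dots> = (\<Sum>\<beta> | \<beta> \<in> S \<and> \<beta> i = \<alpha> i. b \<beta> * monomial I \<beta> v)"
    proof (rule sum.cong)
      fix \<beta> assume "\<beta> \<in> {\<beta>. \<beta> \<in> S \<and> \<beta> i = \<alpha> i}"
      moreover from this have "\<beta>(i := \<alpha> i) = \<beta>" by auto
      moreover have "monomial I (\<beta>(i := 0)) v = monomial I \<beta> v"
        unfolding monomial_def by (rule prod.cong) (use insert.hyps in auto)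
      ultimately show "b' (\<beta>(i := 0)) * monomial I (\<beta>(i := 0)) v = b \<beta> * monomial I \<beta> v"
        by (simp add: b'_def)
    qed simp
    finally show ?thesis using v by simp
  qed
  define p where "p = (\<Sum>\<beta>\<in>S. monom (b \<beta> * monomial I \<beta> v) (\<beta> i))"
  have "coeff p (\<alpha> i) = (\<Sum>\<beta> | \<beta> \<in> S \<and> \<beta> i = \<alpha> i. b \<beta> * monomial I \<beta> v)"
    using insert.prems by (simp add: p_def coeff_sum sum.inter_filter)
  then have "p \<noteq> 0" using v' by auto
  then have "finite {y. poly p y = 0}" by (rule poly_roots_finite)
  then obtain y where y: "poly p y \<noteq> 0" using infinite_UNIV_char_0[where ?'a = 'a]
    by (metis (mono_tags, lifting) UNIV_eq_I mem_Collect_eq)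
  have "monomial (insert i I) \<beta> (v(i := y)) = y ^ \<beta> i * monomial I \<beta> v" for \<beta>
  proof -
    have "monomial I \<beta> (v(i := y)) = monomial I \<beta> v"
      unfolding monomial_def by (rule prod.cong) (use insert.hyps in auto)
    then show ?thesis using insert.hyps by (simp add: monomial_def)
  qed
  then have "(\<Sum>\<beta>\<in>S. b \<beta> * monomial (insert i I) \<beta> (v(i := y))) = poly p y"
    by (simp add: p_def poly_sum poly_monom mult_ac)
  then show ?case using y by metis
qed

text \<open>When one coordinate of a direction is changed, only finitely many values can destroy a
  nonvanishing condition of this kind.\<close>

lemma multi_polynomial_slice:
  fixes b :: "('i \<Rightarrow> nat) \<Rightarrow> 'a::comm_ring_1"
  assumes "finite I"
  obtains p where "\<And>y. (\<Sum>\<alpha>\<in>S. b \<alpha> * monomial I \<alpha> (v(i := y))) = poly p y"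
proof (cases "i \<in> I")
  case True
  show ?thesis
  proof (rule that)
    fix y
    have "monomial I \<alpha> (v(i := y)) = y ^ \<alpha> i * monomial (I - {i}) \<alpha> v" for \<alpha>
      unfolding monomial_def using assms True
      by (subst prod.remove[of I i]) (auto intro!: prod.cong arg_cong2[of _ _ _ _ "(*)"])
    then show "(\<Sum>\<alpha>\<in>S. b \<alpha> * monomial I \<alpha> (v(i := y))) = poly (\<Sum>\<alpha>\<in>S. monom (b \<alpha> * monomial (I - {i}) \<alpha> v) (\<alpha> i)) y"
      by (simp add: poly_sum poly_monom mult_ac)
  qed
next
  case False
  show ?thesis
  proof (rule that)
    fix y
    have "monomial I \<alpha> (v(i := y)) = monomial I \<alpha> v" for \<alpha>
      unfolding monomial_def by (rule prod.cong) (use False in auto)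
    then show "(\<Sum>\<alpha>\<in>S. b \<alpha> * monomial I \<alpha> (v(i := y))) = poly [:\<Sum>\<alpha>\<in>S. b \<alpha> * monomial I \<alpha> v:] y"
      by simp
  qed
qed

text \<open>Treats both fields at once; the instances are \<open>complex_of_real\<close> and the
  identity. Preservation of norms carries convergence over to the complex side.\<close>

locale complex_embedding =
  fixes \<iota> :: "'k::{real_normed_field,banach} \<Rightarrow> complex"
  assumes linear: "bounded_linear \<iota>" and \<iota>_1: "\<iota> 1 = 1"
    and \<iota>_mult: "\<iota> (x * y) = \<iota> x * \<iota> y" and norm_\<iota>: "norm (\<iota> x) = norm x"
begin

interpretation \<iota>: bounded_linear \<iota> by (rule linear)

lemma \<iota>_of_real [simp]: "\<iota> (of_real x) = of_real x"
  using \<iota>.scaleR[of x 1] by (simp add: \<iota>_1 of_real_def)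

lemma \<iota>_eq_0_iff [simp]: "\<iota> x = 0 \<longleftrightarrow> x = 0"
  using norm_\<iota>[of x] by (metis norm_eq_zero)

sublocale hom: partial_hom UNIV \<iota>
  by standard (auto simp: \<iota>_1 \<iota>_mult \<iota>.add \<iota>.neg \<iota>.zero)

lemma \<iota>_power: "\<iota> (x ^ n) = \<iota> x ^ n" using hom.hom_power by simp
lemma \<iota>_sum: "\<iota> (sum f A) = (\<Sum>i\<in>A. \<iota> (f i))" using hom.hom_sum by simp

text \<open>Unordered summability of complex families is absolute, and \<open>\<iota>\<close>
  preserves norms.\<close>

lemma summable_imp_norm_summable:
  fixes f :: "'a \<Rightarrow> 'k"
  assumes "f summable_on S"
  shows "(\<lambda>x. norm (f x)) summable_on S"
proof -
  obtain z where "(f has_sum z) S" using assms by (auto simp: summable_on_def)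
  then have "((\<lambda>x. \<iota> (f x)) has_sum \<iota> z) S" by (rule has_sum_bounded_linear[OF linear])
  then have "(\<lambda>x. \<iota> (f x)) summable_on S" by (auto simp: summable_on_def)
  then have "(\<lambda>x. norm (\<iota> (f x))) summable_on S" by (simp only: summable_on_iff_abs_summable_on_complex)
  then show ?thesis by (simp add: norm_\<iota>)
qed

text \<open>A quantitative form of \<open>has_taylor\<close>: a closed polydisc with an explicit
  majorant, and displacements \<open>h\<close> in place of points.\<close>

definition taylor_on ::
  "'i set \<Rightarrow> (('i \<Rightarrow> 'k) \<Rightarrow> 'k) \<Rightarrow> ('i \<Rightarrow> 'k) \<Rightarrow> (('i \<Rightarrow> nat) \<Rightarrow> 'k) \<Rightarrow> real \<Rightarrow> bool" where
  "taylor_on I f p c \<rho> \<longleftrightarrow> \<rho> > 0 \<and>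
     (\<lambda>\<alpha>. norm (c \<alpha>) * \<rho> ^ (\<Sum>j\<in>I. \<alpha> j)) summable_on multi_indices I \<and>
     (\<forall>h. (\<forall>j\<in>I. norm (h j) \<le> \<rho>) \<longrightarrow>
        ((\<lambda>\<alpha>. c \<alpha> * monomial I \<alpha> h) has_sum f (\<lambda>j. p j + h j)) (multi_indices I))"

lemma taylor_onD:
  assumes "taylor_on I f p c \<rho>" "\<And>j. j \<in> I \<Longrightarrow> norm (h j) \<le> \<rho>"
  shows "((\<lambda>\<alpha>. c \<alpha> * monomial I \<alpha> h) has_sum f (\<lambda>j. p j + h j)) (multi_indices I)"
  using assms by (simp add: taylor_on_def)

lemma norm_monomial_le:
  fixes h :: "'i \<Rightarrow> 'k"
  assumes "\<And>j. j \<in> I \<Longrightarrow> norm (h j) \<le> \<rho>" "\<rho> \<ge> 0"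
  shows "norm (monomial I \<alpha> h) \<le> \<rho> ^ (\<Sum>j\<in>I. \<alpha> j)"
  unfolding monomial_def power_sum
  using assms by (auto simp: norm_power intro!: prod_mono power_mono simp flip: prod_norm)

lemma taylor_on_norm_summable:
  assumes "taylor_on I f p c \<rho>" "\<And>j. j \<in> I \<Longrightarrow> norm (h j) \<le> \<rho>"
  shows "(\<lambda>\<alpha>. norm (c \<alpha> * monomial I \<alpha> h)) summable_on multi_indices I"
proof (rule summable_on_comparison_test)
  show "(\<lambda>\<alpha>. norm (c \<alpha>) * \<rho> ^ (\<Sum>j\<in>I. \<alpha> j)) summable_on multi_indices I"
    using assms(1) by (simp add: taylor_on_def)
  have "\<rho> \<ge> 0" using assms(1) by (simp add: taylor_on_def)
  then show "norm (c \<alpha> * monomial I \<alpha> h) \<le> norm (c \<alpha>) * \<rho> ^ (\<Sum>j\<in>I. \<alpha> j)" for \<alpha>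
    unfolding norm_mult by (intro mult_left_mono norm_monomial_le assms(2)) auto
qed auto

lemma has_taylor_imp_taylor_on:
  assumes "has_taylor I f p c"
  obtains \<rho> where "taylor_on I f p c \<rho>"
proof -
  obtain r where r: "r > 0" "\<And>z. z \<in> polydisc I p r \<Longrightarrow>
        ((\<lambda>\<alpha>. c \<alpha> * (\<Prod>j\<in>I. (z j - p j) ^ \<alpha> j)) has_sum f z) (multi_indices I)"
    using assms unfolding has_taylor_def eventually_coord_nhds by blast
  define \<rho> where "\<rho> = r / 2"
  have \<rho>: "0 < \<rho>" "\<rho> < r" using r by (auto simp: \<rho>_def)
  have sum: "((\<lambda>\<alpha>. c \<alpha> * monomial I \<alpha> h) has_sum f (\<lambda>j. p j + h j)) (multi_indices I)"
    if "\<forall>j\<in>I. norm (h j) \<le> \<rho>" for h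
  proof -
    have "\<forall>j\<in>I. norm (h j) < r" using that \<rho> by force
    then show ?thesis using r(2)[of "\<lambda>j. p j + h j"] by (simp add: polydisc_def monomial_def)
  qed
  have "(\<lambda>\<alpha>. norm (c \<alpha> * monomial I \<alpha> (\<lambda>_. of_real \<rho>))) summable_on multi_indices I"
    by (rule summable_imp_norm_summable, rule has_sum_imp_summable, rule sum) (use \<rho> in auto)
  then have "(\<lambda>\<alpha>. norm (c \<alpha>) * \<rho> ^ (\<Sum>j\<in>I. \<alpha> j)) summable_on multi_indices I"
    using \<rho> by (simp add: monomial_def norm_mult norm_power power_sum flip: prod_norm)
  then show ?thesis using that \<rho> sum unfolding taylor_on_def by blast
qed

end

section \<open>Restriction of Taylor expansions to planes\<close>

context complex_embedding begin
interpretation \<iota>: bounded_linear \<iota> by (rule linear)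
text \<open>The parameters of a plane are real, so that planes over both fields have the same parameters.\<close>

definition plane :: "('i \<Rightarrow> 'k) \<Rightarrow> ('i \<Rightarrow> bool) \<Rightarrow> ('i \<Rightarrow> 'k) \<Rightarrow> real \<Rightarrow> real \<Rightarrow> 'i \<Rightarrow> 'k" where
  "plane p sel v x y = (\<lambda>j. p j + of_real (if sel j then x else y) * v j)"

text \<open>The Taylor series on the plane, collected by bidegree: \<open>k\<close> counts the
  exponents at coordinates in \<open>sel\<close>, which are scaled by the first parameter, and
  \<open>l\<close> the others.\<close>

definition plane_series :: "'i set \<Rightarrow> (('i \<Rightarrow> nat) \<Rightarrow> 'k) \<Rightarrow> ('i \<Rightarrow> bool) \<Rightarrow> ('i \<Rightarrow> 'k) \<Rightarrow> complex fps fps" where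
  "plane_series I c sel v = Abs_fps (\<lambda>l. Abs_fps (\<lambda>k.
     \<iota> (\<Sum>\<alpha> | \<alpha> \<in> multi_indices I \<and> (\<Sum>j\<in>{j\<in>I. \<not> sel j}. \<alpha> j) = l \<and> (\<Sum>j\<in>{j\<in>I. sel j}. \<alpha> j) = k.
       c \<alpha> * monomial I \<alpha> v)))"

definition represents :: "(real \<Rightarrow> real \<Rightarrow> complex) \<Rightarrow> complex fps fps \<Rightarrow> bool" where
  "represents f A \<longleftrightarrow> (\<exists>r>0. conv2 r A \<and> (\<forall>x y. \<bar>x\<bar> \<le> r \<longrightarrow> \<bar>y\<bar> \<le> r \<longrightarrow> f x y = ev2 x y A))"

lemma sum_split_sel:
  fixes \<alpha> :: "'i \<Rightarrow> nat"
  assumes "finite I"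
  shows "(\<Sum>j\<in>I. \<alpha> j) = (\<Sum>j\<in>{j\<in>I. sel j}. \<alpha> j) + (\<Sum>j\<in>{j\<in>I. \<not> sel j}. \<alpha> j)"
  using assms by (subst sum.union_disjoint[symmetric]) (auto intro!: sum.cong)

lemma taylor_plane:
  assumes I: "finite I" and T: "taylor_on I f p c \<rho>"
  shows "represents (\<lambda>x y. \<iota> (f (plane p sel v x y))) (plane_series I c sel v)"
proof -
  have \<rho>: "\<rho> > 0" using T by (simp add: taylor_on_def)
  \<comment> \<open>\<open>K\<close> bounds all components of the direction, so parameters up to
    \<open>\<rho> / K\<close> stay inside the polydisc; the summand 1 keeps it positive.\<close>
  define K where "K = 1 + (\<Sum>j\<in>I. norm (v j))"
  have K: "K \<ge> 1" "\<And>j. j \<in> I \<Longrightarrow> norm (v j) \<le> K"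
    unfolding K_def using I by (auto intro!: sum_nonneg add_increasing member_le_sum)
  define r where "r = \<rho> / K"
  have r: "r > 0" "r * K = \<rho>" using \<rho> K by (auto simp: r_def)
  let ?g = "\<lambda>\<alpha>. (\<Sum>j\<in>{j\<in>I. \<not> sel j}. \<alpha> j, \<Sum>j\<in>{j\<in>I. sel j}. \<alpha> j)"
  let ?T = "\<lambda>t s \<alpha>. \<iota> (c \<alpha> * monomial I \<alpha> v) * t ^ snd (?g \<alpha>) * s ^ fst (?g \<alpha>)"
  let ?A = "plane_series I c sel v"
  have fin: "finite {\<alpha> \<in> multi_indices I. ?g \<alpha> = y}" for y
    by (rule finite_subset[OF _ finite_multi_indices_sum[OF I, of "snd y + fst y"]])
      (auto simp: sum_split_sel[OF I, of _ sel])
  have term2: "term2 t s ?A y = (\<Sum>\<alpha> | \<alpha> \<in> multi_indices I \<and> ?g \<alpha> = y. ?T t s \<alpha>)" for t s y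
  proof (cases y)
    case (Pair l k)
    have "term2 t s ?A y = (\<Sum>\<alpha> | \<alpha> \<in> multi_indices I \<and> ?g \<alpha> = y. \<iota> (c \<alpha> * monomial I \<alpha> v) * t ^ k * s ^ l)"
      by (simp add: Pair term2_def plane_series_def \<iota>_sum sum_distrib_right)
    also have "\<dots> = (\<Sum>\<alpha> | \<alpha> \<in> multi_indices I \<and> ?g \<alpha> = y. ?T t s \<alpha>)"
      by (rule sum.cong) (auto simp: Pair)
    finally show ?thesis .
  qed
  have mono: "monomial I \<alpha> (\<lambda>j. of_real (if sel j then x else y) * v j) = monomial I \<alpha> v * of_real (x ^ snd (?g \<alpha>) * y ^ fst (?g \<alpha>))" for \<alpha> x y
  proof -
    have "(\<Prod>j\<in>I. (of_real (if sel j then x else y) :: 'k) ^ \<alpha> j) =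
      (\<Prod>j\<in>{j\<in>I. sel j}. of_real x ^ \<alpha> j) * (\<Prod>j\<in>{j\<in>I. \<not> sel j}. of_real y ^ \<alpha> j)"
    proof -
      have "(\<Prod>j\<in>I. (of_real (if sel j then x else y) :: 'k) ^ \<alpha> j) =
        (\<Prod>j\<in>{j\<in>I. sel j} \<union> {j\<in>I. \<not> sel j}. of_real (if sel j then x else y) ^ \<alpha> j)"
        by (rule prod.cong) auto
      also have "\<dots> = (\<Prod>j\<in>{j\<in>I. sel j}. of_real (if sel j then x else y) ^ \<alpha> j) * (\<Prod>j\<in>{j\<in>I. \<not> sel j}. of_real (if sel j then x else y) ^ \<alpha> j)"
        by (rule prod.union_disjoint) (use I in auto)
      finally show ?thesis by simp
    qed
    then show ?thesis
      by (simp add: monomial_def power_mult_distrib prod.distrib power_sum mult_ac)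
  qed
  have norm_sum: "(\<lambda>\<alpha>. norm (?T r r \<alpha>)) summable_on multi_indices I"
  proof -
    have "(\<lambda>\<alpha>. norm (c \<alpha> * monomial I \<alpha> (\<lambda>j. of_real (if sel j then r else r) * v j))) summable_on multi_indices I"
      by (rule taylor_on_norm_summable[OF T])
        (use r K in \<open>auto simp: norm_mult intro: order.trans[OF mult_left_mono]\<close>)
    then show ?thesis
      unfolding mono using r by (simp add: norm_mult norm_\<iota> norm_power \<iota>_mult mult_ac)
  qed
  have conv: "conv2 r ?A"
    unfolding conv2_def term2 by (rule abs_summable_group(2)[OF norm_sum _ fin]) auto
  have "\<iota> (f (plane p sel v x y)) = ev2 x y ?A" if xy: "\<bar>x\<bar> \<le> r" "\<bar>y\<bar> \<le> r" for x y
  proof -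
    have le: "norm (of_real (if sel j then x else y) * v j) \<le> \<rho>" if "j \<in> I" for j
    proof -
      have "\<bar>if sel j then x else y\<bar> * norm (v j) \<le> r * K"
        using xy K(2)[OF that] r by (intro mult_mono) auto
      then show ?thesis using r by (simp add: norm_mult)
    qed
    have "((\<lambda>\<alpha>. c \<alpha> * monomial I \<alpha> (\<lambda>j. of_real (if sel j then x else y) * v j)) has_sum
        f (plane p sel v x y)) (multi_indices I)"
      unfolding plane_def by (rule taylor_onD[OF T le])
    from has_sum_bounded_linear[OF linear this]
    have "((\<lambda>\<alpha>. ?T x y \<alpha>) has_sum \<iota> (f (plane p sel v x y))) (multi_indices I)"
      unfolding mono by (simp add: \<iota>_mult \<iota>_power mult_ac)
    then have "(term2 x y ?A has_sum \<iota> (f (plane p sel v x y))) UNIV"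
      unfolding term2[abs_def] by (rule has_sum_group) (use fin in auto)
    then show ?thesis by (simp add: ev2_def infsumI)
  qed
  then show ?thesis unfolding represents_def using r(1) conv by blast
qed

lemma represents_unique:
  assumes "represents f A" "represents g B" "e > 0"
    and fg: "\<And>x y. 0 < x \<Longrightarrow> x < e \<Longrightarrow> 0 < y \<Longrightarrow> y < e \<Longrightarrow> f x y = g x y"
  shows "A = B"
proof -
  obtain r r' where r: "r > 0" "conv2 r A" "\<And>x y. \<bar>x\<bar> \<le> r \<Longrightarrow> \<bar>y\<bar> \<le> r \<Longrightarrow> f x y = ev2 x y A"
    and r': "r' > 0" "conv2 r' B" "\<And>x y. \<bar>x\<bar> \<le> r' \<Longrightarrow> \<bar>y\<bar> \<le> r' \<Longrightarrow> g x y = ev2 x y B"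
    using assms(1,2) unfolding represents_def by blast
  define s where "s = min r r'"
  have s: "s > 0" "s \<le> r" "s \<le> r'" using r r' by (auto simp: s_def)
  have conv: "conv2 s A" "conv2 s B" using r r' s by (auto intro: conv2_mono)
  have conv_diff: "conv2 s (A + - B)" and ev_diff: "\<And>x y. cmod x \<le> s \<Longrightarrow> cmod y \<le> s \<Longrightarrow> ev2 x y (A + - B) = ev2 x y A - ev2 x y B"
  proof -
    have "cmod 0 \<le> s" using s by simp
    from partial_hom_ev2[OF this this] interpret partial_hom "{A. conv2 s A}" "ev2 0 0" .
    show "conv2 s (A + - B)" using C_add[of A "- B"] C_uminus conv by auto
  next
    fix x y assume "cmod x \<le> s" "cmod y \<le> s"
    from partial_hom_ev2[OF this] interpret partial_hom "{A. conv2 s A}" "ev2 x y" .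
    show "ev2 x y (A + - B) = ev2 x y A - ev2 x y B"
      using h_add[of A "- B"] h_uminus C_uminus conv by auto
  qed
  have "A + - B = 0"
  proof (rule ev2_eq_0[OF conv_diff s(1)])
    show "min e s > 0" using assms(3) s by simp
    fix x y assume "0 < x" "x < min e s" "0 < y" "y < min e s"
    then show "ev2 x y (A + - B) = 0"
      using fg[of x y] r(3)[of x y] r'(3)[of x y] s by (subst ev_diff) auto
  qed
  then show ?thesis by simp
qed

text \<open>If the coefficients differ at \<open>\<alpha>\<close>, the homogeneous parts of that
  degree differ in some direction \<open>v\<close>. With \<open>sel\<close> constantly
  \<open>False\<close> the plane is the line in this direction, and one function would have two
  expansions there.\<close>

lemma has_taylor_unique:
  fixes f :: "('i \<Rightarrow> 'k) \<Rightarrow> 'k"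
  assumes I: "finite I" and c: "has_taylor I f p c" and c': "has_taylor I f p c'" and \<alpha>: "\<alpha> \<in> multi_indices I"
  shows "c \<alpha> = c' \<alpha>"
proof (rule ccontr)
  assume ne: "c \<alpha> \<noteq> c' \<alpha>"
  define l where "l = (\<Sum>j\<in>I. \<alpha> j)"
  define S where "S = {\<alpha> \<in> multi_indices I. (\<Sum>j\<in>I. \<alpha> j) = l}"
  have finS: "finite S" unfolding S_def
    by (rule finite_subset[OF _ finite_multi_indices_sum[OF I, of l]]) auto
  obtain v where v: "(\<Sum>\<alpha>\<in>S. (c \<alpha> - c' \<alpha>) * monomial I \<alpha> v) \<noteq> 0"
    using multi_polynomial_nonzero[OF I finS, where \<alpha> = \<alpha> and b = "\<lambda>\<alpha>. c \<alpha> - c' \<alpha>"] ne \<alpha> by (auto simp: S_def l_def)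
  obtain \<rho> \<rho>' where "taylor_on I f p c \<rho>" "taylor_on I f p c' \<rho>'"
    using has_taylor_imp_taylor_on c c' by metis
  then have "plane_series I c (\<lambda>_. False) v = plane_series I c' (\<lambda>_. False) v"
    using represents_unique[OF taylor_plane[OF I] taylor_plane[OF I], of f p c \<rho> f p c' \<rho>' 1 "\<lambda>_. False" v "\<lambda>_. False" v]
    by simp
  then have "fps_nth (fps_nth (plane_series I c (\<lambda>_. False) v) l) 0 = fps_nth (fps_nth (plane_series I c' (\<lambda>_. False) v) l) 0"
    by simp
  then have "\<iota> (\<Sum>\<alpha>\<in>S. c \<alpha> * monomial I \<alpha> v) - \<iota> (\<Sum>\<alpha>\<in>S. c' \<alpha> * monomial I \<alpha> v) = 0"
    by (simp add: plane_series_def S_def)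
  then have "\<iota> (\<Sum>\<alpha>\<in>S. (c \<alpha> - c' \<alpha>) * monomial I \<alpha> v) = 0"
    by (simp add: left_diff_distrib sum_subtractf \<iota>.diff)
  then show False using v by simp
qed

lemma vanishing_order_eqI:
  fixes f :: "('i \<Rightarrow> 'k) \<Rightarrow> 'k"
  assumes "finite I" "has_taylor I f p c"
    "\<And>\<alpha>. \<alpha> \<in> multi_indices I \<Longrightarrow> c \<alpha> \<noteq> 0 \<Longrightarrow> \<mu> \<le> (\<Sum>j\<in>I. \<alpha> j)"
    "\<alpha> \<in> multi_indices I" "c \<alpha> \<noteq> 0" "(\<Sum>j\<in>I. \<alpha> j) = \<mu>"
  shows "vanishing_order I f p = enat \<mu>"
  unfolding vanishing_order_def
proof (rule antisym)
  show "Inf {enat (\<Sum>j\<in>I. \<alpha> j) |\<alpha> c. has_taylor I f p c \<and> \<alpha> \<in> multi_indices I \<and> c \<alpha> \<noteq> 0} \<le> enat \<mu>"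
    using assms by (intro Inf_lower) auto
  show "enat \<mu> \<le> Inf {enat (\<Sum>j\<in>I. \<alpha> j) |\<alpha> c. has_taylor I f p c \<and> \<alpha> \<in> multi_indices I \<and> c \<alpha> \<noteq> 0}"
  proof (rule Inf_greatest)
    fix x assume "x \<in> {enat (\<Sum>j\<in>I. \<alpha> j) |\<alpha> c. has_taylor I f p c \<and> \<alpha> \<in> multi_indices I \<and> c \<alpha> \<noteq> 0}"
    then obtain \<beta> c' where \<beta>: "x = enat (\<Sum>j\<in>I. \<beta> j)" "has_taylor I f p c'" "\<beta> \<in> multi_indices I" "c' \<beta> \<noteq> 0" by blast
    then have "c \<beta> \<noteq> 0" using has_taylor_unique[OF assms(1,2)] by metis
    then show "enat \<mu> \<le> x" using assms(3) \<beta> by simp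
  qed
qed

end

section \<open>Recentring Taylor expansions\<close>

context complex_embedding begin
interpretation \<iota>: bounded_linear \<iota> by (rule linear)
text \<open>The part of \<open>c_\<alpha> (h + p)^\<alpha>\<close> with
  \<open>\<alpha> = \<beta> + \<gamma>\<close> that multiplies \<open>h^\<beta>\<close>.\<close>

definition recenter_term ::
  "'i set \<Rightarrow> (('i \<Rightarrow> nat) \<Rightarrow> 'k) \<Rightarrow> ('i \<Rightarrow> 'k) \<Rightarrow> ('i \<Rightarrow> nat) \<Rightarrow> ('i \<Rightarrow> nat) \<Rightarrow> 'k" where
  "recenter_term I c p \<beta> \<gamma> = c (\<lambda>j. \<beta> j + \<gamma> j) * of_nat (\<Prod>j\<in>I. (\<beta> j + \<gamma> j) choose \<beta> j) * monomial I \<gamma> p"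

definition recentered :: "'i set \<Rightarrow> (('i \<Rightarrow> nat) \<Rightarrow> 'k) \<Rightarrow> ('i \<Rightarrow> 'k) \<Rightarrow> ('i \<Rightarrow> nat) \<Rightarrow> 'k" where
  "recentered I c p \<beta> = infsum (recenter_term I c p \<beta>) (multi_indices I)"

text \<open>The radius is shared equally between centre and displacement, so the binomial expansions
  are dominated by the series at \<open>\<rho>\<close>. Absolute summability then allows reindexing
  from \<open>\<beta> \<le> \<alpha>\<close> to arbitrary pairs \<open>\<beta>\<close>,
  \<open>\<gamma>\<close>.\<close>

lemma recenter_summable:
  assumes I: "finite I" and T: "taylor_on I f (\<lambda>_. 0) c \<rho>"
    and p: "\<And>j. j \<in> I \<Longrightarrow> norm (p j) \<le> \<rho> / 2"
    and h: "\<And>j. j \<in> I \<Longrightarrow> norm (h j) \<le> \<rho> / 2"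
  shows "(\<lambda>(\<beta>, \<gamma>). norm (recenter_term I c p \<beta> \<gamma> * monomial I \<beta> h)) summable_on (multi_indices I \<times> multi_indices I)"
    "((\<lambda>(\<beta>, \<gamma>). recenter_term I c p \<beta> \<gamma> * monomial I \<beta> h) has_sum f (\<lambda>j. p j + h j)) (multi_indices I \<times> multi_indices I)"
proof -
  let ?M = "multi_indices I"
  let ?B = "\<lambda>\<alpha>. {\<beta> \<in> ?M. \<forall>j\<in>I. \<beta> j \<le> \<alpha> j}"
  define T' where "T' = (\<lambda>(\<alpha>, \<beta>). c \<alpha> * (\<Prod>j\<in>I. of_nat (\<alpha> j choose \<beta> j) * h j ^ \<beta> j * p j ^ (\<alpha> j - \<beta> j)))"
  have \<rho>: "\<rho> > 0" using T by (simp add: taylor_on_def)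
  have fin: "finite (?B \<alpha>)" for \<alpha> :: "_ \<Rightarrow> nat" by (rule finite_multi_indices_le[OF I])
  have normT': "norm (T' (\<alpha>, \<beta>)) = norm (c \<alpha>) * (\<Prod>j\<in>I. of_nat (\<alpha> j choose \<beta> j) * norm (h j) ^ \<beta> j * norm (p j) ^ (\<alpha> j - \<beta> j))" for \<alpha> \<beta>
    by (simp add: T'_def norm_mult norm_power flip: prod_norm)
  have norm_T': "(\<lambda>q. norm (T' q)) summable_on (Sigma ?M ?B)"
  proof (rule summable_on_SigmaI)
    show "((\<lambda>\<beta>. norm (T' (\<alpha>, \<beta>))) has_sum norm (c \<alpha>) * (\<Prod>j\<in>I. (norm (h j) + norm (p j)) ^ \<alpha> j)) (?B \<alpha>)" for \<alpha>
      unfolding normT' multi_binomial[OF I, symmetric] sum_distrib_left by (rule has_sum_finite[OF fin])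
    show "(\<lambda>\<alpha>. norm (c \<alpha>) * (\<Prod>j\<in>I. (norm (h j) + norm (p j)) ^ \<alpha> j)) summable_on ?M"
    proof (rule summable_on_comparison_test)
      show "(\<lambda>\<alpha>. norm (c \<alpha>) * \<rho> ^ (\<Sum>j\<in>I. \<alpha> j)) summable_on ?M" using T by (simp add: taylor_on_def)
      show "norm (c \<alpha>) * (\<Prod>j\<in>I. (norm (h j) + norm (p j)) ^ \<alpha> j) \<le> norm (c \<alpha>) * \<rho> ^ (\<Sum>j\<in>I. \<alpha> j)" for \<alpha>
        unfolding power_sum
      proof (intro mult_left_mono prod_mono conjI power_mono)
        show "norm (h j) + norm (p j) \<le> \<rho>" if "j \<in> I" for j using h[OF that] p[OF that] by simp
      qed auto
    qed (auto intro!: mult_nonneg_nonneg prod_nonneg)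
  qed auto
  have sumT': "(T' has_sum f (\<lambda>j. p j + h j)) (Sigma ?M ?B)"
  proof -
    have 1: "((\<lambda>\<beta>. T' (\<alpha>, \<beta>)) has_sum c \<alpha> * monomial I \<alpha> (\<lambda>j. h j + p j)) (?B \<alpha>)" for \<alpha>
      unfolding T'_def prod.case monomial_def multi_binomial[OF I, symmetric] sum_distrib_left
      by (rule has_sum_finite[OF fin])
    have "((\<lambda>\<alpha>. c \<alpha> * monomial I \<alpha> (\<lambda>j. h j + p j)) has_sum infsum T' (Sigma ?M ?B)) ?M"
      by (rule has_sum_SigmaD[OF has_sum_infsum[OF abs_summable_summable[OF norm_T']] 1])
    moreover have "((\<lambda>\<alpha>. c \<alpha> * monomial I \<alpha> (\<lambda>j. h j + p j)) has_sum f (\<lambda>j. 0 + (h j + p j))) ?M"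
    proof -
      have "norm (h j + p j) \<le> \<rho>" if "j \<in> I" for j
        using h[OF that] p[OF that] norm_triangle_ineq[of "h j" "p j"] by simp
      then show ?thesis by (rule taylor_onD[OF T])
    qed
    ultimately have "infsum T' (Sigma ?M ?B) = f (\<lambda>j. p j + h j)"
      using has_sum_unique by (fastforce simp: add.commute)
    then show ?thesis using has_sum_infsum[OF abs_summable_summable[OF norm_T']] by simp
  qed
  have aux: "(\<lambda>j. \<beta> j + (\<alpha> j - \<beta> j)) = \<alpha>" if "\<alpha> \<in> ?M" "\<forall>j\<in>I. \<beta> j \<le> \<alpha> j" "\<beta> \<in> ?M" for \<alpha> \<beta> :: "_ \<Rightarrow> nat"
  proof
    fix j show "\<beta> j + (\<alpha> j - \<beta> j) = \<alpha> j"
      by (cases "j \<in> I") (use that in \<open>auto simp: multi_indices_def\<close>)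
  qed
  have bij: "bij_betw (\<lambda>(\<beta>, \<gamma>). (\<lambda>j. \<beta> j + \<gamma> j, \<beta>)) (?M \<times> ?M) (Sigma ?M ?B)"
    by (rule bij_betw_byWitness[where f' = "\<lambda>(\<alpha>, \<beta>). (\<beta>, \<lambda>j. \<alpha> j - \<beta> j)"])
      (auto simp: aux, auto simp: multi_indices_def)
  have TT': "T' ((\<lambda>(\<beta>, \<gamma>). (\<lambda>j. \<beta> j + \<gamma> j, \<beta>)) q) = (\<lambda>(\<beta>, \<gamma>). recenter_term I c p \<beta> \<gamma> * monomial I \<beta> h) q" for q
    by (cases q) (simp add: T'_def recenter_term_def monomial_def prod.distrib mult_ac)
  show "((\<lambda>(\<beta>, \<gamma>). recenter_term I c p \<beta> \<gamma> * monomial I \<beta> h) has_sum f (\<lambda>j. p j + h j)) (?M \<times> ?M)"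
    using has_sum_reindex_bij_betw[OF bij, of T'] sumT' unfolding TT' by simp
  have "(\<lambda>q. norm ((\<lambda>(\<beta>, \<gamma>). recenter_term I c p \<beta> \<gamma> * monomial I \<beta> h) q)) summable_on (?M \<times> ?M)"
    using summable_on_reindex_bij_betw[OF bij, of "\<lambda>q. norm (T' q)"] norm_T' unfolding TT' by simp
  then show "(\<lambda>(\<beta>, \<gamma>). norm (recenter_term I c p \<beta> \<gamma> * monomial I \<beta> h)) summable_on (?M \<times> ?M)"
    by (simp add: case_prod_unfold)
qed

lemma recenter_coeff_summable:
  fixes I :: "'i set"
  assumes I: "finite I" and T: "taylor_on I f (\<lambda>_. 0) c \<rho>"
    and p: "\<And>j. j \<in> I \<Longrightarrow> norm (p j) \<le> \<rho> / 2" and \<beta>: "\<beta> \<in> multi_indices I"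
  shows "(\<lambda>\<gamma>. norm (recenter_term I c p \<beta> \<gamma>)) summable_on multi_indices I"
proof -
  have \<rho>: "\<rho> > 0" using T by (simp add: taylor_on_def)
  define h where "h = (\<lambda>j::'i. of_real (\<rho> / 2) :: 'k)"
  have h: "norm (h j) \<le> \<rho> / 2" for j using \<rho> by (simp add: h_def)
  have m: "norm (monomial I \<beta> h) > 0" using \<rho> I by (simp add: monomial_def h_def)
  have "(\<lambda>(\<beta>, \<gamma>). norm (recenter_term I c p \<beta> \<gamma> * monomial I \<beta> h)) summable_on ({\<beta>} \<times> multi_indices I)"
    using recenter_summable(1)[OF I T p h] by (rule summable_on_subset_banach) (use \<beta> in auto)
  moreover have "bij_betw (\<lambda>\<gamma>. (\<beta>, \<gamma>)) (multi_indices I) ({\<beta>} \<times> multi_indices I)" by (auto simp: bij_betw_def inj_on_def)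
  ultimately have "(\<lambda>\<gamma>. norm (recenter_term I c p \<beta> \<gamma> * monomial I \<beta> h)) summable_on multi_indices I"
    using summable_on_reindex_bij_betw[of "\<lambda>\<gamma>. (\<beta>, \<gamma>)" "multi_indices I" "{\<beta>} \<times> multi_indices I" "\<lambda>(\<beta>, \<gamma>). norm (recenter_term I c p \<beta> \<gamma> * monomial I \<beta> h)"] by simp
  then have "(\<lambda>\<gamma>. norm (recenter_term I c p \<beta> \<gamma> * monomial I \<beta> h) * (1 / norm (monomial I \<beta> h))) summable_on multi_indices I"
    by (rule summable_on_cmult_left)
  moreover have "norm (recenter_term I c p \<beta> \<gamma> * monomial I \<beta> h) * (1 / norm (monomial I \<beta> h)) = norm (recenter_term I c p \<beta> \<gamma>)" for \<gamma>
    using m by (simp add: norm_mult)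
  ultimately show ?thesis by simp
qed

lemma recenter:
  assumes I: "finite I" and T: "taylor_on I f (\<lambda>_. 0) c \<rho>"
    and p: "\<And>j. j \<in> I \<Longrightarrow> norm (p j) \<le> \<rho> / 2"
  shows "has_taylor I f p (recentered I c p)"
  unfolding has_taylor_def eventually_coord_nhds
proof (intro exI[of _ "\<rho> / 2"] conjI ballI)
  show "\<rho> / 2 > 0" using T by (simp add: taylor_on_def)
  fix z assume "z \<in> polydisc I p (\<rho> / 2)"
  then have h: "norm (z j - p j) \<le> \<rho> / 2" if "j \<in> I" for j using that by (auto simp: polydisc_def less_imp_le)
  show "((\<lambda>\<beta>. recentered I c p \<beta> * (\<Prod>j\<in>I. (z j - p j) ^ \<beta> j)) has_sum f z) (multi_indices I)"
  proof (rule has_sum_SigmaD)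
    show "((\<lambda>(\<beta>, \<gamma>). recenter_term I c p \<beta> \<gamma>
       * monomial I \<beta> (\<lambda>j. z j - p j)) has_sum f z) (Sigma (multi_indices I) (\<lambda>_. multi_indices I))"
    proof -
      have "((\<lambda>(\<beta>, \<gamma>). recenter_term I c p \<beta> \<gamma>
       * monomial I \<beta> (\<lambda>j. z j - p j)) has_sum f (\<lambda>j. p j + (z j - p j))) (multi_indices I \<times> multi_indices I)"
        by (rule recenter_summable(2)[OF I T]) (use p h in auto)
      then show ?thesis by simp
    qed
    fix \<beta> assume \<beta>: "\<beta> \<in> multi_indices I"
    have "((\<lambda>\<gamma>. recenter_term I c p \<beta> \<gamma>) has_sum recentered I c p \<beta>) (multi_indices I)"
      unfolding recentered_def by (rule has_sum_infsum[OF abs_summable_summable[OF recenter_coeff_summable[OF I T p \<beta>]]])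
    from has_sum_cmult_left[OF this, of "monomial I \<beta> (\<lambda>j. z j - p j)"]
    show "((\<lambda>\<gamma>. (\<lambda>(\<beta>, \<gamma>). recenter_term I c p \<beta> \<gamma>
       * monomial I \<beta> (\<lambda>j. z j - p j)) (\<beta>, \<gamma>)) has_sum recentered I c p \<beta> * (\<Prod>j\<in>I. (z j - p j) ^ \<beta> j)) (multi_indices I)"
      by (simp add: monomial_def)
  qed
qed

text \<open>The term with \<open>\<gamma> = 0\<close> is \<open>c \<beta>\<close> for every centre,
  and all others contain a factor from \<open>p\<close>, so they are jointly small for small
  \<open>p\<close>.\<close>

lemma recentered_near:
  fixes I :: "'i set"
  assumes I: "finite I" and T: "taylor_on I f (\<lambda>_. 0) c \<rho>" and \<beta>: "\<beta> \<in> multi_indices I" and nz: "c \<beta> \<noteq> 0"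
  obtains e where "e > 0" "\<And>p :: 'i \<Rightarrow> 'k. (\<And>j. j \<in> I \<Longrightarrow> norm (p j) \<le> e) \<Longrightarrow> recentered I c p \<beta> \<noteq> 0"
proof -
  have \<rho>: "\<rho> > 0" using T by (simp add: taylor_on_def)
  let ?M = "multi_indices I" and ?z = "\<lambda>_::'i. 0 :: nat"
  define u where "u p = recenter_term I c p \<beta>" for p
  have zM: "?z \<in> ?M" by (simp add: multi_indices_def)
  define P where "P = (\<lambda>_::'i. of_real (\<rho> / 2) :: 'k)"
  have sumP: "(\<lambda>\<gamma>. norm (u P \<gamma>)) summable_on ?M"
    unfolding u_def by (rule recenter_coeff_summable[OF I T _ \<beta>]) (use \<rho> in \<open>simp add: P_def\<close>)
  define S where "S = infsum (\<lambda>\<gamma>. norm (u P \<gamma>)) ?M"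
  have S0: "S \<ge> 0" unfolding S_def by (rule infsum_nonneg) simp
  \<comment> \<open>Shrinking the centre by \<open>\<sigma> \<le> 1\<close> gains at least one
    factor \<open>\<sigma>\<close> in every term with \<open>\<gamma> \<noteq> 0\<close>; the value
    is chosen to push their sum, at most \<open>\<sigma> S\<close>, below
    \<open>norm (c \<beta>)\<close>. The summand 1 guards against \<open>S = 0\<close>.\<close>
  define \<sigma> where "\<sigma> = min 1 (norm (c \<beta>) / (2 * (S + 1)))"
  have \<sigma>: "\<sigma> > 0" "\<sigma> \<le> 1" "\<sigma> * S < norm (c \<beta>)"
  proof -
    show "\<sigma> > 0" "\<sigma> \<le> 1" using nz S0 by (auto simp: \<sigma>_def)
    have "\<sigma> * S \<le> norm (c \<beta>) / (2 * (S + 1)) * (S + 1)" using S0 by (intro mult_mono) (auto simp: \<sigma>_def)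
    also have "\<dots> = norm (c \<beta>) / 2" using S0 by (simp add: field_simps)
    also have "\<dots> < norm (c \<beta>)" using nz by simp
    finally show "\<sigma> * S < norm (c \<beta>)" .
  qed
  show ?thesis
  proof (rule that[of "\<sigma> * (\<rho> / 2)"])
    show "\<sigma> * (\<rho> / 2) > 0" using \<sigma> \<rho> by simp
    fix p :: "'i \<Rightarrow> 'k" assume p: "\<And>j. j \<in> I \<Longrightarrow> norm (p j) \<le> \<sigma> * (\<rho> / 2)"
    have "\<sigma> * (\<rho> / 2) \<le> 1 * (\<rho> / 2)" using \<sigma> \<rho> by (intro mult_right_mono) auto
    then have p': "norm (p j) \<le> \<rho> / 2" if "j \<in> I" for j using p[OF that] by simp
    have sump: "(\<lambda>\<gamma>. norm (u p \<gamma>)) summable_on ?M"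
      unfolding u_def by (rule recenter_coeff_summable[OF I T p' \<beta>])
    have le: "norm (u p \<gamma>) \<le> \<sigma> * norm (u P \<gamma>)" if \<gamma>: "\<gamma> \<in> ?M - {?z}" for \<gamma>
    proof -
      have "\<exists>j\<in>I. \<gamma> j \<noteq> 0" using \<gamma> by (auto simp: multi_indices_def fun_eq_iff)
      then have n: "(\<Sum>j\<in>I. \<gamma> j) \<noteq> 0" using I by simp
      have "norm (monomial I \<gamma> p) \<le> (\<sigma> * (\<rho> / 2)) ^ (\<Sum>j\<in>I. \<gamma> j)"
        by (rule norm_monomial_le) (use p \<sigma> \<rho> in auto)
      also have "\<dots> = \<sigma> ^ (\<Sum>j\<in>I. \<gamma> j) * (\<rho> / 2) ^ (\<Sum>j\<in>I. \<gamma> j)" by (rule power_mult_distrib)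
      also have "\<dots> \<le> \<sigma> * (\<rho> / 2) ^ (\<Sum>j\<in>I. \<gamma> j)"
        using \<sigma> \<rho> n power_decreasing[of 1 "\<Sum>j\<in>I. \<gamma> j" \<sigma>] by (intro mult_right_mono) auto
      also have "(\<rho> / 2) ^ (\<Sum>j\<in>I. \<gamma> j) = norm (monomial I \<gamma> P)"
        using \<rho> by (simp add: monomial_def P_def norm_power power_sum flip: prod_norm)
      finally have "norm (monomial I \<gamma> p) \<le> \<sigma> * norm (monomial I \<gamma> P)" .
      then have "norm (c (\<lambda>j. \<beta> j + \<gamma> j) * of_nat (\<Prod>j\<in>I. (\<beta> j + \<gamma> j) choose \<beta> j)) * norm (monomial I \<gamma> p)
        \<le> norm (c (\<lambda>j. \<beta> j + \<gamma> j) * of_nat (\<Prod>j\<in>I. (\<beta> j + \<gamma> j) choose \<beta> j)) * (\<sigma> * norm (monomial I \<gamma> P))"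
        by (rule mult_left_mono) simp
      then show ?thesis by (simp add: u_def recenter_term_def norm_mult mult_ac)
    qed
    have uz: "u p ?z = c \<beta>" by (simp add: u_def recenter_term_def monomial_def)
    have total: "(u p has_sum recentered I c p \<beta>) ?M"
      using has_sum_infsum[OF abs_summable_summable[OF sump]] by (simp add: recentered_def u_def)
    have single: "(u p has_sum c \<beta>) {?z}"
      by (rule has_sum_finiteI) (use uz in auto)
    have "(u p has_sum recentered I c p \<beta> - c \<beta>) (?M - {?z})"
      by (rule has_sum_Diff[OF total single]) (use zM in auto)
    then have d: "recentered I c p \<beta> - c \<beta> = infsum (u p) (?M - {?z})" by (simp add: infsumI)
    have s1: "(\<lambda>\<gamma>. norm (u p \<gamma>)) summable_on (?M - {?z})" using sump by (rule summable_on_subset_banach) auto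
    have s2: "(\<lambda>\<gamma>. \<sigma> * norm (u P \<gamma>)) summable_on (?M - {?z})"
      by (rule summable_on_cmult_right, rule summable_on_subset_banach[OF sumP]) auto
    have "norm (infsum (u p) (?M - {?z})) \<le> infsum (\<lambda>\<gamma>. norm (u p \<gamma>)) (?M - {?z})"
      by (rule norm_infsum_bound[OF s1])
    also have "\<dots> \<le> infsum (\<lambda>\<gamma>. \<sigma> * norm (u P \<gamma>)) (?M - {?z})"
      by (rule infsum_mono[OF s1 s2 le])
    also have "\<dots> \<le> infsum (\<lambda>\<gamma>. \<sigma> * norm (u P \<gamma>)) ?M"
      by (rule infsum_mono2[OF s2 summable_on_cmult_right[OF sumP]]) (use \<sigma> in auto)
    also have "\<dots> = \<sigma> * S" unfolding S_def by (rule infsum_cmult_right) (simp add: sumP)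
    finally have "norm (recentered I c p \<beta> - c \<beta>) < norm (c \<beta>)" using d \<sigma>(3) by simp
    then show "recentered I c p \<beta> \<noteq> 0" by auto
  qed
qed

end

section \<open>Restriction of the system to planes\<close>

text \<open>Asking for all small \<open>r\<close>, not just one, lets finitely many conditions be
  combined as eventualities.\<close>

definition near :: "(real \<Rightarrow> real \<Rightarrow> bool) \<Rightarrow> bool" where
  "near P \<longleftrightarrow> (\<forall>\<^sub>F r in at_right 0. \<forall>x y. \<bar>x\<bar> \<le> r \<longrightarrow> \<bar>y\<bar> \<le> r \<longrightarrow> P x y)"

lemma near_mono: "near P \<Longrightarrow> (\<And>x y. P x y \<Longrightarrow> Q x y) \<Longrightarrow> near Q"
  unfolding near_def by (erule eventually_mono) blast

lemma near_conj_mono: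
  assumes "near P" "near Q" "\<And>x y. P x y \<Longrightarrow> Q x y \<Longrightarrow> R x y"
  shows "near R"
  using assms(1,2) unfolding near_def by eventually_elim (use assms(3) in blast)

lemma near_conj: "near P \<Longrightarrow> near Q \<Longrightarrow> near (\<lambda>x y. P x y \<and> Q x y)"
  by (rule near_conj_mono[of P Q]) auto

lemma near_ball: "finite S \<Longrightarrow> (\<And>k. k \<in> S \<Longrightarrow> near (P k)) \<Longrightarrow> near (\<lambda>x y. \<forall>k\<in>S. P k x y)"
proof (induction S rule: finite_induct)
  case empty
  then show ?case by (simp add: near_def)
next
  case (insert k S)
  show ?case
    by (rule near_conj_mono[of "P k" "\<lambda>x y. \<forall>k\<in>S. P k x y"]) (use insert in auto)
qed

lemma near_iff: "near P \<longleftrightarrow> (\<exists>e>0. \<forall>x y. \<bar>x\<bar> \<le> e \<longrightarrow> \<bar>y\<bar> \<le> e \<longrightarrow> P x y)"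
proof
  assume "near P"
  then have "\<forall>\<^sub>F r in at_right 0. r > 0 \<and> (\<forall>x y. \<bar>x\<bar> \<le> r \<longrightarrow> \<bar>y\<bar> \<le> r \<longrightarrow> P x y)"
    unfolding near_def by (intro eventually_conj eventually_at_right_less)
  then show "\<exists>e>0. \<forall>x y. \<bar>x\<bar> \<le> e \<longrightarrow> \<bar>y\<bar> \<le> e \<longrightarrow> P x y"
    by (metis (mono_tags, lifting) eventually_happens' trivial_limit_at_right_real)
next
  assume "\<exists>e>0. \<forall>x y. \<bar>x\<bar> \<le> e \<longrightarrow> \<bar>y\<bar> \<le> e \<longrightarrow> P x y"
  then obtain e where e: "e > 0" "\<And>x y. \<bar>x\<bar> \<le> e \<Longrightarrow> \<bar>y\<bar> \<le> e \<Longrightarrow> P x y" by blast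
  show "near P" unfolding near_def eventually_at_right_field
    using e by (intro exI[of _ e]) auto
qed

definition convergent2 :: "complex fps fps \<Rightarrow> bool" where
  "convergent2 A \<longleftrightarrow> (\<forall>\<^sub>F r in at_right 0. conv2 r A)"

lemma convergent2_iff: "convergent2 A \<longleftrightarrow> (\<exists>r>0. conv2 r A)"
proof
  assume "convergent2 A"
  then have "\<forall>\<^sub>F r in at_right 0. r > 0 \<and> conv2 r A"
    unfolding convergent2_def by (intro eventually_conj eventually_at_right_less)
  then show "\<exists>r>0. conv2 r A"
    by (metis (mono_tags, lifting) eventually_happens' trivial_limit_at_right_real)
next
  assume "\<exists>r>0. conv2 r A"
  then obtain r where "r > 0" "conv2 r A" by blast
  then show "convergent2 A" unfolding convergent2_def eventually_at_right_field
    by (intro exI[of _ r]) (auto intro: conv2_mono)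
qed

text \<open>Finitely many convergent series share a radius on which evaluation is a ring
  homomorphism. Whatever follows from that alone, for a fixed radius and point, therefore holds near
  the origin.\<close>

lemma convergent2_hom:
  assumes "finite S" "\<And>A. A \<in> S \<Longrightarrow> convergent2 A"
    and "\<And>r x y. r > 0 \<Longrightarrow> S \<subseteq> {A. conv2 r A} \<Longrightarrow> \<bar>x\<bar> \<le> r \<Longrightarrow> \<bar>y\<bar> \<le> r \<Longrightarrow>
      partial_hom {A. conv2 r A} (ev2 (complex_of_real x) (complex_of_real y)) \<Longrightarrow> conv2 r B \<and> P x y"
  shows "convergent2 B" "near P"
proof -
  have "\<forall>\<^sub>F r in at_right 0. \<forall>A\<in>S. conv2 r A"
    using assms(1,2) by (simp add: eventually_ball_finite_distrib convergent2_def)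
  then have *: "\<forall>\<^sub>F r in at_right 0. r > 0 \<and> S \<subseteq> {A. conv2 r A}"
    using eventually_at_right_less[of "0::real"] by eventually_elim auto
  show "convergent2 B" unfolding convergent2_def using *
  proof eventually_elim
    case (elim r)
    then show ?case using assms(3)[of r 0 0] partial_hom_ev2[of "of_real 0" r "of_real 0"] by simp
  qed
  show "near P" unfolding near_def using *
  proof eventually_elim
    case (elim r)
    then show ?case using assms(3)[of r] partial_hom_ev2[of "of_real _" r "of_real _"] by simp
  qed
qed

definition represents_poly :: "(real \<Rightarrow> real \<Rightarrow> complex poly) \<Rightarrow> complex fps fps poly \<Rightarrow> bool" where
  "represents_poly Q R \<longleftrightarrow> (\<forall>j. convergent2 (coeff R j)) \<and> near (\<lambda>x y. Q x y = map_poly (ev2 x y) R)"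

section \<open>Arithmetic of germs represented on planes\<close>

context complex_embedding begin

lemma represents_iff: "represents f A \<longleftrightarrow> convergent2 A \<and> near (\<lambda>x y. f x y = ev2 x y A)"
proof
  assume "represents f A"
  then show "convergent2 A \<and> near (\<lambda>x y. f x y = ev2 x y A)"
    unfolding represents_def convergent2_iff near_iff by blast
next
  assume "convergent2 A \<and> near (\<lambda>x y. f x y = ev2 x y A)"
  then obtain r e where *: "r > 0" "conv2 r A" "e > 0" "\<And>x y. \<bar>x\<bar> \<le> e \<Longrightarrow> \<bar>y\<bar> \<le> e \<Longrightarrow> f x y = ev2 x y A"
    unfolding convergent2_iff near_iff by blast
  then have "conv2 (min r e) A" by (intro conv2_mono[OF *(2)]) auto
  with * show "represents f A" unfolding represents_def
    by (intro exI[of _ "min r e"]) auto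
qed

lemma represents_cong: "represents f A \<Longrightarrow> near (\<lambda>x y. g x y = f x y) \<Longrightarrow> represents g A"
  unfolding represents_iff by (elim conjE, intro conjI, assumption, erule (1) near_conj_mono) simp

lemma represents_poly_cong: "represents_poly Q R \<Longrightarrow> near (\<lambda>x y. Q' x y = Q x y) \<Longrightarrow> represents_poly Q' R"
  unfolding represents_poly_def by (elim conjE, intro conjI, assumption, erule (1) near_conj_mono) simp

lemma represents_eqI: "represents f A \<Longrightarrow> represents f B \<Longrightarrow> A = B"
  using represents_unique[of f A f B 1] by simp

lemma represents_mult:
  assumes "represents f A" "represents g B"
  shows "represents (\<lambda>x y. f x y * g x y) (A * B)"
proof -
  have AB: "finite {A, B}" "\<And>a. a \<in> {A, B} \<Longrightarrow> convergent2 a"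
    using assms by (auto simp: represents_iff)
  have step: "conv2 r (A * B) \<and> ev2 x y (A * B) = ev2 x y A * ev2 x y B"
    if "{A, B} \<subseteq> {A. conv2 r A}" "partial_hom {A. conv2 r A} (ev2 (complex_of_real x) (complex_of_real y))" for r x y
    using partial_hom.C_mult[OF that(2), of A B] partial_hom.h_mult[OF that(2), of A B] that(1) by auto
  note hom = convergent2_hom[OF AB step]
  have A: "near (\<lambda>x y. f x y = ev2 x y A)" and B: "near (\<lambda>x y. g x y = ev2 x y B)"
    using assms by (auto simp: represents_iff)
  have "near (\<lambda>x y. f x y * g x y = ev2 x y (A * B))"
    by (rule near_conj_mono[OF near_conj[OF A B] hom(2)]) auto
  then show ?thesis using hom(1) by (simp add: represents_iff)
qed

lemma represents_poly_common:
  assumes "represents_poly Q R"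
  shows "\<exists>S. finite S \<and> (\<forall>a\<in>S. convergent2 a) \<and>
    (\<forall>r x y. S \<subseteq> {A. conv2 r A} \<longrightarrow> partial_hom {A. conv2 r A} (ev2 (complex_of_real x) (complex_of_real y)) \<longrightarrow>
       R \<in> partial_hom.Cpoly {A. conv2 r A})"
proof (intro exI conjI allI impI)
  \<comment> \<open>The element 0 accounts for the coefficients beyond the degree.\<close>
  let ?S = "coeff R ` {..degree R} \<union> {0}"
  show "finite ?S" by simp
  have "convergent2 0" using conv2_const(1)[of _ 0] by (simp add: convergent2_def)
  then show "\<forall>a\<in>?S. convergent2 a" using assms by (auto simp: represents_poly_def)
  fix r x y
  assume *: "?S \<subseteq> {A. conv2 r A}" "partial_hom {A. conv2 r A} (ev2 (complex_of_real x) (complex_of_real y))"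
  have "conv2 r (coeff R j)" for j
    using *(1) by (cases "j \<le> degree R") (force simp: coeff_eq_0)+
  then show "R \<in> partial_hom.Cpoly {A. conv2 r A}"
    by (simp add: partial_hom.Cpoly_def[OF *(2)])
qed

lemma represents_poly_mult:
  assumes "represents_poly f A" "represents_poly g B"
  shows "represents_poly (\<lambda>x y. f x y * g x y) (A * B)"
proof -
  obtain S where S: "finite S" "\<forall>a\<in>S. convergent2 a"
    "\<And>r x y. S \<subseteq> {A. conv2 r A} \<Longrightarrow> partial_hom {A. conv2 r A} (ev2 (complex_of_real x) (complex_of_real y)) \<Longrightarrow>
       A \<in> partial_hom.Cpoly {A. conv2 r A}"
    using represents_poly_common[OF assms(1)] by blast
  obtain T where T: "finite T" "\<forall>a\<in>T. convergent2 a"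
    "\<And>r x y. T \<subseteq> {A. conv2 r A} \<Longrightarrow> partial_hom {A. conv2 r A} (ev2 (complex_of_real x) (complex_of_real y)) \<Longrightarrow>
       B \<in> partial_hom.Cpoly {A. conv2 r A}"
    using represents_poly_common[OF assms(2)] by blast
  have ST: "finite (S \<union> T)" "\<And>a. a \<in> S \<union> T \<Longrightarrow> convergent2 a" using S T by auto
  have step: "conv2 r (coeff (A * B) j) \<and> map_poly (ev2 x y) (A * B) = map_poly (ev2 x y) A * map_poly (ev2 x y) B"
    if "S \<union> T \<subseteq> {A. conv2 r A}" "partial_hom {A. conv2 r A} (ev2 (complex_of_real x) (complex_of_real y))" for r x y j
    using partial_hom.Cpoly_mult[OF that(2) S(3)[OF _ that(2)] T(3)[OF _ that(2)]] partial_hom.Cpoly_def[OF that(2)] that(1)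
    by blast
  have conv: "convergent2 (coeff (A * B) j)" for j
    by (rule convergent2_hom(1)[OF ST step])
  have ev: "near (\<lambda>x y. map_poly (ev2 x y) (A * B) = map_poly (ev2 x y) A * map_poly (ev2 x y) B)"
    by (rule convergent2_hom(2)[OF ST step])
  have A: "near (\<lambda>x y. f x y = map_poly (ev2 x y) A)" and B: "near (\<lambda>x y. g x y = map_poly (ev2 x y) B)"
    using assms by (auto simp: represents_poly_def)
  have "near (\<lambda>x y. f x y * g x y = map_poly (ev2 x y) (A * B))"
    by (rule near_conj_mono[OF near_conj[OF A B] ev]) auto
  then show ?thesis using conv by (simp add: represents_poly_def)
qed

lemma represents_poly_1: "represents_poly (\<lambda>x y. 1) 1"
proof -
  have c: "convergent2 (coeff 1 j)" for j
    using conv2_const(1)[of _ 0] conv2_const(1)[of _ 1] by (auto simp: convergent2_def coeff_1)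
  have "near (\<lambda>x y. map_poly (ev2 x y) 1 = 1)"
    by (rule convergent2_hom(2)[of "{}", where B = 0])
      (use partial_hom.map_poly_1 conv2_const(1)[of _ 0] in auto)
  then show ?thesis using c unfolding represents_poly_def by (auto elim: near_mono)
qed

lemma represents_poly_power: "represents_poly f A \<Longrightarrow> represents_poly (\<lambda>x y. f x y ^ n) (A ^ n)"
  by (induction n) (auto intro: represents_poly_1 represents_poly_mult)

lemma represents_poly_prod:
  "(\<And>k. k \<in> S \<Longrightarrow> represents_poly (f k) (A k)) \<Longrightarrow> represents_poly (\<lambda>x y. \<Prod>k\<in>S. f k x y) (\<Prod>k\<in>S. A k)"
  by (induction S rule: infinite_finite_induct) (auto intro: represents_poly_1 represents_poly_mult)

lemma represents_poly_eval:
  assumes "represents_poly Q R" "represents f A"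
  shows "represents (\<lambda>x y. poly (Q x y) (f x y)) (poly R A)"
proof -
  obtain S where S: "finite S" "\<forall>a\<in>S. convergent2 a"
    "\<And>r x y. S \<subseteq> {A. conv2 r A} \<Longrightarrow> partial_hom {A. conv2 r A} (ev2 (complex_of_real x) (complex_of_real y)) \<Longrightarrow>
       R \<in> partial_hom.Cpoly {A. conv2 r A}"
    using represents_poly_common[OF assms(1)] by blast
  have fin: "finite (insert A S)" and cv: "\<And>a. a \<in> insert A S \<Longrightarrow> convergent2 a"
    using S assms(2) by (auto simp: represents_iff)
  have step: "conv2 r (poly R A) \<and> ev2 x y (poly R A) = poly (map_poly (ev2 x y) R) (ev2 x y A)"
    if "insert A S \<subseteq> {A. conv2 r A}" "partial_hom {A. conv2 r A} (ev2 (complex_of_real x) (complex_of_real y))" for r x y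
    using partial_hom.hom_poly[OF that(2) S(3)[OF _ that(2)], of A] that by auto
  note hom = convergent2_hom[OF fin cv step]
  have Q: "near (\<lambda>x y. Q x y = map_poly (ev2 x y) R)" and f: "near (\<lambda>x y. f x y = ev2 x y A)"
    using assms by (auto simp: represents_poly_def represents_iff)
  have "near (\<lambda>x y. poly (Q x y) (f x y) = ev2 x y (poly R A))"
    by (rule near_conj_mono[OF near_conj[OF Q f] hom(2)]) auto
  then show ?thesis using hom(1) by (simp add: represents_iff)
qed

text \<open>A monic polynomial keeps its degree under evaluation, and in characteristic 0 so does
  its derivative; hence the Sylvester matrix keeps its size.\<close>

lemma represents_poly_discriminant:
  assumes rep: "represents_poly Q R" and monic: "lead_coeff R = 1"
  shows "near (\<lambda>x y. degree (Q x y) = degree R \<and> lead_coeff (Q x y) = 1)"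
    and "represents (\<lambda>x y. resultant (Q x y) (pderiv (Q x y))) (resultant R (pderiv R))"
proof -
  obtain S where S: "finite S" "\<forall>a\<in>S. convergent2 a"
    "\<And>r x y. S \<subseteq> {A. conv2 r A} \<Longrightarrow> partial_hom {A. conv2 r A} (ev2 (complex_of_real x) (complex_of_real y)) \<Longrightarrow>
       R \<in> partial_hom.Cpoly {A. conv2 r A}"
    using represents_poly_common[OF rep] by blast
  let ?q = "\<lambda>x y. map_poly (ev2 (complex_of_real x) (complex_of_real y)) R"
  have step: "conv2 r (resultant R (pderiv R)) \<and> (degree (?q x y) = degree R \<and> lead_coeff (?q x y) = 1 \<and>
      ev2 x y (resultant R (pderiv R)) = resultant (?q x y) (pderiv (?q x y)))"
    if "S \<subseteq> {A. conv2 r A}" "partial_hom {A. conv2 r A} (ev2 (complex_of_real x) (complex_of_real y))" for r x y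
  proof -
    interpret partial_hom "{A. conv2 r A}" "ev2 (complex_of_real x) (complex_of_real y)" by (rule that(2))
    have RC: "R \<in> Cpoly" by (rule S(3)[OF that])
    have lc: "coeff (?q x y) (degree R) = 1" using monic h_1 by simp
    then have "degree R \<le> degree (?q x y)" by (intro le_degree) simp
    then have dg: "degree (?q x y) = degree R" using degree_map_poly_le[of "ev2 x y" R] by simp
    then have "degree (map_poly (ev2 x y) (pderiv R)) = degree (pderiv R)"
      by (simp add: Cpoly_pderiv(2)[OF RC] degree_pderiv)
    from hom_resultant[OF RC Cpoly_pderiv(1)[OF RC] dg this] show ?thesis
      using lc dg Cpoly_pderiv(2)[OF RC] by simp
  qed
  have cv: "\<And>a. a \<in> S \<Longrightarrow> convergent2 a" using S(2) by blast
  note hom = convergent2_hom[OF S(1) cv step]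
  have 1: "convergent2 (resultant R (pderiv R))" by (rule hom(1))
  have 2: "near (\<lambda>x y. degree (?q x y) = degree R \<and> lead_coeff (?q x y) = 1 \<and>
      ev2 x y (resultant R (pderiv R)) = resultant (?q x y) (pderiv (?q x y)))"
    by (rule hom(2))
  have Q: "near (\<lambda>x y. Q x y = ?q x y)" using rep by (simp add: represents_poly_def)
  show "near (\<lambda>x y. degree (Q x y) = degree R \<and> lead_coeff (Q x y) = 1)"
    using near_conj[OF Q 2] by (rule near_mono) auto
  show "represents (\<lambda>x y. resultant (Q x y) (pderiv (Q x y))) (resultant R (pderiv R))"
    unfolding represents_iff using 1 by (rule conjI) (rule near_conj_mono[OF Q 2], auto)
qed

lemma represents_const: "represents (\<lambda>x y. c) (fps_const (fps_const c))"
  unfolding represents_def by (intro exI[of _ 1]) (simp add: conv2_const)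

lemma represents_snd: "represents (\<lambda>x y. of_real y) fps_X"
  unfolding represents_def by (intro exI[of _ 1]) (simp add: conv2_X)

lemma plane_near:
  fixes v :: "'i \<Rightarrow> 'k"
  assumes "finite I" "\<forall>\<^sub>F z in coord_nhds I (\<lambda>_. 0). P z"
  shows "near (\<lambda>x y. P (plane (\<lambda>_. 0) sel v x y))"
proof -
  obtain r where r: "r > 0" "\<And>z. z \<in> polydisc I (\<lambda>_. 0) r \<Longrightarrow> P z"
    using assms(2) unfolding eventually_coord_nhds by blast
  define K where "K = 1 + (\<Sum>j\<in>I. norm (v j))"
  have K: "K \<ge> 1" "\<And>j. j \<in> I \<Longrightarrow> norm (v j) \<le> K"
    unfolding K_def using assms(1) by (auto intro!: sum_nonneg add_increasing member_le_sum)
  show ?thesis unfolding near_iff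
  proof (intro exI[of _ "r / (2 * K)"] conjI allI impI r(2))
    show "r / (2 * K) > 0" using r K by simp
    fix x y assume xy: "\<bar>x\<bar> \<le> r / (2 * K)" "\<bar>y\<bar> \<le> r / (2 * K)"
    have "norm (of_real (if sel j then x else y) * v j) < r" if "j \<in> I" for j
    proof -
      have "\<bar>if sel j then x else y\<bar> * norm (v j) \<le> r / (2 * K) * K"
        using xy K(2)[OF that] r K(1) by (intro mult_mono) auto
      also have "\<dots> < r" using r K by simp
      finally show ?thesis by (simp add: norm_mult)
    qed
    then show "plane (\<lambda>_. 0) sel v x y \<in> polydisc I (\<lambda>_. 0) r"
      by (simp add: polydisc_def plane_def)
  qed
qed

lemma represents_analytic:
  assumes "finite I" "K_analytic_at I f (\<lambda>_. 0)"
  obtains A where "represents (\<lambda>x y. \<iota> (f (plane (\<lambda>_. 0) sel v x y))) A"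
  using assms taylor_plane has_taylor_imp_taylor_on unfolding K_analytic_at_def by metis

lemma represents_0_0:
  assumes "represents f A"
  shows "f 0 0 = fps_nth (fps_nth A 0) 0"
proof -
  obtain r where r: "r > 0" "conv2 r A" "\<And>x y. \<bar>x\<bar> \<le> r \<Longrightarrow> \<bar>y\<bar> \<le> r \<Longrightarrow> f x y = ev2 x y A"
    using assms unfolding represents_def by blast
  then show ?thesis
    using r(3)[of 0 0] by (simp add: ev2_0[OF r(2,1)] ev1_0[OF conv2_imp_conv1[OF r(2,1)] r(1)])
qed

lemma represents_vanish:
  assumes "represents f A" "near (\<lambda>x y. f x 0 = 0)"
  shows "fps_nth A 0 = 0"
proof -
  obtain r where r: "r > 0" "conv2 r A" "\<And>x y. \<bar>x\<bar> \<le> r \<Longrightarrow> \<bar>y\<bar> \<le> r \<Longrightarrow> f x y = ev2 x y A"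
    using assms unfolding represents_def by blast
  obtain e where e: "e > 0" "\<And>x. \<bar>x\<bar> \<le> e \<Longrightarrow> f x 0 = 0"
    using assms(2) unfolding near_iff by (metis abs_zero less_imp_le)
  show ?thesis
  proof (rule ev1_eq_0[OF conv2_imp_conv1[OF r(2,1)] r(1)])
    show "min e r > 0" using e r by simp
    fix x :: real assume x: "0 < x" "x < min e r"
    then have "ev1 x (fps_nth A 0) = ev2 x 0 A" by (simp add: ev2_0[OF r(2,1)])
    also have "\<dots> = f x 0" using r(3)[of x 0] x by simp
    finally show "ev1 x (fps_nth A 0) = 0" using e(2)[of x] x by simp
  qed
qed

end

lemma monic_dvd_monom:
  fixes p :: "complex poly"
  assumes "p dvd monom 1 n" "lead_coeff p = 1"
  shows "p = monom 1 (degree p)"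
proof -
  have p: "p = (\<Prod>z | poly p z = 0. [:-z, 1:] ^ order z p)"
    using complex_poly_decompose[of p] assms(2) by simp
  obtain q where q: "monom 1 n = p * q" using assms(1) by (auto simp: dvd_def)
  have "z = 0" if "poly p z = 0" for z
  proof -
    have "z ^ n = poly (p * q) z" by (simp flip: q add: poly_monom)
    then show ?thesis using that by simp
  qed
  then have sub: "{z. poly p z = 0} \<subseteq> {0}" by blast
  have "\<exists>k. p = [:0, 1:] ^ k"
  proof (cases "{z. poly p z = 0} = {}")
    case True
    with p have "p = [:0, 1:] ^ 0" by simp
    then show ?thesis by blast
  next
    case False
    with sub have "{z. poly p z = 0} = {0}" by blast
    with p have "p = [:0, 1:] ^ order 0 p" by simp
    then show ?thesis by blast
  qed
  then obtain k where "p = monom 1 k" by (auto simp: monom_altdef)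
  then show ?thesis by (simp add: degree_monom_eq)
qed

lemma poly_monic_poly:
  "poly (monic_poly d a) x = x ^ d + (\<Sum>j=1..d. a j * x ^ (d - j))"
  by (simp add: monic_poly_def poly_monom poly_sum)

lemma finite_coords [simp]: "finite (coords m i)"
  by (simp add: coords_def)

section \<open>Monic germs on planes and the induction over the system\<close>

context complex_embedding begin

interpretation \<iota>: bounded_linear \<iota> by (rule linear)

lemma degree_map_\<iota>: "degree (map_poly \<iota> p) = degree p"
  by (rule degree_map_poly) simp

lemma \<iota>_eq_1_iff: "\<iota> x = 1 \<longleftrightarrow> x = 1"
proof -
  have "\<iota> (x + - 1) = \<iota> x - 1" using hom.h_add[of x "- 1"] hom.h_uminus[of 1] by (simp add: \<iota>_1)
  then show ?thesis using \<iota>_eq_0_iff[of "x + - 1"] by auto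
qed

lemma represents_monic_germ:
  assumes I: "finite I" and Q: "monic_germ I Q"
  obtains R where "represents_poly (\<lambda>x y. map_poly \<iota> (Q (plane (\<lambda>_. 0) sel v x y))) R" "lead_coeff R = 1"
proof -
  obtain \<delta> where \<delta>: "\<forall>\<^sub>F z in coord_nhds I (\<lambda>_. 0). degree (Q z) = \<delta> \<and> lead_coeff (Q z) = 1"
    using Q unfolding monic_germ_def by blast
  have "\<exists>A. represents (\<lambda>x y. \<iota> (coeff (Q (plane (\<lambda>_. 0) sel v x y)) j)) A" for j
    using Q represents_analytic[OF I, of "\<lambda>z. coeff (Q z) j" sel v] unfolding monic_germ_def poly_germ_def by metis
  then obtain A where A: "\<And>j. represents (\<lambda>x y. \<iota> (coeff (Q (plane (\<lambda>_. 0) sel v x y)) j)) (A j)" by metis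
  \<comment> \<open>The leading coefficient is entered as the literal 1, and represented series are
    used only below it; so \<open>R\<close> is exactly monic as a polynomial over power
    series.\<close>
  define R where "R = monom 1 \<delta> + (\<Sum>j<\<delta>. monom (A j) j)"
  have coeff_R: "coeff R j = (if j < \<delta> then A j else if j = \<delta> then 1 else 0)" for j
    by (auto simp: R_def coeff_sum coeff_monom)
  have deg_R: "degree R = \<delta>"
  proof (rule antisym)
    show "degree R \<le> \<delta>" by (rule degree_le) (simp add: coeff_R)
    show "\<delta> \<le> degree R" by (rule le_degree) (simp add: coeff_R)
  qed
  have c01: "convergent2 0" "convergent2 1"
    using conv2_const(1)[of _ 0] conv2_const(1)[of _ 1] by (auto simp: convergent2_def)
  have "convergent2 (coeff R j)" for j
    using A[of j] c01 by (simp add: coeff_R represents_iff)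
  moreover have "near (\<lambda>x y. map_poly \<iota> (Q (plane (\<lambda>_. 0) sel v x y)) = map_poly (ev2 x y) R)"
  proof (rule near_conj_mono[OF near_conj[OF plane_near[OF I \<delta>] near_ball[of "{..<\<delta>}"]]])
    show "near (\<lambda>x y. \<iota> (coeff (Q (plane (\<lambda>_. 0) sel v x y)) j) = ev2 x y (A j))" if "j \<in> {..<\<delta>}" for j
      using A[of j] by (simp add: represents_iff)
    show "near (\<lambda>x y. ev2 (complex_of_real x) (complex_of_real y) 0 = 0 \<and> ev2 (complex_of_real x) (complex_of_real y) 1 = 1)"
      by (rule convergent2_hom(2)[of "{}", where B = 0])
        (use partial_hom.h_0 partial_hom.h_1 conv2_const(1)[of _ 0] in auto)
    fix x y
    let ?q = "Q (plane (\<lambda>_. 0) sel v x y)"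
    assume *: "(degree ?q = \<delta> \<and> lead_coeff ?q = 1) \<and> (\<forall>j\<in>{..<\<delta>}. \<iota> (coeff ?q j) = ev2 x y (A j))"
      and ev: "ev2 (complex_of_real x) (complex_of_real y) 0 = 0 \<and> ev2 (complex_of_real x) (complex_of_real y) 1 = 1"
    show "map_poly \<iota> ?q = map_poly (ev2 x y) R"
    proof (rule poly_eqI)
      fix j
      consider "j < \<delta>" | "j = \<delta>" | "j > \<delta>" by linarith
      then show "coeff (map_poly \<iota> ?q) j = coeff (map_poly (ev2 x y) R) j"
        using * ev by cases (auto simp: coeff_map_poly coeff_R \<iota>_1 coeff_eq_0)
    qed
  qed simp
  ultimately have "represents_poly (\<lambda>x y. map_poly \<iota> (Q (plane (\<lambda>_. 0) sel v x y))) R"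
    by (simp add: represents_poly_def)
  then show ?thesis by (rule that) (simp add: deg_R coeff_R)
qed

abbreviation tx_plane :: "(nat + nat \<Rightarrow> 'k) \<Rightarrow> real \<Rightarrow> real \<Rightarrow> nat + nat \<Rightarrow> 'k" where
  "tx_plane \<equiv> plane (\<lambda>_. 0) isl"

lemma plane_case_sum:
  fixes v :: "nat + nat \<Rightarrow> 'k"
  shows "tx_plane v x y = case_sum (\<lambda>a. of_real x * v (Inl a)) (\<lambda>b. of_real y * v (Inr b))"
  by (auto simp: plane_def fun_eq_iff split: sum.splits)

lemma scaled_near:
  fixes v :: "'i \<Rightarrow> 'k"
  assumes "finite I" "coord_open I W" "(\<lambda>_. 0) \<in> W"
  shows "near (\<lambda>x y. (\<lambda>a. of_real x * v a) \<in> W)" "near (\<lambda>x y. (\<lambda>a. of_real y * v a) \<in> W)"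
proof -
  have ev: "\<forall>\<^sub>F z in coord_nhds I (\<lambda>_. 0). z \<in> W" using assms(2,3) by (simp add: coord_open_def)
  show "near (\<lambda>x y. (\<lambda>a. of_real x * v a) \<in> W)"
    using plane_near[OF assms(1) ev, of "\<lambda>_. True" v] by (simp add: plane_def)
  show "near (\<lambda>x y. (\<lambda>a. of_real y * v a) \<in> W)"
    using plane_near[OF assms(1) ev, of "\<lambda>_. False" v] by (simp add: plane_def)
qed

text \<open>The Taylor series sees the coordinates in \<open>I\<close> only. This allows
  \<open>A i j\<close> to be compared on planes that differ in the direction of
  \<open>x_i\<close>.\<close>

lemma analytic_depends_on_coords:
  fixes f :: "('i \<Rightarrow> 'k) \<Rightarrow> 'k"
  assumes "K_analytic_at I f (\<lambda>_. 0)"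
  shows "\<forall>\<^sub>F z in coord_nhds I (\<lambda>_. 0). \<forall>z'. (\<forall>j\<in>I. z' j = z j) \<longrightarrow> f z' = f z"
proof -
  obtain c r where r: "r > 0" "\<And>z. z \<in> polydisc I (\<lambda>_. 0) r \<Longrightarrow>
        ((\<lambda>\<alpha>. c \<alpha> * (\<Prod>j\<in>I. (z j - 0) ^ \<alpha> j)) has_sum f z) (multi_indices I)"
    using assms unfolding K_analytic_at_def has_taylor_def eventually_coord_nhds by blast
  show ?thesis unfolding eventually_coord_nhds
  proof (intro exI[of _ r] conjI ballI allI impI r(1))
    fix z z' :: "'i \<Rightarrow> 'k" assume z: "z \<in> polydisc I (\<lambda>_. 0) r" and eq: "\<forall>j\<in>I. z' j = z j"
    then have "z' \<in> polydisc I (\<lambda>_. 0) r" by (simp add: polydisc_def)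
    from r(2)[OF this] have "((\<lambda>\<alpha>. c \<alpha> * (\<Prod>j\<in>I. (z j - 0) ^ \<alpha> j)) has_sum f z') (multi_indices I)"
      using eq by (simp cong: prod.cong)
    then show "f z' = f z" using r(2)[OF z] has_sum_unique by blast
  qed
qed

lemma near_swap_0: "near P \<Longrightarrow> near (\<lambda>x y. P x 0)"
  unfolding near_iff by fastforce

text \<open>Over the plane for \<open>F (i - 1)\<close>, setting \<open>x_i = c s\<close> amounts to
  a plane with a new entry in its direction. The result on generic lines applies to the reduced
  form, whose discriminant divides \<open>F (i - 1)\<close>; the multiplicities are restored through
  the irreducible factors.\<close>

lemma induction_step:
  fixes v :: "nat + nat \<Rightarrow> 'k"
  assumes sys: "pseudopoly_system m n U V d A F" and i: "1 \<le> i" "i \<le> n"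
    and rep: "represents (\<lambda>x y. \<iota> (F (i - 1) (tx_plane v x y))) \<Phi>" and unit: "monomial_unit \<Phi>"
  shows "\<exists>E. finite E \<and> (\<forall>c. \<iota> c \<notin> E \<longrightarrow> (\<exists>\<Psi>. monomial_unit \<Psi> \<and>
     represents (\<lambda>x y. \<iota> (F i (tx_plane (v(Inr i := c)) x y))) \<Psi>))"
proof -
  let ?I = "coords m (i - 1)"
  let ?z = "\<lambda>x y. tx_plane v x y"
  let ?P = "\<lambda>z. monic_poly (d i) (\<lambda>j. A i j z)"
  have iI: "i \<in> {1..n}" using i by simp
  have U: "coord_open {1..m} U" "(\<lambda>_. 0) \<in> U"
    and "\<forall>i\<le>n. coord_open {1..i} (V i) \<and> (\<lambda>_. 0) \<in> V i"
    using sys unfolding pseudopoly_system_def by simp_all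
  then have V: "coord_open {1..i} (V i)" "(\<lambda>_. 0) \<in> V i" using i by blast+
  have coeffs: "\<forall>i\<in>{1..n}. \<forall>j\<in>{1..d i}.
      (\<forall>t\<in>U. \<forall>x\<in>V i. K_analytic_at (coords m (i - 1)) (A i j) (case_sum t x)) \<and>
      (\<forall>t\<in>U. A i j (case_sum t (\<lambda>_. 0)) = 0)"
    and monic_eq: "\<forall>i\<in>{1..n}. \<forall>t\<in>U. \<forall>x\<in>V i.
      F i (case_sum t x) = x i ^ d i + (\<Sum>j=1..d i. A i j (case_sum t x) * x i ^ (d i - j))"
    and reduced: "\<forall>i\<in>{1..n}. \<exists>R.
      reduced_form (coords m (i - 1)) (\<lambda>z. monic_poly (d i) (\<lambda>j. A i j z)) R \<and>
      germ_dvd (coords m (i - 1)) (\<lambda>z. discriminant (R z)) (F (i - 1))"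
    using sys unfolding pseudopoly_system_def by simp_all
  have A_an: "K_analytic_at ?I (A i j) (\<lambda>_. 0)" if "j \<in> {1..d i}" for j
  proof -
    have "K_analytic_at ?I (A i j) (case_sum (\<lambda>_. 0) (\<lambda>_. 0))"
      using coeffs iI that U(2) V(2) by blast
    moreover have "case_sum (\<lambda>_. 0) (\<lambda>_. 0) = (\<lambda>_. 0 :: 'k)" by (auto simp: fun_eq_iff split: sum.splits)
    ultimately show ?thesis by simp
  qed
  have A_0: "A i j (case_sum t (\<lambda>_. 0)) = 0" if "j \<in> {1..d i}" "t \<in> U" for j t
    using coeffs iI that by blast
  have F_eq: "F i (case_sum t x) = x i ^ d i + (\<Sum>j=1..d i. A i j (case_sum t x) * x i ^ (d i - j))"
    if "t \<in> U" "x \<in> V i" for t x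
    using monic_eq iI that by blast
  obtain R where red: "reduced_form ?I ?P R" and dv: "germ_dvd ?I (\<lambda>z. discriminant (R z)) (F (i - 1))"
    using reduced iI by blast
  obtain N Q and e :: "nat \<Rightarrow> nat" where P: "poly_germ_eq ?I ?P (\<lambda>z. \<Prod>k<N::nat. Q k z ^ e k)"
    and RQ: "poly_germ_eq ?I R (\<lambda>z. \<Prod>k<N. Q k z)"
    and Q': "\<forall>k<N. monic_germ ?I (Q k) \<and> irreducible_germ ?I (Q k) \<and> e k \<ge> 1"
    using red unfolding reduced_form_def by (elim exE conjE) (rule that)
  have Q: "monic_germ ?I (Q k) \<and> e k \<ge> 1" if "k < N" for k using Q' that by blast
  have "\<exists>q. represents_poly (\<lambda>x y. map_poly \<iota> (Q k (?z x y))) q \<and> lead_coeff q = 1" if "k < N" for k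
    using represents_monic_germ[of ?I "Q k" isl v] Q[OF that] by (metis finite_coords)
  then obtain q where q: "\<And>k. k < N \<Longrightarrow> represents_poly (\<lambda>x y. map_poly \<iota> (Q k (?z x y))) (q k)"
    "\<And>k. k < N \<Longrightarrow> lead_coeff (q k) = 1" by metis
  define r where "r = (\<Prod>k<N. q k)"
  define f where "f = (\<Prod>k<N. q k ^ e k)"
  have UNIV: "p \<in> hom.Cpoly" for p by (simp add: hom.Cpoly_def)
  have rep_r: "represents_poly (\<lambda>x y. map_poly \<iota> (R (?z x y))) r"
  proof (rule represents_poly_cong)
    show "represents_poly (\<lambda>x y. \<Prod>k\<in>{..<N}. map_poly \<iota> (Q k (?z x y))) r"
      unfolding r_def by (rule represents_poly_prod) (use q in auto)
    show "near (\<lambda>x y. map_poly \<iota> (R (?z x y)) = (\<Prod>k\<in>{..<N}. map_poly \<iota> (Q k (?z x y))))"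
      using plane_near[OF finite_coords RQ[unfolded poly_germ_eq_def], of isl v]
      by (rule near_mono) (simp add: hom.Cpoly_prod UNIV)
  qed
  have rep_f: "represents_poly (\<lambda>x y. map_poly \<iota> (?P (?z x y))) f"
  proof (rule represents_poly_cong)
    show "represents_poly (\<lambda>x y. \<Prod>k\<in>{..<N}. map_poly \<iota> (Q k (?z x y)) ^ e k) f"
      unfolding f_def by (rule represents_poly_prod, rule represents_poly_power) (use q in auto)
    show "near (\<lambda>x y. map_poly \<iota> (?P (?z x y)) = (\<Prod>k\<in>{..<N}. map_poly \<iota> (Q k (?z x y)) ^ e k))"
      using plane_near[OF finite_coords P[unfolded poly_germ_eq_def], of isl v]
      by (rule near_mono) (simp add: hom.Cpoly_prod hom.Cpoly_power UNIV)
  qed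
  have monic_r: "lead_coeff r = 1" unfolding r_def using q(2) by (simp add: lead_coeff_prod)
  note disc = represents_poly_discriminant[OF rep_r monic_r]

  \<comment> \<open>For \<open>s = 0\<close> the coefficients \<open>A i l\<close> vanish and the
    pseudopolynomial is a power of \<open>X\<close>; its monic divisor \<open>R\<close> is then a
    power of \<open>X\<close> as well.\<close>
  have vanish: "fps_nth (coeff r j) 0 = 0" if j: "j < degree r" for j
  proof (rule represents_vanish)
    show "represents (\<lambda>x y. coeff (map_poly \<iota> (R (?z x y))) j) (coeff r j)"
      unfolding represents_iff
    proof
      show "convergent2 (coeff r j)" using rep_r by (simp add: represents_poly_def)
      have "near (\<lambda>x y. map_poly \<iota> (R (?z x y)) = map_poly (ev2 x y) r)" using rep_r by (simp add: represents_poly_def)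
      then show "near (\<lambda>x y. coeff (map_poly \<iota> (R (?z x y))) j = ev2 x y (coeff r j))"
        by (rule near_mono) (simp add: coeff_map_poly ev2_def term2_def case_prod_unfold)
    qed
    have "near (\<lambda>x y. ?P (?z x y) = (\<Prod>k<N. Q k (?z x y) ^ e k) \<and> R (?z x y) = (\<Prod>k<N. Q k (?z x y)))"
      using near_conj[OF plane_near[OF finite_coords P[unfolded poly_germ_eq_def], of isl v]
          plane_near[OF finite_coords RQ[unfolded poly_germ_eq_def], of isl v]] .
    note n1 = near_swap_0[OF this] and n2 = near_swap_0[OF disc(1)]
    have n3: "near (\<lambda>x y. (\<lambda>a. of_real x * v (Inl a)) \<in> U)"
      by (rule scaled_near(1)[OF _ U]) simp
    show "near (\<lambda>x y. coeff (map_poly \<iota> (R (?z x 0))) j = 0)"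
    proof (rule near_conj_mono[OF near_conj[OF n1 n2] n3])
      fix x y :: real
      assume *: "(?P (?z x 0) = (\<Prod>k<N. Q k (?z x 0) ^ e k) \<and> R (?z x 0) = (\<Prod>k<N. Q k (?z x 0))) \<and>
          degree (map_poly \<iota> (R (?z x 0))) = degree r \<and> lead_coeff (map_poly \<iota> (R (?z x 0))) = 1"
        and t: "(\<lambda>a. of_real x * v (Inl a)) \<in> U"
      have "A i l (?z x 0) = 0" if "l \<in> {1..d i}" for l
        using A_0[OF that t] by (simp add: plane_case_sum)
      then have "?P (?z x 0) = monom 1 (d i)" by (simp add: monic_poly_def)
      moreover have "R (?z x 0) dvd ?P (?z x 0)"
      proof -
        have "(\<Prod>k<N. Q k (?z x 0)) dvd (\<Prod>k<N. Q k (?z x 0) ^ e k)"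
          by (rule prod_dvd_prod) (use Q in \<open>force intro: dvd_power\<close>)
        then show ?thesis using * by simp
      qed
      ultimately obtain s where "monom 1 (d i) = R (?z x 0) * s" by (auto simp: dvd_def)
      then have "map_poly \<iota> (monom 1 (d i)) = map_poly \<iota> (R (?z x 0)) * map_poly \<iota> s"
        using hom.Cpoly_mult(2)[OF UNIV UNIV] by simp
      moreover have "map_poly \<iota> (monom 1 (d i)) = monom 1 (d i)"
        by (simp add: poly_eq_iff coeff_map_poly coeff_monom \<iota>_1)
      ultimately have "map_poly \<iota> (R (?z x 0)) dvd monom 1 (d i)" by (simp add: dvd_def)
      moreover have "lead_coeff (map_poly \<iota> (R (?z x 0))) = 1" and dr: "degree (map_poly \<iota> (R (?z x 0))) = degree r"
        using * by blast+
      ultimately have "map_poly \<iota> (R (?z x 0)) = monom 1 (degree r)" using monic_dvd_monom by metis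
      then show "coeff (map_poly \<iota> (R (?z x 0))) j = 0" using j by simp
    qed
  qed

  \<comment> \<open>Since \<open>R\<close> is monic, its discriminant is the resultant up to sign.
    As a factor of the series of \<open>F (i - 1)\<close>, it is a monomial unit.\<close>
  have unit_disc: "monomial_unit (resultant r (pderiv r))"
  proof -
    obtain h where h: "K_analytic_at ?I h (\<lambda>_. 0)"
      and Fh: "\<forall>\<^sub>F z in coord_nhds ?I (\<lambda>_. 0). F (i - 1) z = discriminant (R z) * h z"
      using dv unfolding germ_dvd_def by blast
    obtain H where H: "represents (\<lambda>x y. \<iota> (h (?z x y))) H"
      using represents_analytic[OF finite_coords h] by metis
    define \<kappa> where "\<kappa> = degree r * (degree r - 1) div 2"
    have "represents (\<lambda>x y. \<iota> (F (i - 1) (?z x y))) (fps_const (fps_const ((- 1) ^ \<kappa>)) * resultant r (pderiv r) * H)"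
    proof (rule represents_cong[OF represents_mult[OF represents_mult[OF represents_const disc(2)] H]])
      show "near (\<lambda>x y. \<iota> (F (i - 1) (?z x y)) =
         (- 1) ^ \<kappa> * resultant (map_poly \<iota> (R (?z x y))) (pderiv (map_poly \<iota> (R (?z x y)))) * \<iota> (h (?z x y)))"
      proof (rule near_conj_mono[OF plane_near[OF finite_coords Fh] disc(1)])
        fix x y
        let ?R = "R (?z x y)"
        assume F: "F (i - 1) (?z x y) = discriminant ?R * h (?z x y)"
          and deg: "degree (map_poly \<iota> ?R) = degree r \<and> lead_coeff (map_poly \<iota> ?R) = 1"
        have dg: "degree ?R = degree r" using deg degree_map_\<iota> by simp
        have lc: "lead_coeff ?R = 1" using deg by (auto simp: degree_map_\<iota> coeff_map_poly \<iota>_eq_1_iff)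
        have "\<iota> (resultant ?R (pderiv ?R)) = resultant (map_poly \<iota> ?R) (pderiv (map_poly \<iota> ?R))"
          using hom.hom_resultant[OF UNIV UNIV degree_map_\<iota> degree_map_\<iota>] hom.Cpoly_pderiv(2)[OF UNIV] by metis
        moreover have "\<iota> ((- 1) ^ \<kappa>) = (- 1) ^ \<kappa>"
          using hom.h_uminus[of 1] by (simp add: \<iota>_power \<iota>_1)
        moreover have "discriminant ?R = (- 1) ^ \<kappa> * resultant ?R (pderiv ?R)"
          using lc dg by (simp add: discriminant_def \<kappa>_def)
        ultimately show "\<iota> (F (i - 1) (?z x y)) =
         (- 1) ^ \<kappa> * resultant (map_poly \<iota> ?R) (pderiv (map_poly \<iota> ?R)) * \<iota> (h (?z x y))"
          unfolding F by (simp add: \<iota>_mult)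
      qed
    qed
    then have "\<Phi> = fps_const (fps_const ((- 1) ^ \<kappa>)) * resultant r (pderiv r) * H" using rep represents_eqI by blast
    then show ?thesis using unit by (simp add: monomial_unit_mult)
  qed

  obtain s where s: "s > 0" "\<And>j. conv2 s (coeff r j)"
  proof -
    obtain S where S: "finite S" "\<forall>a\<in>S. convergent2 a"
      "\<And>s x y. S \<subseteq> {A. conv2 s A} \<Longrightarrow> partial_hom {A. conv2 s A} (ev2 (complex_of_real x) (complex_of_real y)) \<Longrightarrow>
       r \<in> partial_hom.Cpoly {A. conv2 s A}"
      using represents_poly_common[OF rep_r] by blast
    have "\<forall>\<^sub>F s in at_right 0. \<forall>A\<in>S. conv2 s A"
      using S(1,2) by (simp add: eventually_ball_finite_distrib convergent2_def)
    then have "\<forall>\<^sub>F s in at_right 0. s > 0 \<and> (\<forall>A\<in>S. conv2 s A)"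
      using eventually_at_right_less[of "0::real"] by eventually_elim auto
    then obtain s where s: "s > 0" "\<forall>A\<in>S. conv2 s A"
      by (metis (mono_tags, lifting) eventually_happens' trivial_limit_at_right_real)
    have hs: "partial_hom {A. conv2 s A} (ev2 (complex_of_real 0) (complex_of_real 0))"
      by (rule partial_hom_ev2) (use s in auto)
    have "r \<in> partial_hom.Cpoly {A. conv2 s A}" by (rule S(3)[OF _ hs]) (use s in auto)
    then show ?thesis using that[OF s(1)] by (simp add: partial_hom.Cpoly_def[OF hs])
  qed
  define E where "E = {c. \<not> monomial_unit (poly r (fps_const (fps_const c) * fps_X))}"
  have "finite E" unfolding E_def
    by (rule generic_line_monomial_unit[OF s monic_r vanish unit_disc])
  moreover have "\<exists>\<Psi>. monomial_unit \<Psi> \<and> represents (\<lambda>x y. \<iota> (F i (tx_plane (v(Inr i := c)) x y))) \<Psi>"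
    if c: "\<iota> c \<notin> E" for c
  proof (intro exI conjI)
    let ?X = "fps_const (fps_const (\<iota> c)) * fps_X"
    let ?w = "tx_plane (v(Inr i := c))"
    \<comment> \<open>From the reduced form down to each factor, then up again with the exponents
      \<open>e k\<close>.\<close>
    have "monomial_unit (\<Prod>k<N. poly (q k) ?X)"
      using c by (simp add: E_def r_def poly_prod)
    then have "monomial_unit (poly (q k) ?X)" if "k < N" for k
      using that by (simp add: monomial_unit_prod)
    then show "monomial_unit (poly f ?X)"
      unfolding f_def by (simp add: poly_prod poly_power monomial_unit_prod monomial_unit_power)
    have X: "represents (\<lambda>x y. \<iota> c * of_real y) ?X"
      by (rule represents_mult[OF represents_const represents_snd])
    show "represents (\<lambda>x y. \<iota> (F i (?w x y))) (poly f ?X)"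
    proof (rule represents_cong[OF represents_poly_eval[OF rep_f X]])
      \<comment> \<open>The old and the new plane differ only in the coordinate
        \<open>Inr i\<close>, which is not among those seen by \<open>A i j\<close>.\<close>
      have n1: "near (\<lambda>x y. \<forall>j\<in>{1..d i}. \<forall>z'. (\<forall>l\<in>?I. z' l = ?z x y l) \<longrightarrow> A i j z' = A i j (?z x y))"
        by (rule near_ball) (use plane_near[OF finite_coords analytic_depends_on_coords[OF A_an]] in auto)
      have n2: "near (\<lambda>x y. (\<lambda>a. of_real x * v (Inl a)) \<in> U)"
        by (rule scaled_near(1)[OF _ U]) simp
      have n3: "near (\<lambda>x y. (\<lambda>b. of_real y * (v(Inr i := c)) (Inr b)) \<in> V i)"
        by (rule scaled_near(2)[OF _ V]) simp
      show "near (\<lambda>x y. \<iota> (F i (?w x y)) = poly (map_poly \<iota> (?P (?z x y))) (\<iota> c * of_real y))"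
      proof (rule near_conj_mono[OF n1 near_conj[OF n2 n3]])
        fix x y
        assume dep: "\<forall>j\<in>{1..d i}. \<forall>z'. (\<forall>l\<in>?I. z' l = ?z x y l) \<longrightarrow> A i j z' = A i j (?z x y)"
          and UV: "(\<lambda>a. of_real x * v (Inl a)) \<in> U \<and> (\<lambda>b. of_real y * (v(Inr i := c)) (Inr b)) \<in> V i"
        have w: "?w x y = case_sum (\<lambda>a. of_real x * v (Inl a)) (\<lambda>b. of_real y * (v(Inr i := c)) (Inr b))"
          by (simp add: plane_case_sum)
        have "\<forall>l\<in>?I. ?w x y l = ?z x y l"
          using i by (auto simp: coords_def plane_def)
        then have "A i j (?w x y) = A i j (?z x y)" if "j \<in> {1..d i}" for j using dep that by blast
        then have "F i (?w x y) = poly (?P (?z x y)) (of_real y * c)"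
          using F_eq[OF conjunct1[OF UV] conjunct2[OF UV]] unfolding w[symmetric]
          by (simp add: poly_monic_poly)
        then show "\<iota> (F i (?w x y)) = poly (map_poly \<iota> (?P (?z x y))) (\<iota> c * of_real y)"
          using hom.hom_poly[OF UNIV, of "of_real y * c"] by (simp add: \<iota>_mult mult.commute)
      qed
    qed
  qed
  ultimately show ?thesis by blast
qed


text \<open>\<open>g\<close> carries a side condition on the direction. Being polynomial in each
  single coordinate, it excludes only finitely many values of the coordinate adjusted at each step.
  It will be instantiated by bihomogeneous parts of the Taylor series of \<open>G\<close>.\<close>

lemma generic_plane_monomial_unit:
  assumes sys: "zariski_equisingular m n U V d A F" and "i \<le> n"
    and slice: "\<And>v b. \<exists>p. \<forall>y. g (v(b := y)) = poly p y" and g: "g v0 \<noteq> (0 :: 'k)"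
  shows "\<exists>v \<Phi>. g v \<noteq> 0 \<and> monomial_unit \<Phi> \<and> represents (\<lambda>x y. \<iota> (F i (tx_plane v x y))) \<Phi>"
  using \<open>i \<le> n\<close>
proof (induction i)
  case 0
  have sys': "pseudopoly_system m n U V d A F" "F 0 (\<lambda>_. 0) \<noteq> 0"
    using sys by (auto simp: zariski_equisingular_def)
  have an: "\<forall>i\<le>n. \<forall>t\<in>U. \<forall>x\<in>V i. K_analytic_at (coords m i) (F i) (case_sum t x)"
    and U: "(\<lambda>_. 0) \<in> U" and V: "\<forall>i\<le>n. coord_open {1..i} (V i) \<and> (\<lambda>_. 0) \<in> V i"
    using sys'(1) unfolding pseudopoly_system_def by simp_all
  have "K_analytic_at (coords m 0) (F 0) (case_sum (\<lambda>_. 0) (\<lambda>_. 0))"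
    using an U V by blast
  moreover have "case_sum (\<lambda>_. 0) (\<lambda>_. 0) = (\<lambda>_. 0 :: 'k)" by (auto simp: fun_eq_iff split: sum.splits)
  ultimately have "K_analytic_at (coords m 0) (F 0) (\<lambda>_. 0)" by simp
  then obtain \<Phi> where \<Phi>: "represents (\<lambda>x y. \<iota> (F 0 (tx_plane v0 x y))) \<Phi>"
    using represents_analytic[OF finite_coords] by metis
  have "tx_plane v0 0 0 = (\<lambda>_. 0)" by (simp add: plane_def)
  then have "fps_nth (fps_nth \<Phi> 0) 0 \<noteq> 0" using represents_0_0[OF \<Phi>] sys'(2) \<iota>_eq_0_iff by metis
  then have "monomial_unit \<Phi>" by (rule monomial_unitI) simp
  then show ?case using \<Phi> g by blast
next
  case (Suc i)
  then obtain v \<Phi> where v: "g v \<noteq> 0" "monomial_unit \<Phi>"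
    "represents (\<lambda>x y. \<iota> (F i (tx_plane v x y))) \<Phi>" by auto
  have sys': "pseudopoly_system m n U V d A F" using sys by (simp add: zariski_equisingular_def)
  have rep: "represents (\<lambda>x y. \<iota> (F (Suc i - 1) (tx_plane v x y))) \<Phi>" using v(3) by simp
  obtain E where E: "finite E" "\<And>c. \<iota> c \<notin> E \<Longrightarrow> \<exists>\<Psi>. monomial_unit \<Psi> \<and>
     represents (\<lambda>x y. \<iota> (F (Suc i) (tx_plane (v(Inr (Suc i) := c)) x y))) \<Psi>"
    using induction_step[OF sys' _ Suc.prems rep v(2)] by auto
  obtain p where p: "\<And>y. g (v(Inr (Suc i) := y)) = poly p y" using slice by metis
  have "poly p (v (Inr (Suc i))) \<noteq> 0" using p[of "v (Inr (Suc i))"] v(1) by simp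
  then have "p \<noteq> 0" by auto
  then have "finite {y. poly p y = 0}" by (rule poly_roots_finite)
  moreover have "finite (\<iota> -` E)"
    by (rule finite_vimageI[OF E(1)]) (rule injI, metis \<iota>.diff \<iota>_eq_0_iff eq_iff_diff_eq_0)
  ultimately have "finite ({y. poly p y = 0} \<union> \<iota> -` E)" by simp
  then obtain c where "c \<notin> {y. poly p y = 0} \<union> \<iota> -` E"
    using infinite_UNIV_char_0[where ?'a = 'k] by (metis ex_new_if_finite)
  then have "g (v(Inr (Suc i) := c)) \<noteq> 0" "\<iota> c \<notin> E" using p by auto
  then show ?case using E(2) by blast
qed

section \<open>Multiplicities of a divisor\<close>

lemma coords_isl_split:
  shows "{j \<in> coords m n. isl j} = Inl ` {1..m}" "{j \<in> coords m n. \<not> isl j} = Inr ` {1..n}"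
  by (auto simp: coords_def)

lemma multiplicity_constant:
  fixes G :: "(nat + nat \<Rightarrow> 'k) \<Rightarrow> 'k"
  assumes sys: "zariski_equisingular m n U V d A F"
    and G: "K_analytic_at (coords m n) G (\<lambda>_. 0)" and dv: "germ_dvd (coords m n) G (F n)"
  shows "\<forall>\<^sub>F t in coord_nhds {1..m} (\<lambda>_. 0).
      vanishing_order (coords m n) G (case_sum t (\<lambda>_. 0)) = vanishing_order {1..n} (\<lambda>x. G (case_sum t x)) (\<lambda>_. 0) \<and>
      vanishing_order (coords m n) G (case_sum t (\<lambda>_. 0)) = vanishing_order (coords m n) G (\<lambda>_. 0)"
proof -
  let ?I = "coords m n"
  let ?M = "multi_indices ?I"
  let ?Il = "{j \<in> ?I. isl j}" and ?Ir = "{j \<in> ?I. \<not> isl j}"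
  obtain c \<rho> where c: "taylor_on ?I G (\<lambda>_. 0) c \<rho>"
    using G has_taylor_imp_taylor_on unfolding K_analytic_at_def by metis
  have \<rho>: "\<rho> > 0" using c by (simp add: taylor_on_def)
  \<comment> \<open>The part of the Taylor series of degree \<open>k\<close> in \<open>t\<close> and
    degree \<open>l\<close> in \<open>x\<close>.\<close>
  define g where "g k l v = (\<Sum>\<alpha> | \<alpha> \<in> ?M \<and> (\<Sum>j\<in>?Ir. \<alpha> j) = l \<and> (\<Sum>j\<in>?Il. \<alpha> j) = k. c \<alpha> * monomial ?I \<alpha> v)" for k l v
  have fin: "finite {\<alpha>. \<alpha> \<in> ?M \<and> (\<Sum>j\<in>?Ir. \<alpha> j) = l \<and> (\<Sum>j\<in>?Il. \<alpha> j) = k}" for k l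
    by (rule finite_subset[OF _ finite_multi_indices_sum[OF finite_coords, of m n "k + l"]])
      (auto simp: sum_split_sel[OF finite_coords, of _ m n isl])
  have nth: "fps_nth (fps_nth (plane_series ?I c isl v) l) k = \<iota> (g k l v)" for k l v
    by (simp add: plane_series_def g_def)
  have slice: "\<exists>p. \<forall>y. g k l (v(b := y)) = poly p y" for k l v b
  proof (rule multi_polynomial_slice[OF finite_coords])
    fix p
    assume "\<And>y. (\<Sum>\<alpha> | \<alpha> \<in> ?M \<and> (\<Sum>j\<in>?Ir. \<alpha> j) = l \<and> (\<Sum>j\<in>?Il. \<alpha> j) = k. c \<alpha> * monomial ?I \<alpha> (v(b := y))) = poly p y"
    then show ?thesis unfolding g_def by blast
  qed
  obtain h where h: "K_analytic_at ?I h (\<lambda>_. 0)" "\<forall>\<^sub>F z in coord_nhds ?I (\<lambda>_. 0). F n z = G z * h z"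
    using dv unfolding germ_dvd_def by blast
  have unit: "monomial_unit (plane_series ?I c isl v)"
    if rep: "represents (\<lambda>x y. \<iota> (F n (tx_plane v x y))) \<Phi>" and \<Phi>: "monomial_unit \<Phi>" for v \<Phi>
  proof -
    obtain H where H: "represents (\<lambda>x y. \<iota> (h (tx_plane v x y))) H"
      using represents_analytic[OF finite_coords h(1)] by metis
    have "represents (\<lambda>x y. \<iota> (F n (tx_plane v x y))) (plane_series ?I c isl v * H)"
      by (rule represents_cong[OF represents_mult[OF taylor_plane[OF finite_coords c] H]])
        (rule near_mono[OF plane_near[OF finite_coords h(2), of isl v]], simp add: \<iota>_mult)
    then have "\<Phi> = plane_series ?I c isl v * H" using rep represents_eqI by blast
    then show ?thesis using \<Phi> by (simp add: monomial_unit_mult)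
  qed
  have generic: "\<exists>v. g k l v \<noteq> 0 \<and> monomial_unit (plane_series ?I c isl v)" if "g k l v0 \<noteq> 0" for k l v0
    using generic_plane_monomial_unit[OF sys order_refl slice that] unit by blast
  txt \<open>
    A plane series that is a monomial unit has a term in the second parameter alone which has the
    least possible degree; so the \<open>x\<close>-degrees of \<open>G\<close> are bounded below by that of \<open>G\<close> at \<open>t = 0\<close>.
  \<close>
  define S where "S = {l. \<exists>v. g 0 l v \<noteq> 0}"
  \<comment> \<open>The side condition 1 yields some generic plane; the unit in its leading
    coefficient is a term without \<open>t\<close>.\<close>
  have "S \<noteq> {}"
  proof -
    obtain v where "monomial_unit (plane_series ?I c isl v)"
      using generic_plane_monomial_unit[OF sys order_refl, of "\<lambda>_. 1" "\<lambda>_. 0"] unit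
      by (metis poly_1 zero_neq_one)
    then have "g 0 (subdegree (plane_series ?I c isl v)) v \<noteq> 0"
      by (simp add: monomial_unit_def nth)
    then show ?thesis by (auto simp: S_def)
  qed
  define \<mu> where "\<mu> = (LEAST l. l \<in> S)"
  have \<mu>: "\<mu> \<in> S" "\<And>l. l \<in> S \<Longrightarrow> \<mu> \<le> l"
    using \<open>S \<noteq> {}\<close> unfolding \<mu>_def by (auto intro: LeastI Least_le)
  \<comment> \<open>A nonzero coefficient of \<open>x\<close>-degree below \<open>\<mu>\<close>
    would be visible on some generic plane, although the series there starts only in degree
    \<open>\<mu>\<close> or later.\<close>
  have low: "c \<alpha> = 0" if \<alpha>: "\<alpha> \<in> ?M" "(\<Sum>j\<in>?Ir. \<alpha> j) < \<mu>" for \<alpha>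
  proof (rule ccontr)
    assume "c \<alpha> \<noteq> 0"
    define k l where "k = (\<Sum>j\<in>?Il. \<alpha> j)" and "l = (\<Sum>j\<in>?Ir. \<alpha> j)"
    have "\<exists>v. g k l v \<noteq> 0"
      unfolding g_def by (rule multi_polynomial_nonzero[OF finite_coords fin]) (use \<alpha> \<open>c \<alpha> \<noteq> 0\<close> in \<open>auto simp: k_def l_def\<close>)
    then obtain v where v: "g k l v \<noteq> 0" "monomial_unit (plane_series ?I c isl v)" using generic by blast
    define s where "s = subdegree (plane_series ?I c isl v)"
    have "g 0 s v \<noteq> 0" using v(2) by (simp add: monomial_unit_def nth s_def)
    then have "\<mu> \<le> s" by (intro \<mu>(2)) (auto simp: S_def)
    then have "l < s" using \<alpha>(2) by (simp add: l_def)
    then have "fps_nth (plane_series ?I c isl v) l = 0" by (simp add: s_def nth_less_subdegree_zero)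
    then show False using nth[of v l k] v(1) by simp
  qed
  obtain \<alpha>0 where \<alpha>0: "\<alpha>0 \<in> ?M" "(\<Sum>j\<in>?Ir. \<alpha>0 j) = \<mu>" "(\<Sum>j\<in>?Il. \<alpha>0 j) = 0" "c \<alpha>0 \<noteq> 0"
  proof -
    obtain v where "g 0 \<mu> v \<noteq> 0" using \<mu>(1) by (auto simp: S_def)
    then obtain \<alpha> where "\<alpha> \<in> ?M" "(\<Sum>j\<in>?Ir. \<alpha> j) = \<mu>" "(\<Sum>j\<in>?Il. \<alpha> j) = 0" "c \<alpha> * monomial ?I \<alpha> v \<noteq> 0"
      unfolding g_def by (rule sum.not_neutral_contains_not_neutral) blast
    then show ?thesis by (intro that) auto
  qed
  \<comment> \<open>For the upper bound it is enough that this one coefficient stays nonzero near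
    \<open>t = 0\<close>; the lower bound will hold exactly for each small \<open>t\<close>.\<close>
  obtain e where e: "e > 0" "\<And>p. (\<And>j. j \<in> ?I \<Longrightarrow> norm (p j) \<le> e) \<Longrightarrow> recentered ?I c p \<alpha>0 \<noteq> 0"
    using recentered_near[OF finite_coords c \<alpha>0(1,4)] by metis
  define \<epsilon> where "\<epsilon> = min e (\<rho> / 2)"
  have \<epsilon>: "\<epsilon> > 0" "\<epsilon> \<le> e" "\<epsilon> \<le> \<rho> / 2" using e \<rho> by (auto simp: \<epsilon>_def)
  have main: "vanishing_order ?I G (case_sum t (\<lambda>_. 0)) = enat \<mu> \<and>
      vanishing_order {1..n} (\<lambda>x. G (case_sum t x)) (\<lambda>_. 0) = enat \<mu>"
    if t: "t \<in> polydisc {1..m} (\<lambda>_. 0) \<epsilon>" for t :: "nat \<Rightarrow> 'k"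
  proof -
    define p :: "nat + nat \<Rightarrow> 'k" where "p = case_sum t (\<lambda>_. 0)"
    have p_small: "norm (p j) \<le> \<epsilon>" if "j \<in> ?I" for j
      using that t \<epsilon>(1) by (auto simp: p_def coords_def polydisc_def less_imp_le)
    have pe: "\<And>j. j \<in> ?I \<Longrightarrow> norm (p j) \<le> e" and p\<rho>: "\<And>j. j \<in> ?I \<Longrightarrow> norm (p j) \<le> \<rho> / 2"
      using p_small \<epsilon> order.trans by blast+
    define c' where "c' = recentered ?I c p"
    have T: "has_taylor ?I G p c'" unfolding c'_def by (rule recenter[OF finite_coords c p\<rho>])
    \<comment> \<open>The centre \<open>(t, 0)\<close> has no \<open>x\<close>-part, so only
      \<open>\<gamma>\<close> supported on the \<open>t\<close>-coordinates contribute. They leave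
      the \<open>x\<close>-degree unchanged, and \<open>low\<close> annihilates each
      contribution.\<close>
    have low': "\<mu> \<le> (\<Sum>j\<in>?Ir. \<beta> j)" if \<beta>: "\<beta> \<in> ?M" "c' \<beta> \<noteq> 0" for \<beta>
    proof (rule ccontr)
      assume less: "\<not> ?thesis"
      have "recenter_term ?I c p \<beta> \<gamma> = 0" if \<gamma>: "\<gamma> \<in> ?M" for \<gamma>
      proof (cases "\<exists>j\<in>?Ir. \<gamma> j \<noteq> 0")
        case True
        then obtain j where j: "j \<in> ?Ir" "\<gamma> j \<noteq> 0" by blast
        then have "p j = 0" by (cases j) (auto simp: p_def)
        then have "p j ^ \<gamma> j = 0" using j by simp
        then have "monomial ?I \<gamma> p = 0" unfolding monomial_def using j by (intro prod_zero) auto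
        then show ?thesis by (simp add: recenter_term_def)
      next
        case False
        then have "(\<Sum>j\<in>?Ir. \<beta> j + \<gamma> j) = (\<Sum>j\<in>?Ir. \<beta> j)" by (intro sum.cong) auto
        then have "c (\<lambda>j. \<beta> j + \<gamma> j) = 0"
          using less \<beta>(1) \<gamma> by (intro low) (auto simp: multi_indices_def)
        then show ?thesis by (simp add: recenter_term_def)
      qed
      then have "c' \<beta> = 0" unfolding c'_def recentered_def by (intro infsum_0) auto
      then show False using \<beta>(2) by simp
    qed
    have c'0: "c' \<alpha>0 \<noteq> 0" unfolding c'_def by (rule e(2)[OF pe])
    have sum_I: "(\<Sum>j\<in>?I. \<alpha> j) = (\<Sum>j\<in>?Il. \<alpha> j) + (\<Sum>j\<in>?Ir. \<alpha> j)" for \<alpha> :: "nat + nat \<Rightarrow> nat"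
      by (rule sum_split_sel) simp
    have 1: "vanishing_order ?I G p = enat \<mu>"
    proof (rule vanishing_order_eqI[OF finite_coords T _ \<alpha>0(1) c'0])
      show "(\<Sum>j\<in>?I. \<alpha>0 j) = \<mu>" using sum_I \<alpha>0 by simp
      show "\<mu> \<le> (\<Sum>j\<in>?I. \<alpha> j)" if "\<alpha> \<in> ?M" "c' \<alpha> \<noteq> 0" for \<alpha>
        using low'[OF that] sum_I[of \<alpha>] by simp
    qed
    \<comment> \<open>With no displacement in \<open>t\<close>, exactly the Taylor terms without
      \<open>t\<close>-exponents remain. The term \<open>\<alpha>0\<close> is among them, so the
      restriction to \<open>x\<close> attains the same order.\<close>
    define c'' where "c'' \<gamma> = c' (case_sum (\<lambda>_. 0) \<gamma>)" for \<gamma>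
    have Ir: "(\<Sum>j\<in>?Ir. case_sum (\<lambda>_. 0) \<gamma> j) = (\<Sum>j\<in>{1..n}. \<gamma> j)" for \<gamma> :: "nat \<Rightarrow> nat"
      unfolding coords_isl_split by (simp add: sum.reindex)
    have memI: "case_sum (\<lambda>_. 0) \<gamma> \<in> ?M" if "\<gamma> \<in> multi_indices {1..n}" for \<gamma>
      using that by (auto simp: multi_indices_def coords_def split: sum.splits)
    have T': "has_taylor {1..n} (\<lambda>x. G (case_sum t x)) (\<lambda>_. 0) c''"
    proof -
      obtain r where r: "r > 0" "\<And>z. z \<in> polydisc ?I p r \<Longrightarrow>
        ((\<lambda>\<alpha>. c' \<alpha> * (\<Prod>j\<in>?I. (z j - p j) ^ \<alpha> j)) has_sum G z) ?M"
        using T unfolding has_taylor_def eventually_coord_nhds by blast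
      show ?thesis unfolding has_taylor_def eventually_coord_nhds
      proof (intro exI[of _ r] conjI ballI r(1))
        fix x assume x: "x \<in> polydisc {1..n} (\<lambda>_. 0 :: 'k) r"
        have "case_sum t x \<in> polydisc ?I p r"
          using x r(1) by (auto simp: polydisc_def coords_def p_def)
        note sum = r(2)[OF this]
        let ?f = "\<lambda>\<alpha>. c' \<alpha> * (\<Prod>j\<in>?I. (case_sum t x j - p j) ^ \<alpha> j)"
        have inj: "inj_on (case_sum (\<lambda>_. 0)) (multi_indices {1..n})"
          by (rule inj_onI) (metis case_sum_inject)
        have zero: "?f \<alpha> = 0" if \<alpha>: "\<alpha> \<in> ?M - case_sum (\<lambda>_. 0) ` multi_indices {1..n}" for \<alpha>
        proof -
          have "\<exists>a\<in>{1..m}. \<alpha> (Inl a) \<noteq> 0"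
          proof (rule ccontr)
            assume no: "\<not> ?thesis"
            have "\<alpha> = case_sum (\<lambda>_. 0) (\<lambda>b. \<alpha> (Inr b))"
            proof
              fix j show "\<alpha> j = case_sum (\<lambda>_. 0) (\<lambda>b. \<alpha> (Inr b)) j"
                using no \<alpha> by (cases j) (auto simp: multi_indices_def coords_def)
            qed
            moreover have "(\<lambda>b. \<alpha> (Inr b)) \<in> multi_indices {1..n}"
              using \<alpha> by (auto simp: multi_indices_def coords_def)
            ultimately show False using \<alpha> by blast
          qed
          then obtain a where a: "a \<in> {1..m}" "\<alpha> (Inl a) \<noteq> 0" by blast
          then have "(\<Prod>j\<in>?I. (case_sum t x j - p j) ^ \<alpha> j) = 0"
            by (intro prod_zero[OF finite_coords] bexI[of _ "Inl a"]) (auto simp: p_def coords_def)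
          then show ?thesis by simp
        qed
        have "(?f has_sum G (case_sum t x)) (case_sum (\<lambda>_. 0) ` multi_indices {1..n})"
          using sum by (rule iffD1[OF has_sum_cong_neutral, rotated -1]) (use zero memI in auto)
        then have slice_sum: "((?f \<circ> case_sum (\<lambda>_. 0)) has_sum G (case_sum t x)) (multi_indices {1..n})"
          by (simp only: has_sum_reindex[OF inj])
        have "(?f \<circ> case_sum (\<lambda>_. 0)) \<gamma> = c'' \<gamma> * (\<Prod>j\<in>{1..n}. (x j - 0) ^ \<gamma> j)" for \<gamma>
        proof -
          have I: "?I = Inl ` {1..m} \<union> Inr ` {1..n}" by (auto simp: coords_def)
          have "(\<Prod>j\<in>?I. (case_sum t x j - p j) ^ case_sum (\<lambda>_. 0) \<gamma> j) =
            (\<Prod>j\<in>Inl ` {1..m}. (case_sum t x j - p j) ^ case_sum (\<lambda>_. 0) \<gamma> j) *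
            (\<Prod>j\<in>Inr ` {1..n}. (case_sum t x j - p j) ^ case_sum (\<lambda>_. 0) \<gamma> j)"
            unfolding I by (rule prod.union_disjoint) auto
          also have "\<dots> = (\<Prod>j\<in>{1..n}. (x j - 0) ^ \<gamma> j)"
            by (simp add: prod.reindex p_def)
          finally show ?thesis by (simp add: c''_def)
        qed
        then have "?f \<circ> case_sum (\<lambda>_. 0) = (\<lambda>\<gamma>. c'' \<gamma> * (\<Prod>j\<in>{1..n}. (x j - 0) ^ \<gamma> j))"
          by (rule ext)
        from slice_sum[unfolded this] show "((\<lambda>\<alpha>. c'' \<alpha> * (\<Prod>j\<in>{1..n}. (x j - 0) ^ \<alpha> j)) has_sum G (case_sum t x)) (multi_indices {1..n})"
          .
      qed
    qed
    have \<alpha>0_eq: "\<alpha>0 = case_sum (\<lambda>_. 0) (\<lambda>b. \<alpha>0 (Inr b))"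
    proof
      fix j
      have "\<alpha>0 j = 0" if "j \<in> ?Il" using \<alpha>0(3) that by simp
      then show "\<alpha>0 j = case_sum (\<lambda>_. 0) (\<lambda>b. \<alpha>0 (Inr b)) j"
        using \<alpha>0(1) by (cases j) (auto simp: multi_indices_def coords_def)
    qed
    have 2: "vanishing_order {1..n} (\<lambda>x. G (case_sum t x)) (\<lambda>_. 0) = enat \<mu>"
    proof (rule vanishing_order_eqI[OF _ T'])
      show "(\<lambda>b. \<alpha>0 (Inr b)) \<in> multi_indices {1..n}"
        using \<alpha>0(1) by (auto simp: multi_indices_def coords_def)
      show "c'' (\<lambda>b. \<alpha>0 (Inr b)) \<noteq> 0" using c'0 by (simp only: c''_def \<alpha>0_eq[symmetric] not_False_eq_True)
      show "(\<Sum>j\<in>{1..n}. \<alpha>0 (Inr j)) = \<mu>" using Ir[of "\<lambda>b. \<alpha>0 (Inr b)"] \<alpha>0(2) by (simp only: \<alpha>0_eq[symmetric])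
      show "\<mu> \<le> (\<Sum>j\<in>{1..n}. \<gamma> j)" if "\<gamma> \<in> multi_indices {1..n}" "c'' \<gamma> \<noteq> 0" for \<gamma>
        using low'[OF memI[OF that(1)]] that(2) Ir by (simp add: c''_def)
    qed simp
    show ?thesis using 1 2 by (simp add: p_def)
  qed
  have origin: "vanishing_order ?I G (\<lambda>_. 0) = enat \<mu>"
  proof -
    have "(\<lambda>_. 0) \<in> polydisc {1..m} (\<lambda>_. 0 :: 'k) \<epsilon>" using \<epsilon>(1) by (simp add: polydisc_def)
    from conjunct1[OF main[OF this]]
    have "vanishing_order ?I G (case_sum (\<lambda>_. 0) (\<lambda>_. 0)) = enat \<mu>" .
    moreover have "case_sum (\<lambda>_. 0) (\<lambda>_. 0) = (\<lambda>_ :: nat + nat. 0 :: 'k)"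
      by (auto simp: fun_eq_iff split: sum.splits)
    ultimately show ?thesis by simp
  qed
  show ?thesis unfolding eventually_coord_nhds
  proof (intro exI[of _ \<epsilon>] conjI ballI \<epsilon>(1))
    fix t :: "nat \<Rightarrow> 'k" assume "t \<in> polydisc {1..m} (\<lambda>_. 0) \<epsilon>"
    from main[OF this]
    show "vanishing_order ?I G (case_sum t (\<lambda>_. 0)) = vanishing_order {1..n} (\<lambda>x. G (case_sum t x)) (\<lambda>_. 0)"
      "vanishing_order ?I G (case_sum t (\<lambda>_. 0)) = vanishing_order ?I G (\<lambda>_. 0)"
      by (simp_all only: origin)
  qed
qed

end

interpretation complex_embedding_real: complex_embedding complex_of_real
  by (rule complex_embedding.intro) (simp_all add: bounded_linear_of_real)

interpretation complex_embedding_complex: complex_embedding "\<lambda>z::complex. z"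
  by (rule complex_embedding.intro) (simp_all add: bounded_linear_ident)

theorem proposition3p6:
  shows
    "(\<forall>m n U V d A (F :: nat \<Rightarrow> (nat + nat \<Rightarrow> real) \<Rightarrow> real) G.
       zariski_equisingular m n U V d A F \<longrightarrow>
       K_analytic_at (coords m n) G (\<lambda>_. 0) \<longrightarrow>
       germ_dvd (coords m n) G (F n) \<longrightarrow>
       (\<forall>\<^sub>F t in coord_nhds {1..m} (\<lambda>_. 0).
          vanishing_order (coords m n) G (case_sum t (\<lambda>_. 0)) = vanishing_order {1..n} (\<lambda>x. G (case_sum t x)) (\<lambda>_. 0) \<and>
          vanishing_order (coords m n) G (case_sum t (\<lambda>_. 0)) = vanishing_order (coords m n) G (\<lambda>_. 0))) \<and>
     (\<forall>m n U V d A (F :: nat \<Rightarrow> (nat + nat \<Rightarrow> complex) \<Rightarrow> complex) G.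
       zariski_equisingular m n U V d A F \<longrightarrow>
       K_analytic_at (coords m n) G (\<lambda>_. 0) \<longrightarrow>
       germ_dvd (coords m n) G (F n) \<longrightarrow>
       (\<forall>\<^sub>F t in coord_nhds {1..m} (\<lambda>_. 0).
          vanishing_order (coords m n) G (case_sum t (\<lambda>_. 0)) = vanishing_order {1..n} (\<lambda>x. G (case_sum t x)) (\<lambda>_. 0) \<and>
          vanishing_order (coords m n) G (case_sum t (\<lambda>_. 0)) = vanishing_order (coords m n) G (\<lambda>_. 0)))"
  using complex_embedding_real.multiplicity_constant complex_embedding_complex.multiplicity_constant
  by (intro conjI allI impI)

end
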